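(* Let $m\ge 3$ be an integer and let $U_1,U_2,\ldots$ be independent points uniformly distributed on the unit circumference $\mathbb{S}$. For $n\ge m$ let $\mathrm{area}_n^m$ be the minimal area among all circumscribed $m$-polygons determined by $m$-element subsets $\{U_{i_1},\ldots,U_{i_m}\}$, $1\le i_1<\ldots<i_m\le n$, where the circumscribed $m$-polygon determined by such a subset is the one bounded by the tangents to $\mathbb{S}$ at these points. Then for each $t>0$ $$\lim_{n\to\infty}P\left\{n^{\frac{2m}{m-1}}\left(\mathrm{area}_n^m-m\tan\frac{\pi}{m}\right)\le t\right\}=1-\exp\left\{-\frac{t^{\frac{m-1}{2}}}{K_{4m}}\right\},$$ where $$K_{4m}=m^{\frac32}\left(\pi\left(1+\tan^2\frac{\pi}{m}\right)\tan\frac{\pi}{m}\right)^{\frac{m-1}{2}}\Gamma\left(\frac{m+1}{2}\right).$$ The rate of convergence is $O\left(n^{-\frac{1}{m-1}}\right)$; that is, for each fixed $t>0$ the absolute difference between the probability on the left and its limit is $O\left(n^{-\frac{1}{m-1}}\right)$ as $n\to\infty$.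
   Context: The unit circumference $\mathbb{S}$ is the circle of radius $1$ in the plane. Given $m$ distinct points of $\mathbb{S}$, listed in cyclic order along the circle as $u_1,\ldots,u_m$ (with $u_{m+1}=u_1$), draw the tangent lines to $\mathbb{S}$ at these points and let $v_k$ be the intersection point of the tangents at $u_k$ and $u_{k+1}$, $k=1,\ldots,m$. The points determine a convex circumscribed $m$-polygon, with vertices $v_1,\ldots,v_m$, exactly when they are not all contained in a closed semicircle (equivalently, every arc between cyclically consecutive points has length less than $\pi$); only such $m$-subsets are taken into account in the minimum, and the minimum over the empty collection is $+\infty$. $\Gamma$ is Euler's gamma function. Here $m$ is fixed as $n\to\infty$. *)

theory Defs
  imports "HOL-Probability.Probability" "HOL-Library.Landau_Symbols"
begin

text \<open>The plane is the type of complex numbers; its Lebesgue measure is the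
  two-dimensional one.\<close>

definition uniform_circle :: "complex measure" where
  "uniform_circle = distr (uniform_measure lborel {0..<2 * pi}) borel cis"

definition tangent_line :: "complex \<Rightarrow> complex set" where
  "tangent_line u = {z. (z - u) \<bullet> u = 0}"

text \<open>For points of the unit circle, \<open>Arg2pi (w / u)\<close> is the length in \<open>[0, 2\<pi>)\<close> of the
  counterclockwise arc from \<open>u\<close> to \<open>w\<close>. So \<open>cyclic_succ A u w\<close> says that
  \<open>w\<close> is the first other point of \<open>A\<close> met when moving counterclockwise from \<open>u\<close>.\<close>

definition cyclic_succ :: "complex set \<Rightarrow> complex \<Rightarrow> complex \<Rightarrow> bool" where
  "cyclic_succ A u w \<longleftrightarrow>
     u \<in> A \<and> w \<in> A - {u} \<and> (\<forall>x\<in>A - {u}. Arg2pi (w / u) \<le> Arg2pi (x / u))"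

definition closed_semicircle :: "complex \<Rightarrow> complex set" where
  "closed_semicircle d = {z \<in> sphere 0 1. z \<bullet> d \<ge> 0}"

definition determines_polygon :: "complex set \<Rightarrow> bool" where
  "determines_polygon A \<longleftrightarrow>
     A \<subseteq> sphere 0 1 \<and> \<not> (\<exists>d\<in>sphere 0 1. A \<subseteq> closed_semicircle d)"

definition polygon_vertices :: "complex set \<Rightarrow> complex set" where
  "polygon_vertices A = (\<Union>(u, w)\<in>{(u, w). cyclic_succ A u w}. tangent_line u \<inter> tangent_line w)"

text \<open>Only meaningful for finite \<open>A\<close> with \<open>determines_polygon A\<close>:
  the polygon is then convex, hence the hull of its vertices.\<close>

definition circumscribed_polygon :: "complex set \<Rightarrow> complex set" where
  "circumscribed_polygon A = convex hull (polygon_vertices A)"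

text \<open>The points are \<open>u 1, \<dots>, u n\<close>. In \<open>ereal\<close> the infimum of the empty family is \<open>\<infinity>\<close>;
  otherwise the family is finite and the infimum is a minimum.\<close>

definition min_area :: "nat \<Rightarrow> nat \<Rightarrow> (nat \<Rightarrow> complex) \<Rightarrow> ereal" where
  "min_area m n u =
     (INF I\<in>{I. I \<subseteq> {1..n} \<and> card I = m \<and> inj_on u I \<and> determines_polygon (u ` I)}.
        ereal (measure lebesgue (circumscribed_polygon (u ` I))))"

definition K4 :: "nat \<Rightarrow> real" where
  "K4 m = real m powr (3 / 2)
     * (pi * (1 + (tan (pi / real m))\<^sup>2) * tan (pi / real m)) powr ((real m - 1) / 2)
     * Gamma ((real m + 1) / 2)"

end

theory Submission
  imports Defs
begin

text \<open>
  Write the points as \<open>cis \<theta>\<^sub>i\<close> with independent uniform angles. The triangles spanned by the centre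
  and two consecutive vertices show that a circumscribed polygon with gaps \<open>g\<^sub>1, \<dots>, g\<^sub>m < \<pi>\<close> between
  consecutive tangent points has area \<open>\<Sum> tan (g\<^sub>k / 2)\<close>. Convexity of the tangent turns
  \<open>area \<le> m tan (\<pi> / m) + e\<close> into \<open>\<Sum> (g\<^sub>k - 2\<pi> / m)\<^sup>2 \<le> e (1 + O(\<surd>e)) / \<kappa>\<close> with
  \<open>\<kappa> = T (1 + T\<^sup>2) / 4\<close> and \<open>T = tan (\<pi> / m)\<close>, and this is an ellipsoid in \<open>m - 1\<close> dimensions, whose
  volume gives the probability that \<open>m\<close> given points determine such a polygon.

  If \<open>m\<close>-sets \<open>I\<close> and \<open>J\<close> with a common point both do, then all angles of \<open>I \<union> J\<close> are within
  \<open>O(\<surd>e)\<close> of the same translate of \<open>(2\<pi> / m) \<int>\<close>, which has probability \<open>O(\<surd>e)\<close> to the power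
  \<open>card (I \<union> J) - 1\<close>. Hence the number of good \<open>m\<close>-sets is asymptotically Poisson by the Chen--Stein method, and the largest error
  term, of order \<open>n\<close> to the power \<open>-1 / (m - 1)\<close>, comes from pairs with \<open>card (I \<union> J) = m + 1\<close>.
\<close>

text \<open>The scale: with \<open>r = n powr (- 1 / (m - 1))\<close> one has
  \<open>n * r ^ (m - 1) = 1\<close>, and the excess is \<open>e = t * (r ^ m)\<^sup>2\<close>.
  Configurations of \<open>u\<close> points whose angles, relative to one of them, are confined to
  within order \<open>sqrt e\<close> have expected number of order
  \<open>n ^ u * (r ^ m) ^ (u - 1) = r ^ (u - m)\<close>. For \<open>u = m\<close> this is the
  finite limiting intensity; every further point of an overlapping pair costs a factor
  \<open>r\<close>. The constant: about \<open>n ^ m / m!\<close> sets carry \<open>m!\<close>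
  orders each, so the factorials cancel and the intensity is a volume for one order, divided by
  \<open>(2 * pi) ^ m\<close>. Angles are cut at 0, so in increasing order the first one ranges over
  an interval of length close to \<open>2 * pi / m\<close>; given it, the other \<open>m - 1\<close>
  fill an ellipsoid whose volume does not depend on it. The obstacle: a Taylor expansion of the
  tangent says nothing about gaps far from \<open>2 * pi / m\<close>. A cruder inequality that is
  valid for all gaps below \<pi> has to confine them first; only then does the expansion give the
  sharp constant.\<close>

section \<open>Poisson approximation by the Chen--Stein method\<close>

text \<open>Taking \<open>f (Suc k)\<close> to be the integral of
  \<open>u ^ k * exp (- l * u)\<close> over \<open>{0..1}\<close> turns the Stein equation for the
  event "count 0" into an integration by parts and makes the bounds evident. \<open>f 0\<close>
  enters the equation with factor 0, so its value 0 is a convention.\<close>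

lemma stein_solution_zero:
  fixes l :: real
  assumes "l > 0"
  obtains f :: "nat \<Rightarrow> real"
  where "\<And>k. 0 \<le> f k" "\<And>k. f k \<le> 1"
    "\<And>k. l * f (Suc k) - real k * f k = of_bool (k = 0) - exp (- l)"
proof -
  define g where "g k = integral {0..1} (\<lambda>u::real. u ^ k * exp (- l * u))" for k :: nat
  define f where "f k = (case k of 0 \<Rightarrow> 0 | Suc j \<Rightarrow> g j)" for k
  have int: "(\<lambda>u::real. u ^ k * exp (- l * u)) integrable_on {0..1}" for k
    by (intro integrable_continuous_real continuous_intros)
  have g0: "0 \<le> g k" for k unfolding g_def by (intro integral_nonneg int) auto
  have g1: "g k \<le> 1" for k
  proof -
    have "g k \<le> integral {0..1} (\<lambda>u::real. 1)" unfolding g_def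
      using \<open>l > 0\<close> by (intro integral_le int) (auto intro!: mult_le_one power_le_one)
    then show ?thesis by simp
  qed
  have rec: "l * g (Suc k) = - exp (- l) + real (Suc k) * g k" for k
  proof -
    have "((\<lambda>u. real (Suc k) * (u ^ k * exp (- l * u)) - l * (u ^ Suc k * exp (- l
        * u))) has_integral
       (1 ^ Suc k * exp (- l * 1) - 0 ^ Suc k * exp (- l * 0))) {0..1}"
      by (intro fundamental_theorem_of_calculus)
         (auto intro!: derivative_eq_intros simp flip: has_real_derivative_iff_has_vector_derivative
            simp: algebra_simps simp del: power_Suc)
    moreover have "((\<lambda>u. real (Suc k) * (u ^ k * exp (- l * u)) - l * (u ^ Suc k * exp (- l
        * u))) has_integral
       (real (Suc k) * g k - l * g (Suc k))) {0..1}"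
      unfolding g_def
      by (intro has_integral_diff has_integral_mult_right integrable_integral int)
    ultimately have "real (Suc k) * g k - l * g (Suc k)
        = 1 ^ Suc k * exp (- l * 1) - 0 ^ Suc k * exp (- l * 0)"
      by (rule has_integral_unique[symmetric])
    then show ?thesis by simp
  qed
  have rec0: "l * g 0 = 1 - exp (- l)"
  proof -
    have "((\<lambda>u. l * (u ^ 0 * exp (- l * u))) has_integral (- exp (- l * 1) - (- exp (- l
        * 0)))) {0..1}"
      by (intro fundamental_theorem_of_calculus)
         (auto intro!: derivative_eq_intros simp flip: has_real_derivative_iff_has_vector_derivative
            simp: algebra_simps)
    moreover have "((\<lambda>u. l * (u ^ 0 * exp (- l * u))) has_integral l * g 0) {0..1}"
      unfolding g_def by (intro has_integral_mult_right integrable_integral int)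
    ultimately have "l * g 0 = - exp (- l * 1) - (- exp (- l * 0))"
      using has_integral_unique by blast
    then show ?thesis by simp
  qed
  show ?thesis
  proof
    show "0 \<le> f k" for k by (auto simp: f_def g0 split: nat.splits)
    show "f k \<le> 1" for k by (auto simp: f_def g1 split: nat.splits)
    show "l * f (Suc k) - real k * f k = of_bool (k = 0) - exp (- l)" for k
      using rec rec0 by (cases k) (auto simp: f_def)
  qed
qed

context prob_space
begin

lemma measurable_count_events:
  assumes "finite J" "\<And>i. i \<in> J \<Longrightarrow> E i \<in> events"
  shows "(\<lambda>\<omega>. card {i \<in> J. \<omega> \<in> E i}) \<in> measurable M (count_space UNIV)"
  using assms
proof (induction J rule: finite_induct)
  case (insert a J)
  have "card {i \<in> insert a J. \<omega> \<in> E i} = (if \<omega> \<in> E a then Suc (card {i \<in> J. \<omega> \<in> E i}) else card {i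
      \<in> J. \<omega> \<in> E i})" for \<omega>
  proof -
    have "{i \<in> insert a J. \<omega> \<in> E i} = (if \<omega> \<in> E a then insert a {i \<in> J. \<omega> \<in> E i} else {i \<in> J. \<omega>
        \<in> E i})" by auto
    then show ?thesis using insert by auto
  qed
  moreover have [measurable]: "(\<lambda>\<omega>. card {i \<in> J. \<omega> \<in> E i}) \<in> measurable M (count_space UNIV)"
    using insert by auto
  moreover have [measurable]: "E a \<in> events" using insert by auto
  ultimately show ?case by simp
qed auto

text \<open>\<open>N i\<close> is the dependence neighbourhood of \<open>E i\<close>. The Stein
  equation is evaluated at the number \<open>W\<close> of events that occur and averaged; in the
  \<open>i\<close>-th summand \<open>W\<close> is compared with the count \<open>V i\<close> of
  events outside \<open>N i\<close>, which is independent of \<open>E i\<close>.\<close>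

lemma poisson_approximation_none:
  fixes E :: "'i \<Rightarrow> 'a set" and N :: "'i \<Rightarrow> 'i set" and l :: real
  assumes J: "finite J" and E: "\<And>i. i \<in> J \<Longrightarrow> E i \<in> events"
    and N: "\<And>i. i \<in> J \<Longrightarrow> i \<in> N i" "\<And>i. i \<in> J \<Longrightarrow> N i \<subseteq> J"
    and indep: "\<And>i (g :: nat \<Rightarrow> real). i \<in> J \<Longrightarrow> (\<And>k. \<bar>g k\<bar> \<le> 1) \<Longrightarrow>
      expectation (\<lambda>\<omega>. indicator (E i) \<omega> * g (card {j \<in> J - N i. \<omega> \<in> E j}))
        = prob (E i) * expectation (\<lambda>\<omega>. g (card {j \<in> J - N i. \<omega> \<in> E j}))"
    and l: "l > 0"
  shows "\<bar>prob {\<omega> \<in> space M. \<forall>i\<in>J. \<omega> \<notin> E i} - exp (- l)\<bar>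
    \<le> \<bar>l - (\<Sum>i\<in>J. prob (E i))\<bar> + (\<Sum>i\<in>J. \<Sum>j\<in>N i. prob (E i) * prob (E j))
      + (\<Sum>i\<in>J. \<Sum>j\<in>N i - {i}. prob (E i \<inter> E j))"
proof -
  obtain f :: "nat \<Rightarrow> real" where f0: "\<And>k. 0 \<le> f k" and f1: "\<And>k. f k \<le> 1"
    and f: "\<And>k. l * f (Suc k) - real k * f k = of_bool (k = 0) - exp (- l)"
    using stein_solution_zero[OF l] by blast
  \<comment> \<open>Distinct naturals are at least 1 apart, so the bounds 0 and 1 already give
    Lipschitz constant 1.\<close>
  have flip: "\<bar>f a - f b\<bar> \<le> \<bar>real a - real b\<bar>" for a b
    using f0[of a] f1[of a] f0[of b] f1[of b] by (cases "a = b") auto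
  define W where "W \<omega> = card {i \<in> J. \<omega> \<in> E i}" for \<omega>
  define V where "V i \<omega> = card {j \<in> J - N i. \<omega> \<in> E j}" for i \<omega>
  have [measurable]: "W \<in> measurable M (count_space UNIV)"
    unfolding W_def by (intro measurable_count_events J E)
  have [measurable]: "V i \<in> measurable M (count_space UNIV)" for i
    unfolding V_def using J E by (intro measurable_count_events) auto
  have bdd: "integrable M (\<lambda>\<omega>. h \<omega>)" if "h \<in> borel_measurable M" "\<And>\<omega>. \<bar>h \<omega>\<bar>
      \<le> 1" for h :: "'a \<Rightarrow> real"
    using that by (intro integrable_const_bound[of _ 1]) auto
  have f_abs: "\<bar>f k\<bar> \<le> 1" for k using f0[of k] f1[of k] by auto
  have ind_int[simp]: "integrable M (indicator (E i) :: 'a \<Rightarrow> real)" if "i \<in> J" for i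
    using E[OF that] by (auto simp: integrable_indicator_iff less_top[symmetric])
  have intW: "integrable M (\<lambda>\<omega>. f (Suc (W \<omega>)))" "integrable M (\<lambda>\<omega>. f (W \<omega>))"
    by (auto intro!: bdd f_abs)
  have intV: "integrable M (\<lambda>\<omega>. f (Suc (V i \<omega>)))" for i by (auto intro!: bdd f_abs)
  have prodint: "integrable M (\<lambda>\<omega>. indicator (E i) \<omega> * f (h \<omega>))"
    if "i \<in> J" "h \<in> measurable M (count_space UNIV)" for i h
  proof (rule bdd)
    have [measurable]: "E i \<in> events" using E that by auto
    note that(2)[measurable]
    show "(\<lambda>\<omega>. indicator (E i) \<omega> * f (h \<omega>)) \<in> borel_measurable M" by measurable
  qed (use f_abs in \<open>auto simp: indicator_def\<close>)
  have SucV: "(\<lambda>\<omega>. Suc (V i \<omega>)) \<in> measurable M (count_space UNIV)" for i by measurable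
  \<comment> \<open>The subtracted part, with \<open>V i + 1\<close> in place of both
    \<open>W + 1\<close> and \<open>W\<close>, has mean 0 by independence, so \<open>D i\<close>
    keeps the mean of the Stein summand.\<close>
  define D where "D i \<omega> = (prob (E i) * f (Suc (W \<omega>)) - indicator (E i) \<omega> * f (W \<omega>))
     - (prob (E i) * f (Suc (V i \<omega>)) - indicator (E i) \<omega> * f (Suc (V i \<omega>)))" for i \<omega>
  \<comment> \<open>\<open>W + 1\<close> and \<open>V i + 1\<close> differ by the number of events
    in \<open>N i\<close>; on \<open>E i\<close> the event \<open>i\<close> itself accounts for the
    1, so \<open>W\<close> and \<open>V i + 1\<close> differ by the number of the others.\<close>
  define B where "B i \<omega> = prob (E i) * (\<Sum>j\<in>N i. indicator (E j) \<omega>)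
     + (\<Sum>j\<in>N i - {i}. indicator (E i \<inter> E j) \<omega> :: real)" for i \<omega>
  have DB: "\<bar>D i \<omega>\<bar> \<le> B i \<omega>" if i: "i \<in> J" for i \<omega>
  proof -
    have fin: "finite (N i)" using N(2)[OF i] J finite_subset by blast
    have W1: "real (W \<omega>) - real (V i \<omega>) = (\<Sum>j\<in>N i. indicator (E j) \<omega>)"
    proof -
      have "{i \<in> J. \<omega> \<in> E i} = {j \<in> J - N i. \<omega> \<in> E j} \<union> {j \<in> N i. \<omega> \<in> E j}" using N(2)[OF i] by auto
      then have "W \<omega> = V i \<omega> + card {j \<in> N i. \<omega> \<in> E j}" unfolding W_def V_def
        using J fin by (subst card_Un_disjoint[symmetric]) auto
      moreover have "real (card {j \<in> N i. \<omega> \<in> E j}) = (\<Sum>j\<in>N i. indicator (E j) \<omega>)"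
        using fin by (simp add: indicator_def sum.If_cases Int_def)
      ultimately show ?thesis by simp
    qed
    have a: "\<bar>prob (E i) * f (Suc (W \<omega>)) - prob (E i) * f (Suc (V i \<omega>))\<bar>
        \<le> prob (E i) * (\<Sum>j\<in>N i. indicator (E j) \<omega>)"
    proof -
      have "\<bar>f (Suc (W \<omega>)) - f (Suc (V i \<omega>))\<bar> \<le> (\<Sum>j\<in>N i. indicator (E j) \<omega>)"
        using flip[of "Suc (W \<omega>)" "Suc (V i \<omega>)"] unfolding W1[symmetric]
        using W1 by (smt (verit) indicator_pos_le of_nat_Suc sum_nonneg)
      then show ?thesis
        unfolding right_diff_distrib[symmetric] abs_mult by (simp add: mult_left_mono)
    qed
    have b: "\<bar>indicator (E i) \<omega> * f (W \<omega>) - indicator (E i) \<omega> * f (Suc (V i \<omega>))\<bar>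
        \<le> (\<Sum>j\<in>N i - {i}. indicator (E i \<inter> E j) \<omega> :: real)"
    proof (cases "\<omega> \<in> E i")
      case True
      have "(\<Sum>j\<in>N i. indicator (E j) \<omega> :: real) = 1 + (\<Sum>j\<in>N i - {i}. indicator (E j) \<omega>)"
        using fin N(1)[OF i] True by (subst sum.remove[of _ i]) auto
      also have "(\<Sum>j\<in>N i - {i}. indicator (E j) \<omega>)
          = (\<Sum>j\<in>N i - {i}. indicator (E i \<inter> E j) \<omega> :: real)"
        using True by (intro sum.cong) (auto simp: indicator_def)
      finally have "real (W \<omega>) - real (Suc (V i \<omega>))
          = (\<Sum>j\<in>N i - {i}. indicator (E i \<inter> E j) \<omega> :: real)"
        using W1 by simp
      moreover have "0 \<le> (\<Sum>j\<in>N i - {i}. indicator (E i \<inter> E j) \<omega> :: real)" by (intro sum_nonneg) auto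
      ultimately show ?thesis using flip[of "W \<omega>" "Suc (V i \<omega>)"] True by simp
    qed auto
    show ?thesis using a b unfolding D_def B_def by linarith
  qed
  have finN: "finite (N i)" if "i \<in> J" for i using N(2)[OF that] J finite_subset by blast
  have EJ: "E j \<in> events" if "i \<in> J" "j \<in> N i" for i j using N(2) E that by auto
  have NJ: "j \<in> J" if "i \<in> J" "j \<in> N i" for i j using N(2) that by auto
  have intB: "integrable M (B i)" if i: "i \<in> J" for i
  proof -
    have "integrable M (\<lambda>\<omega>. \<Sum>j\<in>N i. indicator (E j) \<omega> :: real)"
      by (intro Bochner_Integration.integrable_sum ind_int NJ[OF i])
    moreover have "integrable M (\<lambda>\<omega>. \<Sum>j\<in>N i - {i}. indicator (E i \<inter> E j) \<omega> :: real)"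
    proof (intro Bochner_Integration.integrable_sum)
      fix j assume "j \<in> N i - {i}"
      then have "E i \<inter> E j \<in> events" using EJ[OF i] E[OF i] by auto
      then show "integrable M (indicator (E i \<inter> E j) :: 'a \<Rightarrow> real)"
        by (auto simp: integrable_indicator_iff less_top[symmetric])
    qed
    ultimately show ?thesis unfolding B_def
      by (intro Bochner_Integration.integrable_add Bochner_Integration.integrable_mult_right)
  qed
  have EB: "expectation (B i) = (\<Sum>j\<in>N i. prob (E i) * prob (E j))
      + (\<Sum>j\<in>N i - {i}. prob (E i \<inter> E j))"
    if i: "i \<in> J" for i
  proof -
    have 1: "integrable M (\<lambda>\<omega>. \<Sum>j\<in>N i. indicator (E j) \<omega> :: real)"
      using NJ i by (intro Bochner_Integration.integrable_sum ind_int)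
    have 2: "integrable M (indicator (E i \<inter> E j) :: 'a \<Rightarrow> real)" if "j \<in> N i - {i}" for j
      using that EJ[OF i] E[OF i] by (auto simp: integrable_indicator_iff less_top[symmetric])
    have 3: "expectation (indicator (E j)) = prob (E j)" if "j \<in> N i" for j
      using EJ[OF i that] by simp
    have 4: "expectation (indicator (E i \<inter> E j)) = prob (E i \<inter> E j)" if "j \<in> N i - {i}" for j
      using that EJ[OF i] E[OF i] by simp
    have "expectation (B i) = prob (E i) * expectation (\<lambda>\<omega>. \<Sum>j\<in>N i. indicator (E j) \<omega>)
        + expectation (\<lambda>\<omega>. \<Sum>j\<in>N i - {i}. indicator (E i \<inter> E j) \<omega>)"
      unfolding B_def using 1 2
      by (subst Bochner_Integration.integral_add) (auto intro!: Bochner_Integration.integrable_sum)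
    also have "expectation (\<lambda>\<omega>. \<Sum>j\<in>N i. indicator (E j) \<omega>) = (\<Sum>j\<in>N i. prob (E j))"
      using 3 NJ[OF i] by (subst Bochner_Integration.integral_sum) (auto intro!: sum.cong)
    also have "expectation (\<lambda>\<omega>. \<Sum>j\<in>N i - {i}. indicator (E i \<inter> E j) \<omega>)
        = (\<Sum>j\<in>N i - {i}. prob (E i \<inter> E j))"
      using 4 2 by (subst Bochner_Integration.integral_sum) (auto intro!: sum.cong)
    finally show ?thesis by (simp add: sum_distrib_left)
  qed
  have intD: "integrable M (D i)" if "i \<in> J" for i
    unfolding D_def using that intW intV SucV
        by (auto intro!: Bochner_Integration.integrable_diff prodint)
  have ED: "expectation (D i) = expectation (\<lambda>\<omega>. prob (E i) * f (Suc (W \<omega>)) - indicator (E i) \<omega>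
      * f (W \<omega>))"
    if i: "i \<in> J" for i
  proof -
    have "expectation (\<lambda>\<omega>. indicator (E i) \<omega> * f (Suc (V i \<omega>)))
        = prob (E i) * expectation (\<lambda>\<omega>. f (Suc (V i \<omega>)))"
      using indep[OF i, of "\<lambda>k. f (Suc k)"] f_abs unfolding V_def by auto
    then show ?thesis unfolding D_def using i intW intV SucV[of i]
      by (subst Bochner_Integration.integral_diff)
         (auto intro!: Bochner_Integration.integrable_diff prodint simp: prodint)
  qed
  \<comment> \<open>This is the Stein equation at \<open>k = W \<omega>\<close>, with
    \<open>l\<close> split into the expected count and the remaining discrepancy.\<close>
  have key: "of_bool (W \<omega> = 0) - exp (- l) = (l - (\<Sum>i\<in>J. prob (E i))) * f (Suc (W \<omega>))
      + (\<Sum>i\<in>J. prob (E i) * f (Suc (W \<omega>)) - indicator (E i) \<omega> * f (W \<omega>))" for \<omega>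
  proof -
    have "real (W \<omega>) = (\<Sum>i\<in>J. indicator (E i) \<omega>)"
      using J by (simp add: W_def indicator_def sum.If_cases Int_def)
    then have "(\<Sum>i\<in>J. prob (E i) * f (Suc (W \<omega>)) - indicator (E i) \<omega> * f (W \<omega>))
      = (\<Sum>i\<in>J. prob (E i)) * f (Suc (W \<omega>)) - real (W \<omega>) * f (W \<omega>)"
      by (simp add: sum_subtractf sum_distrib_right)
    then show ?thesis using f[of "W \<omega>"] by (simp add: algebra_simps)
  qed
  have W0: "{\<omega> \<in> space M. \<forall>i\<in>J. \<omega> \<notin> E i} = {\<omega> \<in> space M. W \<omega> = 0}"
    using J by (auto simp: W_def)
  have mW0: "{\<omega> \<in> space M. W \<omega> = 0} \<in> events" by measurable
  have "prob {\<omega> \<in> space M. W \<omega> = 0} - exp (- l) = expectation (\<lambda>\<omega>. indicator {\<omega> \<in> space M. W \<omega>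
      = 0} \<omega> - exp (- l))"
    using mW0 by (subst Bochner_Integration.integral_diff) (auto simp: integrable_indicator_iff
        less_top[symmetric] prob_space)
  also have "\<dots> = expectation (\<lambda>\<omega>. (l - (\<Sum>i\<in>J. prob (E i))) * f (Suc (W \<omega>))
      + (\<Sum>i\<in>J. prob (E i) * f (Suc (W \<omega>)) - indicator (E i) \<omega> * f (W \<omega>)))"
    unfolding key[symmetric] by (intro Bochner_Integration.integral_cong refl) (auto simp:
        indicator_def)
  also have "\<dots> = (l - (\<Sum>i\<in>J. prob (E i))) * expectation (\<lambda>\<omega>. f (Suc (W \<omega>)))
      + (\<Sum>i\<in>J. expectation (\<lambda>\<omega>. prob (E i) * f (Suc (W \<omega>)) - indicator (E i) \<omega> * f (W \<omega>)))"
    using intW J by (subst Bochner_Integration.integral_add)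
      (auto intro!: Bochner_Integration.integral_sum Bochner_Integration.integrable_sum
          Bochner_Integration.integrable_diff prodint)
  also have "(\<Sum>i\<in>J. expectation (\<lambda>\<omega>. prob (E i) * f (Suc (W \<omega>)) - indicator (E i) \<omega> * f (W \<omega>)))
     = (\<Sum>i\<in>J. expectation (D i))" by (intro sum.cong refl ED[symmetric])
  finally have main: "prob {\<omega> \<in> space M. W \<omega> = 0} - exp (- l)
     = (l - (\<Sum>i\<in>J. prob (E i))) * expectation (\<lambda>\<omega>. f (Suc (W \<omega>))) + (\<Sum>i\<in>J. expectation (D i))" .
  have "\<bar>expectation (\<lambda>\<omega>. f (Suc (W \<omega>)))\<bar> \<le> expectation (\<lambda>\<omega>. 1)"
    using f_abs intW by (intro order_trans[OF integral_abs_bound] integral_mono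
        Bochner_Integration.integrable_abs) auto
  then have ef: "\<bar>expectation (\<lambda>\<omega>. f (Suc (W \<omega>)))\<bar> \<le> 1" by (simp add: prob_space)
  have "\<bar>expectation (D i)\<bar> \<le> expectation (B i)" if "i \<in> J" for i
    using that DB intD intB by (intro order_trans[OF integral_abs_bound] integral_mono
        Bochner_Integration.integrable_abs) auto
  then have "\<bar>\<Sum>i\<in>J. expectation (D i)\<bar> \<le> (\<Sum>i\<in>J. expectation (B i))"
    by (intro order_trans[OF sum_abs] sum_mono) auto
  also have "\<dots> = (\<Sum>i\<in>J. \<Sum>j\<in>N i. prob (E i) * prob (E j)) + (\<Sum>i\<in>J. \<Sum>j\<in>N i - {i}. prob (E i \<inter> E j))"
    by (simp add: EB sum.distrib)
  moreover have "\<bar>(l - (\<Sum>i\<in>J. prob (E i))) * expectation (\<lambda>\<omega>. f (Suc (W \<omega>)))\<bar>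
      \<le> \<bar>l - (\<Sum>i\<in>J. prob (E i))\<bar>"
    unfolding abs_mult using ef by (simp add: mult_left_le)
  ultimately show ?thesis unfolding W0 main by linarith
qed

end

section \<open>Volume of a chain ellipsoid\<close>

text \<open>A ball of radius \<open>sqrt R\<close> is sliced into balls of one dimension less, and a
  Beta integral links the two unit ball volumes. The guard is essential: \<open>sqrt\<close> is
  negative at negative arguments, and a power with \<open>d = 0\<close> would be 1 there.\<close>

lemma nn_integral_sqrt_power:
  assumes "R \<ge> 0"
  shows "(\<integral>\<^sup>+x. ennreal (unit_ball_vol (real d) * (if x\<^sup>2
      \<le> R then sqrt (R - x\<^sup>2) ^ d else 0)) \<partial>lborel)
     = ennreal (unit_ball_vol (real (Suc d)) * sqrt R ^ Suc d)"
proof (cases "R = 0")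
  case True
  \<comment> \<open>For \<open>d = 0\<close> the integrand is nonzero at the point 0, hence vanishes
    only almost everywhere.\<close>
  have "AE x in lborel. ennreal (unit_ball_vol (real d) * (if x\<^sup>2
      \<le> R then sqrt (R - x\<^sup>2) ^ d else 0)) = 0"
    using AE_lborel_singleton[of "0::real"] by eventually_elim (simp add: True)
  then have "(\<integral>\<^sup>+x. ennreal (unit_ball_vol (real d) * (if x\<^sup>2
      \<le> R then sqrt (R - x\<^sup>2) ^ d else 0)) \<partial>lborel) = 0"
    by (subst nn_integral_0_iff_AE) auto
  then show ?thesis using True by simp
next
  case False
  define r where "r = sqrt R"
  have r: "r > 0" "R = r\<^sup>2" using False assms by (auto simp: r_def)
  have le: "x\<^sup>2 \<le> 1 \<longleftrightarrow> -1 \<le> x \<and> x \<le> 1" for x :: real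
    by (simp add: abs_square_le_1 abs_le_iff) linarith
  have "(\<integral>\<^sup>+x. ennreal (unit_ball_vol (real d) * (if x\<^sup>2
      \<le> R then sqrt (R - x\<^sup>2) ^ d else 0)) \<partial>lborel)
    = ennreal r * (\<integral>\<^sup>+x. ennreal (unit_ball_vol (real d) * (if (0 + r * x)\<^sup>2
        \<le> R then sqrt (R - (0 + r * x)\<^sup>2) ^ d else 0)) \<partial>lborel)"
    using r by (subst nn_integral_real_affine[of _ r 0]) auto
  also have "(\<integral>\<^sup>+x. ennreal (unit_ball_vol (real d) * (if (0 + r * x)\<^sup>2
      \<le> R then sqrt (R - (0 + r * x)\<^sup>2) ^ d else 0)) \<partial>lborel)
    = (\<integral>\<^sup>+x. ennreal (unit_ball_vol (real d) * r ^ d) * ennreal (indicator {-1..1} x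
        * sqrt (1 - x\<^sup>2) ^ d) \<partial>lborel)"
  proof (intro nn_integral_cong)
    fix x :: real
    have "R - (r * x)\<^sup>2 = r\<^sup>2 * (1 - x\<^sup>2)" using r by (simp add: algebra_simps power_mult_distrib)
    then have "sqrt (R - (r * x)\<^sup>2) = r * sqrt (1 - x\<^sup>2)" using r by (simp add: real_sqrt_mult)
    moreover have "(r * x)\<^sup>2 \<le> R \<longleftrightarrow> x\<^sup>2 \<le> 1" using r by (simp add: power_mult_distrib)
    ultimately show "ennreal (unit_ball_vol (real d) * (if (0 + r * x)\<^sup>2
        \<le> R then sqrt (R - (0 + r * x)\<^sup>2) ^ d else 0))
      = ennreal (unit_ball_vol (real d) * r ^ d) * ennreal (indicator {-1..1} x
          * sqrt (1 - x\<^sup>2) ^ d)"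
      using r le[of x] by (auto simp: ennreal_mult'[symmetric] power_mult_distrib indicator_def
          mult_ac)
  qed
  also have "\<dots> = ennreal (unit_ball_vol (real d) * r ^ d) * ennreal (Beta (1 / 2) (real d / 2 + 1))"
    by (subst nn_integral_cmult) (auto simp: emeasure_cball_aux_integral)
  also have "ennreal r * \<dots> = ennreal ((unit_ball_vol (real d) * Beta (1 / 2) (real d / 2 + 1))
      * r ^ Suc d)"
    using r by (simp add: ennreal_mult'[symmetric] mult_ac)
  also have "unit_ball_vol d * Beta (1/2) (d / 2 + 1) = unit_ball_vol (Suc d)"
    by (auto simp: unit_ball_vol_def Beta_def Gamma_eq_zero_iff field_simps
          Gamma_one_half_real powr_half_sqrt [symmetric] powr_add [symmetric])
  finally show ?thesis by (simp add: r_def)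
qed

text \<open>Only the coordinates \<open>1, \<dots>, d\<close> of \<open>y\<close> are free: the ends of the chain, at positions \<open>0\<close> and
  \<open>d + 1\<close>, are pinned to \<open>s\<close> and \<open>e\<close>. The tridiagonal form has determinant \<open>d + 1\<close>.\<close>

definition chain_energy :: "nat \<Rightarrow> real \<Rightarrow> real \<Rightarrow> real \<Rightarrow> (nat \<Rightarrow> real) \<Rightarrow> real" where
  "chain_energy d b s e y = (\<Sum>k<d. ((y(0 := s)) (Suc k) - (y(0 := s)) k - b)\<^sup>2)
      + (e - (y(0 := s)) d - b)\<^sup>2"

lemma measurable_chain_energy [measurable]:
  "(\<lambda>y. chain_energy d b s e y) \<in> borel_measurable (Pi\<^sub>M {1..d} (\<lambda>_. lborel))"
proof -
  have [measurable]: "(\<lambda>y. (y(0 := s)) k) \<in> borel_measurable (Pi\<^sub>M {1..d} (\<lambda>_. lborel))" if "k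
      \<le> d" for k
    using that by (cases "k = 0") auto
  show ?thesis unfolding chain_energy_def by measurable
qed

text \<open>Fixing the last free point at \<open>x\<close> leaves a shorter chain that ends at
  \<open>x\<close> and has energy budget \<open>R - (e - x - b)\<^sup>2\<close>, hence the induction
  with \<open>e\<close> and \<open>R\<close> arbitrary. The term compared with \<open>R\<close> is
  the least possible energy, reached by equal increments. The factors
  \<open>sqrt (D / (D + 1))\<close> of the successive substitutions telescope to
  \<open>1 / sqrt (d + 1)\<close>.\<close>

lemma emeasure_chain_energy_le:
  "emeasure (Pi\<^sub>M {1..d} (\<lambda>_. lborel)) {y \<in> space (Pi\<^sub>M {1..d} (\<lambda>_. lborel)). chain_energy d b s e y
      \<le> R}
   = ennreal (unit_ball_vol (real d) / sqrt (real (Suc d)) *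
       (if (e - s - real (Suc d) * b)\<^sup>2 / real (Suc d) \<le> R
        then sqrt (R - (e - s - real (Suc d) * b)\<^sup>2 / real (Suc d)) ^ d else 0))"
proof (induction d arbitrary: e R)
  case 0
  show ?case by (auto simp: chain_energy_def space_PiM)
next
  case (Suc d)
  interpret product_sigma_finite "\<lambda>_. lborel" by standard
  let ?M = "\<lambda>d. Pi\<^sub>M {1..d} (\<lambda>_. lborel :: real measure)"
  let ?D = "real (Suc d)"
  define A where "A = {y \<in> space (?M (Suc d)). chain_energy (Suc d) b s e y \<le> R}"
  have Am: "A \<in> sets (?M (Suc d))" unfolding A_def by measurable
  have ins: "{1..Suc d} = insert (Suc d) {1..d}" by auto
  have upd: "chain_energy (Suc d) b s e (y(Suc d := x))
      = chain_energy d b s x y + (e - x - b)\<^sup>2" for y x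
    unfolding chain_energy_def by (simp add: fun_upd_twist)
  have "emeasure (?M (Suc d)) A = (\<integral>\<^sup>+y. indicator A y \<partial>Pi\<^sub>M (insert (Suc d) {1..d}) (\<lambda>_. lborel))"
    using Am unfolding ins by simp
  also have "\<dots> = (\<integral>\<^sup>+x. \<integral>\<^sup>+y. indicator A (y(Suc d := x)) \<partial>?M d \<partial>lborel)"
    using Am unfolding ins by (subst product_nn_integral_insert_rev) auto
  also have "\<dots> = (\<integral>\<^sup>+x. emeasure (?M d) {y \<in> space (?M d). chain_energy d b s x y
      \<le> R - (e - x - b)\<^sup>2} \<partial>lborel)"
  proof (intro nn_integral_cong)
    fix x :: real
    have "(\<integral>\<^sup>+y. indicator A (y(Suc d := x)) \<partial>?M d)
       = (\<integral>\<^sup>+y. indicator {y \<in> space (?M d). chain_energy d b s x y \<le> R - (e - x - b)\<^sup>2} y \<partial>?M d)"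
      by (intro nn_integral_cong)
         (auto simp: A_def upd indicator_def space_PiM PiE_def extensional_def)
    also have "\<dots> = emeasure (?M d) {y \<in> space (?M d). chain_energy d b s x y \<le> R - (e - x - b)\<^sup>2}"
      by (rule nn_integral_indicator) measurable
    finally show "(\<integral>\<^sup>+y. indicator A (y(Suc d := x)) \<partial>?M d)
       = emeasure (?M d) {y \<in> space (?M d). chain_energy d b s x y \<le> R - (e - x - b)\<^sup>2}" .
  qed
  also have "\<dots> = (\<integral>\<^sup>+x. ennreal (unit_ball_vol (real d) / sqrt ?D *
       (if (x - s - ?D * b)\<^sup>2 / ?D \<le> R - (e - x - b)\<^sup>2
        then sqrt (R - (e - x - b)\<^sup>2 - (x - s - ?D * b)\<^sup>2 / ?D) ^ d else 0)) \<partial>lborel)"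
    by (simp only: Suc.IH)
  also have "\<dots> = (\<integral>\<^sup>+x. ennreal (1 / sqrt ?D) * ennreal (unit_ball_vol (real d) *
       (if (x - s - ?D * b)\<^sup>2 / ?D \<le> R - (e - x - b)\<^sup>2
        then sqrt (R - (e - x - b)\<^sup>2 - (x - s - ?D * b)\<^sup>2 / ?D) ^ d else 0)) \<partial>lborel)"
    by (intro nn_integral_cong) (simp add: ennreal_mult'[symmetric])
  also have "\<dots> = ennreal (1 / sqrt ?D) * (\<integral>\<^sup>+x. ennreal (unit_ball_vol (real d) *
       (if (x - s - ?D * b)\<^sup>2 / ?D \<le> R - (e - x - b)\<^sup>2
        then sqrt (R - (e - x - b)\<^sup>2 - (x - s - ?D * b)\<^sup>2 / ?D) ^ d else 0)) \<partial>lborel)"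
    by (rule nn_integral_cmult) measurable
  also have "(\<integral>\<^sup>+x. ennreal (unit_ball_vol (real d) *
       (if (x - s - ?D * b)\<^sup>2 / ?D \<le> R - (e - x - b)\<^sup>2
        then sqrt (R - (e - x - b)\<^sup>2 - (x - s - ?D * b)\<^sup>2 / ?D) ^ d else 0)) \<partial>lborel)
     = ennreal (sqrt (?D / (?D + 1))) * (\<integral>\<^sup>+x. ennreal (unit_ball_vol (real d) *
       (if x\<^sup>2 \<le> R - (e - s - (?D + 1) * b)\<^sup>2 / (?D + 1)
        then sqrt (R - (e - s - (?D + 1) * b)\<^sup>2 / (?D + 1) - x\<^sup>2) ^ d else 0)) \<partial>lborel)" (is "_
            = _ * ?J")
  proof -
    \<comment> \<open>\<open>x0\<close> is the energy-minimising position of the last free point.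
      The square around it has coefficient \<open>1 / D + 1\<close>, which the scale
      \<open>c\<close> normalises to 1.\<close>
    define c where "c = sqrt (?D / (?D + 1))"
    define x0 where "x0 = s + ?D * b + ?D / (?D + 1) * (e - s - (?D + 1) * b)"
    have c: "c > 0" "c\<^sup>2 = ?D / (?D + 1)" by (auto simp: c_def)
    have sq: "(x0 + c * x - s - ?D * b)\<^sup>2 / ?D + (e - (x0 + c * x) - b)\<^sup>2
        = x\<^sup>2 + (e - s - (?D + 1) * b)\<^sup>2 / (?D + 1)" for x
    proof -
      define w where "w = e - s - (?D + 1) * b"
      have 1: "x0 + c * x - s - ?D * b = ?D / (?D + 1) * w + c * x" by (simp add: x0_def w_def)
      have 2: "e - (x0 + c * x) - b = w / (?D + 1) - c * x"
        by (simp add: x0_def w_def field_simps)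
      define D where "D = ?D"
      have D: "D > 0" unfolding D_def by simp
      define q y where "q = w / (D + 1)" and "y = c * x"
      have "(D * q + y)\<^sup>2 / D + (q - y)\<^sup>2 = (D + 1) * q\<^sup>2 + y\<^sup>2 * ((D + 1) / D)"
        using D by (simp add: power2_eq_square field_simps)
      also have "y\<^sup>2 * ((D + 1) / D) = x\<^sup>2"
        using D c(2)[folded D_def] by (simp add: y_def power_mult_distrib)
      also have "(D + 1) * q\<^sup>2 = w\<^sup>2 / (D + 1)"
        using D by (simp add: q_def power2_eq_square)
      also have "D * q + y = D / (D + 1) * w + c * x" by (simp add: q_def y_def)
      also have "q - y = w / (D + 1) - c * x" by (simp add: q_def y_def)
      finally show ?thesis unfolding 1 2 unfolding D_def w_def[symmetric] by simp
    qed
    let ?h = "\<lambda>x. ennreal (unit_ball_vol (real d) *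
       (if (x - s - ?D * b)\<^sup>2 / ?D \<le> R - (e - x - b)\<^sup>2
        then sqrt (R - (e - x - b)\<^sup>2 - (x - s - ?D * b)\<^sup>2 / ?D) ^ d else 0))"
    have m: "?h \<in> borel_measurable borel" by measurable
    have "(\<integral>\<^sup>+x. ?h x \<partial>lborel) = ennreal c * (\<integral>\<^sup>+x. ?h (x0 + c * x) \<partial>lborel)"
      using c(1) by (subst nn_integral_real_affine[OF m, of c x0]) auto
    also have "(\<integral>\<^sup>+x. ?h (x0 + c * x) \<partial>lborel) = ?J"
    proof (intro nn_integral_cong)
      fix x :: real
      have 1: "((x0 + c * x - s - ?D * b)\<^sup>2 / ?D \<le> R - (e - (x0 + c * x) - b)\<^sup>2)
         = (x\<^sup>2 \<le> R - (e - s - (?D + 1) * b)\<^sup>2 / (?D + 1))" using sq[of x] by linarith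
      have 2: "R - (e - (x0 + c * x) - b)\<^sup>2 - (x0 + c * x - s - ?D * b)\<^sup>2 / ?D
         = R - (e - s - (?D + 1) * b)\<^sup>2 / (?D + 1) - x\<^sup>2" using sq[of x] by linarith
      show "?h (x0 + c * x) = ennreal (unit_ball_vol (real d) *
       (if x\<^sup>2 \<le> R - (e - s - (?D + 1) * b)\<^sup>2 / (?D + 1)
        then sqrt (R - (e - s - (?D + 1) * b)\<^sup>2 / (?D + 1) - x\<^sup>2) ^ d else 0))"
        unfolding 1 2 ..
    qed
    finally show ?thesis unfolding c_def .
  qed
  also have "ennreal (1 / sqrt ?D) * (ennreal (sqrt (?D / (?D + 1))) * ?J)
     = ennreal (1 / sqrt (?D + 1)) * ?J"
    by (simp add: mult.assoc[symmetric] ennreal_mult'[symmetric] real_sqrt_divide)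
  also have "?J = ennreal (unit_ball_vol (real (Suc d)) *
       (if (e - s - (?D + 1) * b)\<^sup>2 / (?D + 1) \<le> R
        then sqrt (R - (e - s - (?D + 1) * b)\<^sup>2 / (?D + 1)) ^ Suc d else 0))"
  proof (cases "(e - s - (?D + 1) * b)\<^sup>2 / (?D + 1) \<le> R")
    case True
    then show ?thesis by (subst nn_integral_sqrt_power) auto
  next
    case False
    have "?J = (\<integral>\<^sup>+(x::real). 0 \<partial>lborel)"
    proof (intro nn_integral_cong)
      fix x :: real
      have "\<not> x\<^sup>2 \<le> R - (e - s - (?D + 1) * b)\<^sup>2 / (?D + 1)" using False zero_le_power2[of x]
          by linarith
      then show "ennreal (unit_ball_vol (real d) *
       (if x\<^sup>2 \<le> R - (e - s - (?D + 1) * b)\<^sup>2 / (?D + 1)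
        then sqrt (R - (e - s - (?D + 1) * b)\<^sup>2 / (?D + 1) - x\<^sup>2) ^ d else 0)) = 0" by simp
    qed
    then show ?thesis using False by simp
  qed
  finally show ?case unfolding A_def
    by (simp add: ennreal_mult'[symmetric] add_ac)
qed

section \<open>Quadratic expansion of the tangent sum\<close>

lemma DERIV_tan': "cos (y::real) \<noteq> 0 \<Longrightarrow> (tan has_real_derivative 1 + (tan y)\<^sup>2) (at y)"
  using DERIV_tan[of y] tan_sec[of y] by (metis power_inverse)

lemma tan_diff_ge:
  fixes y z :: real
  assumes "0 < y" "y \<le> z" "z < pi / 2"
  shows "z - y \<le> tan z - tan y"
proof -
  have "tan y - y \<le> tan z - z"
  proof (rule DERIV_nonneg_imp_nondecreasing[OF assms(2)])
    fix x assume x: "y \<le> x" "x \<le> z"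
    have "cos x > 0" using x assms by (intro cos_gt_zero_pi) auto
    then have "((\<lambda>x. tan x - x) has_real_derivative 1 + (tan x)\<^sup>2 - 1) (at x)"
      by (intro derivative_intros DERIV_tan') auto
    then show "\<exists>d. ((\<lambda>x. tan x - x) has_real_derivative d) (at x) \<and> 0 \<le> d"
      by (intro exI[of _ "1 + (tan x)\<^sup>2 - 1"]) auto
  qed
  then show ?thesis by simp
qed

text \<open>The difference of the two sides has derivative
  \<open>(tan z - tan a) * (tan z + tan a) - tan a * (z - a)\<close>, which has the sign of
  \<open>z - a\<close> since the tangent grows at least as fast as the identity. The quadratic
  coefficient is below the Taylor one, \<open>tan a * (1 + (tan a)\<^sup>2)\<close>, in exchange for
  validity on the whole interval.\<close>

lemma tan_strong_convexity:
  fixes a y :: real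
  assumes a: "0 < a" "a < pi / 2" and y: "0 < y" "y < pi / 2"
  shows "tan a + (1 + (tan a)\<^sup>2) * (y - a) + tan a / 2 * (y - a)\<^sup>2 \<le> tan y"
proof -
  define g where "g z = tan z - tan a - (1 + (tan a)\<^sup>2) * (z - a) - tan a / 2 * (z - a)\<^sup>2" for z
  define g' where "g' z = (tan z - tan a) * (tan z + tan a) - tan a * (z - a)" for z
  have ta: "tan a > 0" using a by (intro tan_gt_zero)
  have d: "(g has_real_derivative g' z) (at z)" if "0 < z" "z < pi / 2" for z
  proof -
    have c: "cos z \<noteq> 0" using that cos_gt_zero_pi[of z] by simp
    have "(g has_real_derivative (1 + (tan z)\<^sup>2) - (1 + (tan a)\<^sup>2) - tan a / 2 * (2
        * (z - a))) (at z)"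
      unfolding g_def by (rule derivative_eq_intros DERIV_tan' c refl | simp)+
    also have "(1 + (tan z)\<^sup>2) - (1 + (tan a)\<^sup>2) - tan a / 2 * (2 * (z - a)) = g' z"
      by (simp add: g'_def algebra_simps power2_eq_square)
    finally show ?thesis .
  qed
  have "g a \<le> g y"
  proof (cases "a \<le> y")
    case True
    show ?thesis
    proof (rule DERIV_nonneg_imp_nondecreasing[OF True])
      fix z assume z: "a \<le> z" "z \<le> y"
      have tz: "tan z > 0" using z a y by (intro tan_gt_zero) auto
      have "tan a * (z - a) \<le> (tan z + tan a) * (tan z - tan a)"
        using z a y ta tz tan_diff_ge[of a z] by (intro mult_mono) auto
      then have "0 \<le> g' z" unfolding g'_def by (simp add: mult.commute)
      then show "\<exists>d. (g has_real_derivative d) (at z) \<and> 0 \<le> d" using d[of z] z a y by auto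
    qed
  next
    case False
    then have "y \<le> a" by simp
    then show ?thesis
    proof (rule DERIV_nonpos_imp_nonincreasing)
      fix z assume z: "y \<le> z" "z \<le> a"
      have tz: "tan z > 0" using z a y by (intro tan_gt_zero) auto
      have "tan a * (a - z) \<le> (tan z + tan a) * (tan a - tan z)"
        using z a y ta tz tan_diff_ge[of z a] by (intro mult_mono) auto
      then have "g' z \<le> 0" unfolding g'_def by (simp add: algebra_simps)
      then show "\<exists>d. (g has_real_derivative d) (at z) \<and> d \<le> 0" using d[of z] z a y by auto
    qed
  qed
  then show ?thesis by (simp add: g_def)
qed

text \<open>Lagrange remainder: \<open>r\<close> is half the distance from \<open>a\<close> to the
  ends of the interval from 0 to \<open>pi / 2\<close>, so on the range considered the tangent stays
  below \<open>B\<close>, and \<open>C\<close> bounds the third derivative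
  \<open>D 3\<close>.\<close>

lemma tan_Taylor2:
  fixes a :: real
  assumes a: "0 < a" "a < pi / 2"
  obtains C r where "C > 0" "r > 0" "r < a" "r < pi / 2 - a"
    "\<And>h. \<bar>h\<bar> \<le> r \<Longrightarrow> \<bar>tan (a + h) - tan a - (1 + (tan a)\<^sup>2) * h - tan a * (1 + (tan a)\<^sup>2) * h\<^sup>2\<bar>
        \<le> C * \<bar>h\<bar> ^ 3"
proof -
  define r where "r = min a (pi / 2 - a) / 2"
  have r: "r > 0" "r < a" "r < pi / 2 - a" using a by (auto simp: r_def min_def)
  define B where "B = tan (a + r)"
  have B0: "B > 0" unfolding B_def using r a by (intro tan_gt_zero) auto
  define D where "D n z = (if n = 0 then tan z else if n = 1 then 1 + (tan z)\<^sup>2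
     else if n = 2 then 2 * tan z * (1 + (tan z)\<^sup>2) else (2 + 6 * (tan z)\<^sup>2) * (1
         + (tan z)\<^sup>2))" for n :: nat and z :: real
  define C where "C = (2 + 6 * B\<^sup>2) * (1 + B\<^sup>2)"
  have C: "C > 0" unfolding C_def by (intro mult_pos_pos add_pos_nonneg) auto
  have "\<bar>tan (a + h) - tan a - (1 + (tan a)\<^sup>2) * h - tan a * (1 + (tan a)\<^sup>2) * h\<^sup>2\<bar> \<le> C * \<bar>h\<bar> ^ 3"
    if h: "\<bar>h\<bar> \<le> r" for h
  proof (cases "h = 0")
    case False
    have DD: "\<forall>n z. n < 3 \<and> a - r \<le> z \<and> z \<le> a + r \<longrightarrow> (D n has_real_derivative D (Suc n) z) (at z)"
    proof (intro allI impI, elim conjE)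
      fix n :: nat and z assume n: "n < 3" and z: "a - r \<le> z" "z \<le> a + r"
      have c: "cos z \<noteq> 0" using z r a cos_gt_zero_pi[of z] by auto
      have D0: "(D 0 has_real_derivative D (Suc 0) z) (at z)"
        unfolding D_def using DERIV_tan'[OF c] by simp
      have D1: "(D 1 has_real_derivative D (Suc 1) z) (at z)"
        unfolding D_def by (rule derivative_eq_intros DERIV_tan' c refl | simp)+
      have D2: "(D 2 has_real_derivative D (Suc 2) z) (at z)"
        unfolding D_def by (rule derivative_eq_intros DERIV_tan' c refl | simp add: algebra_simps
            power2_eq_square)+
      from n consider "n = 0" | "n = 1" | "n = 2" by linarith
      then show "(D n has_real_derivative D (Suc n) z) (at z)"
        using D0 D1 D2 by cases auto
    qed
    have "\<exists>t. (if a + h < a then a + h < t \<and> t < a else a < t \<and> t < a + h) \<and>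
        tan (a + h) = (\<Sum>n<3. D n a / fact n * (a + h - a) ^ n) + D 3 t / fact 3 * (a + h - a) ^ 3"
    proof (rule Taylor[where a = "a - r" and b = "a + r"])
      show "D 0 = tan" by (auto simp: D_def)
    qed (use DD r h False in auto)
    then obtain t where t: "if a + h < a then a + h < t \<and> t < a else a < t \<and> t < a + h"
      "tan (a + h) = (\<Sum>n<3. D n a / fact n * h ^ n) + D 3 t / fact 3 * h ^ 3" by auto
    have t': "0 < t" "t \<le> a + r" "t < pi / 2" using t(1) h r by (auto split: if_splits)
    have tt: "0 < tan t" "tan t \<le> B" using t' r a unfolding B_def
      by (auto intro!: tan_gt_zero tan_mono_le)
    have "tan (a + h) - tan a - (1 + (tan a)\<^sup>2) * h - tan a * (1 + (tan a)\<^sup>2) * h\<^sup>2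
        = D 3 t / 6 * h ^ 3"
      using t(2) by (simp add: D_def numeral_3_eq_3 fact_numeral power2_eq_square)
    also have "\<bar>D 3 t / 6 * h ^ 3\<bar> = \<bar>D 3 t\<bar> / 6 * \<bar>h\<bar> ^ 3" by (simp add: abs_mult power_abs)
    also have "\<dots> \<le> C * \<bar>h\<bar> ^ 3"
    proof (rule mult_right_mono)
      have "(tan t)\<^sup>2 \<le> B\<^sup>2" using tt by (intro power_mono) auto
      then have "D 3 t \<le> C" unfolding D_def C_def by (auto intro!: mult_mono)
      moreover have "D 3 t \<ge> 0" unfolding D_def by auto
      ultimately show "\<bar>D 3 t\<bar> / 6 \<le> C" by simp
    qed simp
    finally show ?thesis .
  qed simp
  then show ?thesis using that C r by blast
qed

text \<open>The gaps sum to \<open>2 * pi\<close>, so linear terms cancel. From the area bound,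
  \<open>tan_strong_convexity\<close> first gives a lossy bound on the squares; this brings all gaps
  into the range of the Taylor expansion, whose cubic error is then of order
  \<open>e * sqrt e\<close>. From the quadratic bound the expansion applies directly and also yields
  that the gaps lie between 0 and \<pi>. The 4 in \<open>\<kappa>\<close> reflects that the tangents
  are taken at half gaps.\<close>

lemma tan_sum_excess:
  fixes m :: nat
  assumes m: "m \<ge> 3"
  defines "T \<equiv> tan (pi / real m)"
  defines "\<kappa> \<equiv> T * (1 + T\<^sup>2) / 4"
  obtains C e0 where "C > 0" "e0 > 0" "C * sqrt e0 < 1"
    "\<And>g e. 0 < e \<Longrightarrow> e \<le> e0 \<Longrightarrow> (\<And>k. k < m \<Longrightarrow> 0 < g k \<and> g k < pi) \<Longrightarrow> (\<Sum>k<m. g k) = 2 * pi \<Longrightarrow>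
      (\<Sum>k<m. tan (g k / 2)) \<le> real m * T + e \<Longrightarrow>
      \<kappa> * (\<Sum>k<m. (g k - 2 * pi / real m)\<^sup>2) \<le> e * (1 + C * sqrt e)"
    "\<And>g e. 0 < e \<Longrightarrow> e \<le> e0 \<Longrightarrow> (\<Sum>k<m. g k) = 2 * pi \<Longrightarrow>
      \<kappa> * (\<Sum>k<m. (g k - 2 * pi / real m)\<^sup>2) \<le> e * (1 - C * sqrt e) \<Longrightarrow>
      (\<forall>k<m. 0 < g k \<and> g k < pi) \<and> (\<Sum>k<m. tan (g k / 2)) \<le> real m * T + e"
proof -
  define a where "a = pi / real m"
  define b where "b = 2 * pi / real m"
  have ab: "b = 2 * a" by (simp add: a_def b_def)
  have a: "0 < a" "a < pi / 2" using m by (auto simp: a_def field_simps)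
  have T: "T > 0" unfolding T_def a_def[symmetric] using a by (intro tan_gt_zero)
  have \<kappa>: "\<kappa> > 0" unfolding \<kappa>_def using T by (simp add: add_pos_nonneg)
  obtain C1 r where C1: "C1 > 0" and r: "r > 0" "r < a" "r < pi / 2 - a" and taylor:
    "\<And>h. \<bar>h\<bar> \<le> r \<Longrightarrow> \<bar>tan (a + h) - T - (1 + T\<^sup>2) * h - T * (1 + T\<^sup>2) * h\<^sup>2\<bar> \<le> C1 * \<bar>h\<bar> ^ 3"
    using tan_Taylor2[OF a] unfolding T_def a_def by metis
  \<comment> \<open>\<open>A * e\<close> dominates the sum of squares in both directions:
    \<open>8 / T\<close> comes from strong convexity and \<open>1 / \<kappa>\<close> from the
    quadratic hypothesis.\<close>
  define A where "A = 8 / T + 1 / \<kappa>"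
  have A: "A > 0" "8 / T \<le> A" "1 / \<kappa> \<le> A" using T \<kappa> by (auto simp: A_def add_pos_pos)
  define C where "C = C1 * A * sqrt A"
  have C: "C > 0" using C1 A by (simp add: C_def)
  \<comment> \<open>The first bound keeps half gaps within the Taylor radius \<open>r\<close> of
    \<open>a\<close>; the second gives \<open>C * sqrt e0 \<le> 1 / 2\<close>.\<close>
  define e0 where "e0 = min (r\<^sup>2 / A) ((1 / (2 * C))\<^sup>2)"
  have e0: "e0 > 0" using r A C by (simp add: e0_def)
  have "sqrt e0 \<le> 1 / (2 * C)" using C unfolding e0_def by (intro real_le_lsqrt) auto
  then have C1': "C * sqrt e0 < 1" using C by (simp add: field_simps)
  have close: "\<bar>(\<Sum>k<m. tan (g k / 2)) - real m * T - \<kappa> * (\<Sum>k<m. (g k - b)\<^sup>2)\<bar> \<le> C * e * sqrt e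
      \<and> (\<forall>k<m. \<bar>g k / 2 - a\<bar> \<le> r)"
    if e: "0 < e" "e \<le> e0" and g: "(\<Sum>k<m. g k) = 2 * pi" and Q: "(\<Sum>k<m. (g k - b)\<^sup>2)
        \<le> A * e" for g e
  proof -
    define Q where "Q = (\<Sum>k<m. (g k - b)\<^sup>2)"
    have Q0: "Q \<ge> 0" unfolding Q_def by (intro sum_nonneg) auto
    have Qr: "Q \<le> r\<^sup>2"
    proof -
      have "A * e \<le> A * (r\<^sup>2 / A)" using e A by (intro mult_left_mono) (auto simp: e0_def)
      then show ?thesis using Q A unfolding Q_def by simp
    qed
    have xk: "\<bar>g k - b\<bar> \<le> sqrt Q" if "k < m" for k
    proof -
      have "(g k - b)\<^sup>2 \<le> Q" unfolding Q_def using that by (intro member_le_sum) auto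
      then show ?thesis using real_le_rsqrt by (metis abs_le_square_iff abs_of_nonneg real_sqrt_abs
          real_sqrt_le_mono)
    qed
    have xr: "\<bar>g k / 2 - a\<bar> \<le> r" if "k < m" for k
    proof -
      have "sqrt Q \<le> r" using Qr r by (intro real_le_lsqrt) auto
      then have "\<bar>g k - b\<bar> \<le> r" using xk[OF that] by simp
      then show ?thesis using ab r by (simp add: abs_le_iff)
    qed
    have sum0: "(\<Sum>k<m. g k / 2 - a) = 0"
      using g m by (simp add: sum_subtractf sum_divide_distrib[symmetric] a_def)
    have "\<bar>(\<Sum>k<m. tan (g k / 2)) - real m * T - \<kappa> * Q\<bar>
      = \<bar>\<Sum>k<m. tan (a + (g k / 2 - a)) - T - (1 + T\<^sup>2) * (g k / 2 - a) - T * (1 + T\<^sup>2)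
          * (g k / 2 - a)\<^sup>2\<bar>"
    proof -
      have "T * (1 + T\<^sup>2) * (g k / 2 - a)\<^sup>2 = \<kappa> * (g k - b)\<^sup>2" for k
      proof -
        have "g k / 2 - a = (g k - b) / 2" by (simp add: ab)
        then show ?thesis unfolding \<kappa>_def by (simp only: power_divide) simp
      qed
      then have "(\<Sum>k<m. T * (1 + T\<^sup>2) * (g k / 2 - a)\<^sup>2) = \<kappa> * Q"
        unfolding Q_def sum_distrib_left by (intro sum.cong) auto
      moreover have "(\<Sum>k<m. (1 + T\<^sup>2) * (g k / 2 - a)) = 0"
        unfolding sum_distrib_left[symmetric] sum0 by simp
      ultimately show ?thesis by (simp add: sum_subtractf)
    qed
    also have "\<dots> \<le> (\<Sum>k<m. C1 * \<bar>g k / 2 - a\<bar> ^ 3)"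
      by (intro order_trans[OF sum_abs] sum_mono taylor xr) auto
    \<comment> \<open>One factor of each cube is bounded by \<open>sqrt Q\<close>, so that the
      squares can be summed exactly.\<close>
    also have "\<dots> \<le> (\<Sum>k<m. C1 * (sqrt Q * (g k - b)\<^sup>2))"
    proof (intro sum_mono mult_left_mono)
      fix k assume k: "k \<in> {..<m}"
      have "\<bar>g k / 2 - a\<bar> \<le> \<bar>g k - b\<bar>" using ab by (simp add: abs_le_iff) argo
      then have "\<bar>g k / 2 - a\<bar> ^ 3 \<le> \<bar>g k - b\<bar> ^ 3" by (intro power_mono) auto
      also have "\<dots> = \<bar>g k - b\<bar> * (g k - b)\<^sup>2" by (simp add: power3_eq_cube power2_eq_square)
      also have "\<dots> \<le> sqrt Q * (g k - b)\<^sup>2" using xk k by (intro mult_right_mono) auto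
      finally show "\<bar>g k / 2 - a\<bar> ^ 3 \<le> sqrt Q * (g k - b)\<^sup>2" .
    qed (use C1 in auto)
    also have "\<dots> = C1 * (sqrt Q * Q)" unfolding Q_def by (simp add: sum_distrib_left)
    also have "\<dots> \<le> C1 * (sqrt (A * e) * (A * e))"
      using Q Q0 C1 unfolding Q_def[symmetric] by (intro mult_left_mono mult_mono) auto
    also have "\<dots> = C * e * sqrt e" by (simp add: C_def real_sqrt_mult)
    finally show ?thesis using xr unfolding Q_def by auto
  qed
  show ?thesis
  proof (rule that[OF C e0 C1'])
    fix g :: "nat \<Rightarrow> real" and e assume e: "0 < e" "e \<le> e0" and gp: "\<And>k. k < m \<Longrightarrow> 0 < g k \<and> g k < pi"
      and g: "(\<Sum>k<m. g k) = 2 * pi" and F: "(\<Sum>k<m. tan (g k / 2)) \<le> real m * T + e"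
    have sum0: "(\<Sum>k<m. g k / 2 - a) = 0"
      using g m by (simp add: sum_subtractf sum_divide_distrib[symmetric] a_def)
    have "T / 8 * (\<Sum>k<m. (g k - b)\<^sup>2) = (\<Sum>k<m. T / 2 * (g k / 2 - a)\<^sup>2)"
      unfolding sum_distrib_left ab by (intro sum.cong) (auto simp: power2_eq_square algebra_simps)
    also have "\<dots> \<le> (\<Sum>k<m. tan (g k / 2) - T - (1 + T\<^sup>2) * (g k / 2 - a))"
    proof (rule sum_mono)
      fix k assume "k \<in> {..<m}"
      then have "0 < g k / 2" "g k / 2 < pi / 2" using gp[of k] by auto
      then show "T / 2 * (g k / 2 - a)\<^sup>2 \<le> tan (g k / 2) - T - (1 + T\<^sup>2) * (g k / 2 - a)"
        using tan_strong_convexity[OF a, of "g k / 2"] unfolding T_def a_def by simp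
    qed
    also have "\<dots> = (\<Sum>k<m. tan (g k / 2)) - real m * T"
      using sum0 by (simp add: sum_subtractf sum_distrib_left[symmetric])
    also have "\<dots> \<le> e" using F by simp
    finally have "(\<Sum>k<m. (g k - b)\<^sup>2) \<le> 8 / T * e" using T by (simp add: field_simps)
    also have "\<dots> \<le> A * e" using A e by (intro mult_right_mono) auto
    finally have "\<bar>(\<Sum>k<m. tan (g k / 2)) - real m * T - \<kappa> * (\<Sum>k<m. (g k - b)\<^sup>2)\<bar> \<le> C * e * sqrt e"
      using close[OF e g] by auto
    then show "\<kappa> * (\<Sum>k<m. (g k - 2 * pi / real m)\<^sup>2) \<le> e * (1 + C * sqrt e)"
      using F unfolding b_def by (simp add: abs_le_iff algebra_simps)
  next
    fix g :: "nat \<Rightarrow> real" and e assume e: "0 < e" "e \<le> e0"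
      and g: "(\<Sum>k<m. g k) = 2 * pi" and Q: "\<kappa> * (\<Sum>k<m. (g k - 2 * pi / real m)\<^sup>2)
          \<le> e * (1 - C * sqrt e)"
    have "0 \<le> e * (C * sqrt e)" using C e by simp
    then have "\<kappa> * (\<Sum>k<m. (g k - b)\<^sup>2) \<le> e"
      using Q unfolding b_def right_diff_distrib by linarith
    then have "(\<Sum>k<m. (g k - b)\<^sup>2) \<le> 1 / \<kappa> * e" using \<kappa> by (simp add: field_simps)
    also have "\<dots> \<le> A * e" using A e by (intro mult_right_mono) auto
    finally have c: "\<bar>(\<Sum>k<m. tan (g k / 2)) - real m * T - \<kappa> * (\<Sum>k<m. (g k - b)\<^sup>2)\<bar>
        \<le> C * e * sqrt e"
      "\<forall>k<m. \<bar>g k / 2 - a\<bar> \<le> r"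
      using close[OF e g] by auto
    have "0 < g k \<and> g k < pi" if "k < m" for k
      using c(2) that r by (simp add: abs_le_iff) (smt (verit) field_sum_of_halves)
    moreover have "(\<Sum>k<m. tan (g k / 2)) \<le> real m * T + e"
      using c(1) Q unfolding b_def by (simp add: abs_le_iff algebra_simps)
    ultimately show "(\<forall>k<m. 0 < g k \<and> g k < pi) \<and> (\<Sum>k<m. tan (g k / 2)) \<le> real m * T + e" by blast
  qed
qed

section \<open>Area of a circumscribed polygon\<close>

text \<open>Makes the area formula for triangles in \<open>real^2\<close> available for complex
  numbers: the two measures agree on boxes.\<close>

lemma lborel_complex_eq_distr_vec2:
  "(lborel :: complex measure) = distr (lborel :: (real^2) measure) borel (\<lambda>x. Complex (x $ 1) (x $
      2))"
proof (rule lborel_eqI)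
  have [measurable]: "(\<lambda>x :: real^2. Complex (x $ 1) (x $ 2)) \<in> borel \<rightarrow>\<^sub>M borel"
    unfolding Complex_eq by measurable
  fix l u :: complex assume le: "\<And>b. b \<in> Basis \<Longrightarrow> l \<bullet> b \<le> u \<bullet> b"
  let ?v = "\<lambda>z. (\<chi> i. if i = 1 then Re z else Im z) :: real^2"
  have eq: "(\<lambda>x. Complex (x $ 1) (x $ 2)) -` box l u = box (?v l) (?v u)"
    by (auto simp: box_def Basis_complex_def inner_complex_def Basis_vec_def inner_axis forall_2)
  have "emeasure (lborel :: (real^2) measure) (box (?v l) (?v u)) = (\<Prod>b\<in>Basis. (?v u - ?v l) \<bullet> b)"
    using le[of 1] le[of \<i>] by (intro emeasure_lborel_box)
      (auto simp: Basis_complex_def inner_complex_def Basis_vec_def inner_axis)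
  also have "(\<Prod>b\<in>Basis. (?v u - ?v l) \<bullet> b) = (\<Prod>i\<in>UNIV. (?v u - ?v l) $ i)"
  proof -
    have B: "Basis = (\<lambda>i::2. axis i (1::real)) ` UNIV" by (auto simp: Basis_vec_def)
    have "inj (\<lambda>i::2. axis i (1::real))" by (auto simp: inj_on_def axis_eq_axis)
    then show ?thesis unfolding B by (subst prod.reindex) (simp_all add: inner_axis)
  qed
  also have "\<dots> = (\<Prod>b\<in>Basis. (u - l) \<bullet> b)"
    by (simp add: UNIV_2 Basis_complex_def inner_complex_def)
  finally show "emeasure (distr lborel borel (\<lambda>x :: real^2. Complex (x $ 1) (x $ 2))) (box l u)
      = (\<Prod>b\<in>Basis. (u - l) \<bullet> b)"
    by (simp add: emeasure_distr eq)
qed simp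

lemma measure_triangle_complex:
  fixes a b :: complex
  shows "measure lebesgue (convex hull {0, a, b}) = \<bar>Re a * Im b - Im a * Re b\<bar> / 2"
proof -
  define f where "f = (\<lambda>x :: real^2. Complex (x $ 1) (x $ 2))"
  define g where "g z = (vector [Re z, Im z] :: real^2)" for z
  have fg: "f (g z) = z" for z by (simp add: f_def g_def)
  have gf: "g (f x) = x" for x by (simp add: f_def g_def vec_eq_iff forall_2)
  have [measurable]: "f \<in> borel \<rightarrow>\<^sub>M borel"
    unfolding f_def Complex_eq by measurable
  have lin: "linear f" by (rule linearI) (auto simp: f_def complex_eq_iff)
  let ?S = "convex hull {0, a, b}"
  have S: "?S \<in> sets borel"
    by (intro borel_compact finite_imp_compact_convex_hull) auto
  have "?S = f ` (convex hull {g 0, g a, g b})"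
    using convex_hull_linear_image[OF lin, of "{g 0, g a, g b}"] by (simp add: fg)
  moreover have "f -` (f ` X) = X" for X by (rule inj_vimage_image_eq) (metis gf injI)
  ultimately have vim: "f -` ?S = convex hull {g 0, g a, g b}" by simp
  have "measure lebesgue ?S = measure lborel ?S" using S by (simp add: measure_completion)
  also have "\<dots> = measure (distr lborel borel f) ?S"
    unfolding f_def by (subst lborel_complex_eq_distr_vec2) simp
  also have "\<dots> = measure lborel (convex hull {g 0, g a, g b})"
    using S by (subst measure_distr) (auto simp: vim)
  also have "\<dots> = \<bar>Re a * Im b - Im a * Re b\<bar> / 2"
    by (subst content_triangle) (simp add: g_def vector_2 abs_minus_commute mult.commute)
  finally show ?thesis .
qed

text \<open>The \<open>m\<close> points are indexed by all naturals, and their angles are lifted to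
  the real line so that \<open>m\<close> steps add one full turn. The successor of an index is then
  always \<open>Suc k\<close>, and no statement has to treat the wrap-around separately.\<close>

locale cyclic_angles =
  fixes \<Phi> :: "nat \<Rightarrow> real" and m :: nat
  assumes incr: "\<Phi> k < \<Phi> (Suc k)"
    and period: "\<Phi> (k + m) = \<Phi> k + 2 * pi"
    and m2: "m \<ge> 2"
begin

lemma strict_mono_angles: "strict_mono \<Phi>"
  using incr by (simp add: strict_mono_Suc_iff)

lemma angles_less_iff [simp]: "\<Phi> j < \<Phi> k \<longleftrightarrow> j < k"
  using strict_mono_angles by (rule strict_mono_less)

lemma angles_le_iff [simp]: "\<Phi> j \<le> \<Phi> k \<longleftrightarrow> j \<le> k"
  using strict_mono_angles by (rule strict_mono_less_eq)

lemma cis_period: "cis (\<Phi> (k + m)) = cis (\<Phi> k)"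
  by (simp add: period cis_mult[symmetric])

lemma cis_mod: "cis (\<Phi> (k mod m)) = cis (\<Phi> k)"
proof (induction k rule: less_induct)
  case (less k)
  show ?case
  proof (cases "k < m")
    case False
    then have "cis (\<Phi> ((k - m) mod m)) = cis (\<Phi> (k - m))" using m2 by (intro less) auto
    then show ?thesis using False cis_period[of "k - m"] by (simp add: le_mod_geq)
  qed auto
qed

lemma range_points: "range (\<lambda>k. cis (\<Phi> k)) = (\<lambda>k. cis (\<Phi> k)) ` {i..<i + m}"
proof (intro antisym subsetI)
  fix z assume "z \<in> range (\<lambda>k. cis (\<Phi> k))"
  then obtain k where z: "z = cis (\<Phi> k)" by auto
  \<comment> \<open>Adding \<open>m * i\<close> makes the truncated subtraction exact and does not
    change the residue.\<close>
  define j where "j = i + (k + m * i - i) mod m"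
  have "j mod m = (i + (k + m * i - i)) mod m" unfolding j_def by (simp add: mod_simps)
  also have "i + (k + m * i - i) = k + m * i" using m2 by (simp add: trans_le_add2)
  finally have "j mod m = k mod m" by simp
  then have "z = cis (\<Phi> j)" using cis_mod[of j] cis_mod[of k] z by simp
  moreover have "j \<in> {i..<i + m}" using m2 by (simp add: j_def)
  ultimately show "z \<in> (\<lambda>k. cis (\<Phi> k)) ` {i..<i + m}" by blast
qed auto

text \<open>Any direction has a representative within the turn that starts at
  \<open>\<Phi> 0\<close>, and the first lifted angle beyond it ends the required arc. It locates
  the antipode of a direction below, and later the triangle that contains a given point of the
  polygon.\<close>

lemma covering_arc: "\<exists>k<m. \<exists>\<alpha>. cis \<alpha> = cis \<beta> \<and> \<Phi> k \<le> \<alpha> \<and> \<alpha> < \<Phi> (Suc k)"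
proof -
  define n where "n = \<lfloor>(\<beta> - \<Phi> 0) / (2 * pi)\<rfloor>"
  define \<alpha> where "\<alpha> = \<beta> - 2 * pi * of_int n"
  have "of_int n \<le> (\<beta> - \<Phi> 0) / (2 * pi)" "(\<beta> - \<Phi> 0) / (2 * pi) < of_int n + 1"
    unfolding n_def by linarith+
  then have a: "\<Phi> 0 \<le> \<alpha>" "\<alpha> < \<Phi> 0 + 2 * pi" by (auto simp: \<alpha>_def field_simps)
  have "\<alpha> < \<Phi> m" using a period[of 0] by simp
  define k where "k = (LEAST k. \<alpha> < \<Phi> (Suc k))"
  have "\<alpha> < \<Phi> (Suc (m - 1))" using \<open>\<alpha> < \<Phi> m\<close> m2 by simp
  then have k: "\<alpha> < \<Phi> (Suc k)" "k \<le> m - 1"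
    unfolding k_def by (rule LeastI, rule Least_le)
  have "\<Phi> k \<le> \<alpha>"
  proof (cases k)
    case (Suc j)
    then have "\<not> \<alpha> < \<Phi> (Suc j)" using not_less_Least[of j "\<lambda>k. \<alpha> < \<Phi> (Suc k)"] k_def by auto
    then show ?thesis using Suc by simp
  qed (use a in simp)
  moreover have "cis \<alpha> = cis \<beta>"
    by (auto simp: \<alpha>_def cis.ctr complex_eq_iff cos_diff sin_diff)
  ultimately show ?thesis using k m2 by (intro exI[of _ k]) auto
qed

text \<open>Some arc between consecutive points contains the direction opposite to \<delta>. If all
  points were in the closed half-plane of \<delta>, both ends of that arc would be at least
  \<open>pi / 2\<close> away from this direction, and the arc would have length at least
  \<pi>.\<close>

lemma no_closed_semicircle:
  assumes "\<And>k. \<Phi> (Suc k) - \<Phi> k < pi"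
  shows "\<exists>k<m. cos (\<Phi> k - \<delta>) < 0"
proof (rule ccontr)
  assume "\<not> ?thesis"
  then have nn: "cos (\<Phi> k - \<delta>) \<ge> 0" if "k < m" for k using that by force
  have nn': "cos (\<Phi> k - \<delta>) \<ge> 0" for k
  proof -
    have "Re (cis (\<Phi> (k mod m)) * cis (- \<delta>)) = Re (cis (\<Phi> k) * cis (- \<delta>))" by (simp only: cis_mod)
    then show ?thesis using nn[of "k mod m"] m2 by (simp add: cis_mult)
  qed
  obtain k \<alpha> where a: "cis \<alpha> = cis (\<delta> + pi)" "\<Phi> k \<le> \<alpha>" "\<alpha> < \<Phi> (Suc k)"
    using covering_arc by blast
  have c: "cos (\<Phi> j - \<alpha>) \<le> 0" for j
  proof -
    have "cis (\<Phi> j - \<alpha>) = - cis (\<Phi> j - \<delta>)"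
      using a(1) by (simp add: cis_divide[symmetric] cis_mult[symmetric])
    then have "cos (\<Phi> j - \<alpha>) = - cos (\<Phi> j - \<delta>)" by (metis cis.sel(1) uminus_complex.sel(1))
    then show ?thesis using nn'[of j] by simp
  qed
  have "\<alpha> - \<Phi> k \<ge> pi / 2"
  proof (rule ccontr)
    assume "\<not> ?thesis"
    then have "cos (\<alpha> - \<Phi> k) > 0" using a by (intro cos_gt_zero_pi) (use pi_gt_zero in linarith)+
    then show False using c[of k] by (metis cos_minus minus_diff_eq not_le)
  qed
  moreover have "\<Phi> (Suc k) - \<alpha> \<ge> pi / 2"
  proof (rule ccontr)
    assume "\<not> ?thesis"
    then have "cos (\<Phi> (Suc k) - \<alpha>) > 0" using a
        by (intro cos_gt_zero_pi) (use pi_gt_zero in linarith)+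
    then show False using c[of "Suc k"] by simp
  qed
  ultimately show False using assms[of k] by simp
qed

text \<open>The witness is the direction opposite to the middle of the large gap; all points are
  within \<open>pi / 2\<close> of it.\<close>

lemma closed_semicircle_of_large_gap:
  assumes "\<Phi> (Suc k) - \<Phi> k \<ge> pi"
  shows "\<exists>\<delta>. \<forall>j. cos (\<Phi> j - \<delta>) \<ge> 0"
proof -
  define \<delta> where "\<delta> = (\<Phi> k + \<Phi> (Suc k)) / 2 + pi"
  have *: "cos (\<Phi> j - \<delta>) \<ge> 0" if "j \<in> {Suc k..<Suc k + m}" for j
  proof -
    have "\<Phi> (Suc k) \<le> \<Phi> j" "\<Phi> j \<le> \<Phi> (k + m)" using that by auto
    then have "\<Phi> (Suc k) \<le> \<Phi> j" "\<Phi> j \<le> \<Phi> k + 2 * pi" using period[of k] by auto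
    then have "- (pi / 2) \<le> \<Phi> j - \<delta>" "\<Phi> j - \<delta> \<le> pi / 2"
      using assms unfolding \<delta>_def by argo+
    then show ?thesis by (rule cos_ge_zero)
  qed
  have "cos (\<Phi> j - \<delta>) \<ge> 0" for j
  proof -
    have "cis (\<Phi> j) \<in> (\<lambda>k. cis (\<Phi> k)) ` {Suc k..<Suc k + m}"
      using range_points by blast
    then obtain i where i: "i \<in> {Suc k..<Suc k + m}" "cis (\<Phi> j) = cis (\<Phi> i)" by auto
    have "Re (cis (\<Phi> j) * cis (- \<delta>)) = Re (cis (\<Phi> i) * cis (- \<delta>))" by (simp only: i)
    then show ?thesis using *[OF i(1)] by (simp add: cis_mult)
  qed
  then show ?thesis by blast
qed

end

section \<open>Tangent lines and the order of the points of tangency\<close>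

lemma tangent_line_cis: "z \<in> tangent_line (cis \<alpha>) \<longleftrightarrow> Re (z * cis (- \<alpha>)) = 1"
proof -
  have "(z - cis \<alpha>) \<bullet> cis \<alpha> = Re z * cos \<alpha> + Im z * sin \<alpha> - ((cos \<alpha>)\<^sup>2 + (sin \<alpha>)\<^sup>2)"
    by (simp add: inner_complex_def algebra_simps power2_eq_square)
  then show ?thesis by (simp add: tangent_line_def)
qed

lemma tan_half_real: "tan (g / 2) = sin (g::real) / (1 + cos g)"
  using tan_half[of "g / 2"] by simp

text \<open>After rotation by \<open>- \<alpha>\<close> the first tangent is the line of real part
  1, and the second one gives a linear equation for the imaginary part. It has a single solution
  because \<open>sin g\<close> is positive, and the half-angle formula identifies it.\<close>

lemma tangent_lines_inter:
  assumes "0 < g" "g < pi"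
  shows "tangent_line (cis \<alpha>) \<inter> tangent_line (cis (\<alpha> + g)) = {cis \<alpha> * Complex 1 (tan (g / 2))}"
proof -
  have s: "sin g > 0" using assms by (intro sin_gt_zero)
  have c: "1 + cos g \<noteq> 0"
  proof
    assume "1 + cos g = 0"
    then have "(cos g)\<^sup>2 = 1" by (simp add: power2_eq_square add_eq_0_iff2)
    then show False using s sin_cos_squared_add[of g] by simp
  qed
  have key: "cos g + s * sin g = 1 \<longleftrightarrow> s = tan (g / 2)" for s
  proof -
    have "(sin g)\<^sup>2 = (1 - cos g) * (1 + cos g)" using sin_cos_squared_add[of g]
        by (simp add: algebra_simps power2_eq_square)
    then have t: "tan (g / 2) * sin g = 1 - cos g" unfolding tan_half_real using c
      by (simp add: field_simps power2_eq_square)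
    have "cos g + s * sin g = 1 \<longleftrightarrow> (s - tan (g / 2)) * sin g = 0"
      using t unfolding left_diff_distrib by auto
    then show ?thesis using s by simp
  qed
  have "z \<in> tangent_line (cis \<alpha>) \<inter> tangent_line (cis (\<alpha> + g)) \<longleftrightarrow> z
      = cis \<alpha> * Complex 1 (tan (g / 2))" for z
  proof -
    define w where "w = z * cis (- \<alpha>)"
    have z: "z = cis \<alpha> * w" by (simp add: w_def cis_mult)
    have "z * cis (- (\<alpha> + g)) = w * cis (- g)" by (simp add: w_def mult.assoc cis_mult)
    then have "z \<in> tangent_line (cis \<alpha>) \<inter> tangent_line (cis (\<alpha> + g)) \<longleftrightarrow> Re w = 1 \<and> Re (w * cis (- g))
        = 1"
      unfolding Int_iff tangent_line_cis w_def[symmetric] by (simp only:)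
    also have "\<dots> \<longleftrightarrow> Re w = 1 \<and> Im w = tan (g / 2)" using key[of "Im w"] by auto
    also have "\<dots> \<longleftrightarrow> w = Complex 1 (tan (g / 2))" by (simp add: complex_eq_iff)
    also have "\<dots> \<longleftrightarrow> z = cis \<alpha> * Complex 1 (tan (g / 2))" unfolding z by simp
    finally show ?thesis .
  qed
  then show ?thesis by auto
qed

lemma cos_le_cos_far:
  assumes "0 \<le> a" "a \<le> pi" "a \<le> x" "x \<le> 2 * pi - a"
  shows "cos x \<le> cos a"
proof (cases "x \<le> pi")
  case True
  then show ?thesis using assms by (intro cos_monotone_0_pi_le) auto
next
  case False
  have "cos (2 * pi - x) \<le> cos a" using False assms by (intro cos_monotone_0_pi_le) auto
  then show ?thesis by (simp add: cos_diff)
qed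

context cyclic_angles
begin

lemma Arg2pi_quotient:
  assumes "k \<le> j" "j < k + m"
  shows "Arg2pi (cis (\<Phi> j) / cis (\<Phi> k)) = \<Phi> j - \<Phi> k"
proof (rule Arg2pi_unique[where r = 1])
  have "\<Phi> j < \<Phi> (k + m)" using assms by simp
  then show "\<Phi> j - \<Phi> k < 2 * pi" using period[of k] by simp
  show "0 \<le> \<Phi> j - \<Phi> k" using assms by simp
qed (simp_all add: cis_divide, simp add: cis_conv_exp)

lemma points_eq_iff:
  assumes "k \<le> j" "j < k + m"
  shows "cis (\<Phi> j) = cis (\<Phi> k) \<longleftrightarrow> j = k"
  using Arg2pi_quotient[OF assms] Arg2pi_quotient[of k k] assms(1)
  by (metis assms angles_less_iff diff_self le_neq_implies_less less_le_trans not_add_less1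
      eq_iff_diff_eq_0 order_less_irrefl cancel_comm_monoid_add_class.diff_cancel linorder_not_less)

lemma points_diff:
  "range (\<lambda>k. cis (\<Phi> k)) - {cis (\<Phi> k)} = (\<lambda>k. cis (\<Phi> k)) ` {Suc k..<k + m}"
proof -
  have "{k..<k + m} = insert k {Suc k..<k + m}" using m2 by auto
  moreover have "cis (\<Phi> k) \<notin> (\<lambda>k. cis (\<Phi> k)) ` {Suc k..<k + m}"
  proof
    assume "cis (\<Phi> k) \<in> (\<lambda>k. cis (\<Phi> k)) ` {Suc k..<k + m}"
    then obtain j where "Suc k \<le> j" "j < k + m" "cis (\<Phi> j) = cis (\<Phi> k)" by force
    then show False using points_eq_iff[of k j] by simp
  qed
  ultimately show ?thesis using range_points[of k] by auto
qed

text \<open>Within one turn \<open>Arg2pi\<close> of a quotient is the difference of the lifted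
  angles, and this is least at the next index.\<close>

lemma cyclic_succ_iff:
  "cyclic_succ (range (\<lambda>k. cis (\<Phi> k))) (cis (\<Phi> k)) w \<longleftrightarrow> w = cis (\<Phi> (Suc k))"
proof
  assume "cyclic_succ (range (\<lambda>k. cis (\<Phi> k))) (cis (\<Phi> k)) w"
  then have w: "w \<in> (\<lambda>k. cis (\<Phi> k)) ` {Suc k..<k + m}"
    and min: "\<And>x. x \<in> (\<lambda>k. cis (\<Phi> k)) ` {Suc k..<k + m} \<Longrightarrow>
        Arg2pi (w / cis (\<Phi> k)) \<le> Arg2pi (x / cis (\<Phi> k))"
    unfolding cyclic_succ_def points_diff by auto
  from w obtain j where j: "Suc k \<le> j" "j < k + m" "w = cis (\<Phi> j)" by auto
  have "Arg2pi (w / cis (\<Phi> k)) \<le> Arg2pi (cis (\<Phi> (Suc k)) / cis (\<Phi> k))"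
    using m2 by (intro min imageI) auto
  then have "\<Phi> j \<le> \<Phi> (Suc k)" using j m2 Arg2pi_quotient[of k j] Arg2pi_quotient[of k "Suc k"]
      by simp
  then show "w = cis (\<Phi> (Suc k))" using j by simp
next
  assume w: "w = cis (\<Phi> (Suc k))"
  have "Arg2pi (w / cis (\<Phi> k)) \<le> Arg2pi (cis (\<Phi> j) / cis (\<Phi> k))" if "j \<in> {Suc k..<k + m}" for j
    using that w m2 Arg2pi_quotient[of k j] Arg2pi_quotient[of k "Suc k"] by simp
  then show "cyclic_succ (range (\<lambda>k. cis (\<Phi> k))) (cis (\<Phi> k)) w"
    unfolding cyclic_succ_def points_diff using w m2 by auto
qed

lemma determines_polygon_iff:
  "determines_polygon (range (\<lambda>k. cis (\<Phi> k))) \<longleftrightarrow> (\<forall>k. \<Phi> (Suc k) - \<Phi> k < pi)"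
proof
  assume d: "determines_polygon (range (\<lambda>k. cis (\<Phi> k)))"
  show "\<forall>k. \<Phi> (Suc k) - \<Phi> k < pi"
  proof (rule ccontr)
    assume "\<not> ?thesis"
    then obtain k where "\<Phi> (Suc k) - \<Phi> k \<ge> pi" by (auto simp: not_less)
    then obtain \<delta> where "\<And>j. cos (\<Phi> j - \<delta>) \<ge> 0" using closed_semicircle_of_large_gap by blast
    then have "range (\<lambda>k. cis (\<Phi> k)) \<subseteq> closed_semicircle (cis \<delta>)"
      by (auto simp: closed_semicircle_def inner_complex_def cos_diff)
    then show False using d unfolding determines_polygon_def
        by (metis dist_0_norm mem_sphere norm_cis)
  qed
next
  assume gaps: "\<forall>k. \<Phi> (Suc k) - \<Phi> k < pi"
  have False if d: "d \<in> sphere 0 1" "range (\<lambda>k. cis (\<Phi> k)) \<subseteq> closed_semicircle d" for d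
  proof -
    obtain \<delta> where \<delta>: "d = cis \<delta>"
      using d(1) by (metis cis_Arg complex_unit_circle dist_0_norm mem_sphere norm_zero sgn_div_norm
          inverse_1 scaleR_one zero_neq_one)
    have "cos (\<Phi> k - \<delta>) \<ge> 0" for k
    proof -
      have "cis (\<Phi> k) \<in> closed_semicircle d" using d(2) by auto
      then show ?thesis by (simp add: closed_semicircle_def inner_complex_def cos_diff \<delta>)
    qed
    then show False using no_closed_semicircle[of \<delta>] gaps by (auto simp: not_less[symmetric])
  qed
  then show "determines_polygon (range (\<lambda>k. cis (\<Phi> k)))"
    unfolding determines_polygon_def by auto
qed

end

section \<open>Decomposition of the circumscribed polygon into triangles\<close>

locale polygon_angles = cyclic_angles +
  assumes gap_less_pi: "\<Phi> (Suc k) - \<Phi> k < pi"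
begin

definition half_tan :: "nat \<Rightarrow> real" where "half_tan k = tan ((\<Phi> (Suc k) - \<Phi> k) / 2)"
definition vertex :: "nat \<Rightarrow> complex" where "vertex k = cis (\<Phi> k) * Complex 1 (half_tan k)"
definition mid_angle :: "nat \<Rightarrow> real" where "mid_angle k = (\<Phi> k + \<Phi> (Suc k)) / 2"

lemma half_gap: "0 < (\<Phi> (Suc k) - \<Phi> k) / 2" "(\<Phi> (Suc k) - \<Phi> k) / 2 < pi / 2"
  using incr[of k] gap_less_pi[of k] by auto

lemma half_tan_pos: "half_tan k > 0"
  unfolding half_tan_def using half_gap by (intro tan_gt_zero)

lemma cos_half_gap_pos: "cos ((\<Phi> (Suc k) - \<Phi> k) / 2) > 0"
  using half_gap[of k] by (intro cos_gt_zero_pi) linarith+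

text \<open>Polar form from the right triangle formed by the centre, a tangent point and the vertex;
  it turns statements on vertices into statements on \<open>mid_angle\<close>.\<close>

lemma vertex_eq_cis: "vertex k = cis (mid_angle k) / of_real (cos ((\<Phi> (Suc k) - \<Phi> k) / 2))"
proof -
  let ?h = "(\<Phi> (Suc k) - \<Phi> k) / 2"
  have "Complex 1 (half_tan k) = cis ?h / of_real (cos ?h)"
    using cos_half_gap_pos[of k] by (simp add: complex_eq_iff half_tan_def tan_def)
  moreover have "cis (\<Phi> k) * cis ?h = cis (mid_angle k)"
    by (simp add: cis_mult mid_angle_def field_simps)
  ultimately show ?thesis by (simp add: vertex_def)
qed

text \<open>The same vertex seen from its other tangent point. With it, both vertices of
  \<open>sector k\<close> can be written in the frame of the tangent point
  \<open>Suc k\<close>.\<close>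

lemma vertex_eq_Suc: "vertex k = cis (\<Phi> (Suc k)) * Complex 1 (- half_tan k)"
proof -
  let ?h = "(\<Phi> (Suc k) - \<Phi> k) / 2"
  have "Complex 1 (- half_tan k) = cis (- ?h) / of_real (cos ?h)"
    using cos_half_gap_pos[of k] by (simp add: complex_eq_iff half_tan_def tan_def)
  moreover have "cis (\<Phi> (Suc k)) * cis (- ?h) = cis (mid_angle k)"
    by (simp add: cis_mult mid_angle_def field_simps)
  ultimately show ?thesis by (simp add: vertex_eq_cis)
qed

lemma half_tan_period: "half_tan (k + m) = half_tan k"
  using period[of k] period[of "Suc k"] by (simp add: half_tan_def)

lemma vertex_period: "vertex (k + m) = vertex k"
  by (simp add: vertex_def half_tan_period cis_period)

lemma polygon_vertices_eq: "polygon_vertices (range (\<lambda>k. cis (\<Phi> k))) = range vertex"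
proof -
  have "tangent_line (cis (\<Phi> k)) \<inter> tangent_line (cis (\<Phi> (Suc k))) = {vertex k}" for k
    using tangent_lines_inter[of "\<Phi> (Suc k) - \<Phi> k" "\<Phi> k"] incr[of k] gap_less_pi[of k]
    by (simp add: vertex_def half_tan_def)
  moreover have "{(u, w). cyclic_succ (range (\<lambda>k. cis (\<Phi> k))) u w}
      = range (\<lambda>k. (cis (\<Phi> k), cis (\<Phi> (Suc k))))"
    using cyclic_succ_iff by (auto simp: cyclic_succ_def)
  ultimately show ?thesis unfolding polygon_vertices_def by auto
qed

text \<open>Allows the results on arcs and semicircles to be used for the directions of the vertices
  as well.\<close>

lemma cyclic_mid_angles: "cyclic_angles mid_angle m"
proof
  show "mid_angle k < mid_angle (Suc k)" for k
    using incr[of k] incr[of "Suc k"] by (simp add: mid_angle_def)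
  show "mid_angle (k + m) = mid_angle k + 2 * pi" for k
    using period[of k] period[of "Suc k"] by (simp add: mid_angle_def field_simps)
qed (rule m2)

text \<open>The triangle over the polygon side that touches the circle at the point with index
  \<open>Suc k\<close>, not \<open>k\<close>.\<close>

definition sector :: "nat \<Rightarrow> complex set" where
  "sector k = convex hull {0, vertex k, vertex (Suc k)}"

text \<open>In the frame of the tangent point \<open>Suc k\<close> the side lies on the line
  \<open>x = 1\<close>, and the triangle is the part of a cone with apex 0 up to that line.\<close>

lemma mem_sector_iff:
  "z \<in> sector k \<longleftrightarrow> (\<exists>x y. z = cis (\<Phi> (Suc k)) * Complex x y \<and> 0 \<le> x \<and> x \<le> 1
      \<and> - half_tan k * x \<le> y \<and> y \<le> half_tan (Suc k) * x)"
proof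
  assume "z \<in> sector k"
  then obtain a b c where abc: "0 \<le> a" "0 \<le> b" "0 \<le> c" "a + b + c = 1"
    and z: "z = a *\<^sub>R 0 + b *\<^sub>R vertex k + c *\<^sub>R vertex (Suc k)"
    unfolding sector_def convex_hull_3 by auto
  have "z = cis (\<Phi> (Suc k)) * Complex (b + c) (- half_tan k * b + half_tan (Suc k) * c)"
    unfolding z vertex_eq_Suc[of k] vertex_def[of "Suc k"]
    by (simp add: complex_eq_iff algebra_simps)
  moreover have "half_tan k * c \<ge> 0" "half_tan k * b \<ge> 0" "half_tan (Suc k)
      * b \<ge> 0" "half_tan (Suc k) * c \<ge> 0"
    using abc half_tan_pos[of k] half_tan_pos[of "Suc k"] by simp_all
  ultimately show "\<exists>x y. z = cis (\<Phi> (Suc k)) * Complex x y \<and> 0 \<le> x \<and> x \<le> 1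
      \<and> - half_tan k * x \<le> y \<and> y \<le> half_tan (Suc k) * x"
    using abc by (intro exI[of _ "b + c"] exI[of _ "- half_tan k * b + half_tan (Suc k) * c"])
      (auto simp: algebra_simps)
next
  assume "\<exists>x y. z = cis (\<Phi> (Suc k)) * Complex x y \<and> 0 \<le> x \<and> x \<le> 1
      \<and> - half_tan k * x \<le> y \<and> y \<le> half_tan (Suc k) * x"
  then obtain x y where z: "z = cis (\<Phi> (Suc k)) * Complex x y" and xy: "0 \<le> x" "x \<le> 1"
    "- half_tan k * x \<le> y" "y \<le> half_tan (Suc k) * x" by blast
  define s where "s = half_tan k + half_tan (Suc k)"
  have s: "s > 0" using half_tan_pos[of k] half_tan_pos[of "Suc k"] by (simp add: s_def)
  \<comment> \<open>\<open>b\<close> and \<open>c\<close> solve \<open>b + c = x\<close> and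
    \<open>half_tan (Suc k) * c - half_tan k * b = y\<close>; they are the barycentric weights of
    the two vertices.\<close>
  define b where "b = (half_tan (Suc k) * x - y) / s"
  define c where "c = (half_tan k * x + y) / s"
  have bc: "b + c = x" using s by (simp add: b_def c_def s_def add_divide_distrib[symmetric]
      field_simps)
  have y: "- half_tan k * b + half_tan (Suc k) * c = y"
  proof -
    have "s * (- half_tan k * b + half_tan (Suc k) * c)
        = - half_tan k * (s * b) + half_tan (Suc k) * (s * c)"
      by (simp add: algebra_simps)
    also have "s * b = half_tan (Suc k) * x - y" using s by (simp add: b_def)
    also have "s * c = half_tan k * x + y" using s by (simp add: c_def)
    also have "- half_tan k * (half_tan (Suc k) * x - y) + half_tan (Suc k) * (half_tan k * x + y)
        = s * y"
      by (simp add: s_def algebra_simps)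
    finally show ?thesis using s by simp
  qed
  have "b \<ge> 0" "c \<ge> 0" using xy s by (auto simp: b_def c_def)
  moreover have "z = (1 - x) *\<^sub>R 0 + b *\<^sub>R vertex k + c *\<^sub>R vertex (Suc k)"
    unfolding z y[symmetric] bc[symmetric] vertex_eq_Suc[of k] vertex_def[of "Suc k"]
    by (simp add: complex_eq_iff algebra_simps)
  ultimately show "z \<in> sector k" unfolding sector_def convex_hull_3
    using xy bc by (intro CollectI exI[of _ "1 - x"] exI[of _ b] exI[of _ c]) auto
qed

text \<open>The height over the polygon side is 1, and the tangent point splits this side into
  lengths \<open>half_tan k\<close> and \<open>half_tan (Suc k)\<close>.\<close>

lemma measure_sector: "measure lebesgue (sector k) = (half_tan k + half_tan (Suc k)) / 2"
proof -
  let ?c = "cos (\<Phi> (Suc k))" and ?s = "sin (\<Phi> (Suc k))" and ?p = "half_tan k" and ?q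
      = "half_tan (Suc k)"
  have "Re (vertex k) * Im (vertex (Suc k)) - Im (vertex k) * Re (vertex (Suc k))
      = (?c\<^sup>2 + ?s\<^sup>2) * (?p + ?q)"
    unfolding vertex_eq_Suc[of k] vertex_def[of "Suc k"]
        by (simp add: algebra_simps power2_eq_square
      del: sin_cos_squared_add sin_cos_squared_add2 sin_cos_squared_add3)
  then show ?thesis unfolding sector_def measure_triangle_complex
    using half_tan_pos[of k] half_tan_pos[of "Suc k"] by simp
qed

text \<open>The full line through 0 rather than the ray: as a hyperplane it is known to be
  negligible, and it contains the common boundary of neighbouring triangles.\<close>

definition ray_line :: "nat \<Rightarrow> complex set" where
  "ray_line k = {z. (\<i> * cis (mid_angle k)) \<bullet> z = 0}"

lemma negligible_ray_line: "negligible (ray_line k)"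
  unfolding ray_line_def by (rule negligible_hyperplane) simp

lemma rcis_in_ray_line: "complex_of_real r * cis (mid_angle k) \<in> ray_line k"
  by (simp add: ray_line_def inner_complex_def)

lemma sector_polar:
  assumes "z \<in> sector k"
  obtains r \<alpha> where "z = of_real r * cis \<alpha>" "r \<ge> 0" "mid_angle k \<le> \<alpha>" "\<alpha> \<le> mid_angle (Suc k)"
proof -
  obtain x y where z: "z = cis (\<Phi> (Suc k)) * Complex x y" and xy: "0 \<le> x"
    "- half_tan k * x \<le> y" "y \<le> half_tan (Suc k) * x"
    using assms mem_sector_iff by auto
  show ?thesis
  proof (cases "x = 0")
    case True
    then have "z = 0" using z xy by (simp add: complex_eq_iff)
    then show ?thesis using that[of 0 "mid_angle k"] cyclic_angles.incr[OF cyclic_mid_angles, of k]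
        by simp
  next
    case False
    define \<beta> where "\<beta> = arctan (y / x)"
    have x: "x > 0" using False xy by simp
    have "- half_tan k \<le> y / x" "y / x \<le> half_tan (Suc k)" using xy x by (auto simp: field_simps)
    moreover have "arctan (half_tan j) = (\<Phi> (Suc j) - \<Phi> j) / 2" for j
      unfolding half_tan_def using half_gap[of j] by (intro arctan_tan) linarith+
    ultimately have "- ((\<Phi> (Suc k) - \<Phi> k) / 2) \<le> \<beta>" "\<beta> \<le> (\<Phi> (Suc (Suc k)) - \<Phi> (Suc k)) / 2"
      unfolding \<beta>_def by (metis arctan_le_iff arctan_minus)+
    then have "mid_angle k \<le> \<Phi> (Suc k) + \<beta>" "\<Phi> (Suc k) + \<beta> \<le> mid_angle (Suc k)"
      by (auto simp: mid_angle_def field_simps)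
    moreover have "y = x * tan \<beta>" using x by (simp add: \<beta>_def tan_arctan)
    moreover have cb: "cos \<beta> > 0" unfolding \<beta>_def cos_arctan by (simp add: add_pos_nonneg)
    ultimately show ?thesis
      using x by (intro that[of "x / cos \<beta>" "\<Phi> (Suc k) + \<beta>"])
        (auto simp: z complex_eq_iff cis_mult[symmetric] tan_def field_simps)
  qed
qed

lemma cis_eq_within_turn:
  assumes "cis a = cis b" "a \<le> b" "b \<le> a + 2 * pi"
  shows "b = a \<or> b = a + 2 * pi"
proof (rule ccontr)
  assume "\<not> ?thesis"
  then have "0 \<le> b - a" "b - a < 2 * pi" "b \<noteq> a" using assms by auto
  moreover have "cis (b - a) = 1" using assms(1) by (simp add: cis_divide[symmetric])
  then have "cos (b - a) = 1" by (metis cis.sel(1) one_complex.sel(1))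
  ultimately show False using cos_eq_1 [of "b - a"] 
    by (metis cos_one_2pi cos_one_2pi_int diff_ge_0_iff_ge eq_iff_diff_eq_0 Arg2pi_unique
        cis_conv_exp \<open>cis (b - a) = 1\<close>
         mult_1 of_real_1 zero_less_one order_refl pi_gt_zero mult_pos_pos zero_less_numeral
             exp_zero mult_zero_right of_real_0)
qed

text \<open>A common point other than 0 has polar angles \<alpha> and \<beta> in the two ranges that
  differ by 0 or \<open>2 * pi\<close>. Since \<open>\<alpha> \<le> mid_angle k \<le> \<beta> \<le>
  mid_angle (Suc k) \<le> \<alpha> + 2 * pi\<close>, the angle \<beta> is an end of its range. The
  point 0 lies on every \<open>ray_line\<close>.\<close>

lemma sector_inter: assumes "j < k" "k < m" shows "sector j \<inter> sector k \<subseteq> ray_line k \<union> ray_line (Suc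
    k)"
proof
  interpret mid: cyclic_angles mid_angle m by (rule cyclic_mid_angles)
  fix z assume z: "z \<in> sector j \<inter> sector k"
  obtain r \<alpha> where a: "z = of_real r * cis \<alpha>" "r \<ge> 0" "mid_angle j \<le> \<alpha>" "\<alpha> \<le> mid_angle (Suc j)"
    using z sector_polar by blast
  obtain s \<beta> where b: "z = of_real s * cis \<beta>" "s \<ge> 0" "mid_angle k \<le> \<beta>" "\<beta> \<le> mid_angle (Suc k)"
    using z sector_polar by blast
  have 1: "mid_angle (Suc j) \<le> mid_angle k" "mid_angle (Suc k) \<le> mid_angle (j + m)"
    using assms by auto
  have rs: "r = s" using a b by (metis abs_of_nonneg norm_cis norm_mult norm_of_real
      mult.right_neutral)
  show "z \<in> ray_line k \<union> ray_line (Suc k)"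
  proof (cases "s = 0")
    case True
    then show ?thesis using b rcis_in_ray_line[of 0 k] by simp
  next
    case False
    then have "cis \<alpha> = cis \<beta>" using a b rs by auto
    then have "\<beta> = \<alpha> \<or> \<beta> = \<alpha> + 2 * pi"
      by (rule cis_eq_within_turn) (use a(3,4) b(3,4) 1 mid.period[of j] in linarith)+
    then have "\<beta> = mid_angle k \<or> \<beta> = mid_angle (Suc k)"
      using a(3,4) b(3,4) 1 mid.period[of j] by linarith
    then show ?thesis using b rcis_in_ray_line by auto
  qed
qed

text \<open>A vertex is at distance \<open>1 / cos h\<close> from the centre, where \<open>h\<close>
  is its half gap, and every tangent point is at angular distance at least \<open>h\<close> from its
  direction. Reindexing the point into the turn that starts at \<open>Suc j\<close> makes this
  visible.\<close>

lemma tangent_halfplane_vertex: "Re (vertex j * cis (- \<Phi> k)) \<le> 1"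
proof -
  have "cis (\<Phi> k) \<in> (\<lambda>k. cis (\<Phi> k)) ` {Suc j..<Suc j + m}" using range_points by blast
  then obtain i where i: "Suc j \<le> i" "i < Suc j + m" "cis (\<Phi> k) = cis (\<Phi> i)" by auto
  let ?h = "(\<Phi> (Suc j) - \<Phi> j) / 2"
  have "\<Phi> (Suc j) \<le> \<Phi> i" "\<Phi> i \<le> \<Phi> (j + m)" using i by auto
  then have "cos (\<Phi> i - mid_angle j) \<le> cos ?h"
    by (intro cos_le_cos_far) (use period[of j] half_gap[of j] in \<open>unfold mid_angle_def, argo+\<close>)
  moreover have "Re (vertex j * cis (- \<Phi> k)) = cos (\<Phi> i - mid_angle j) / cos ?h"
  proof -
    have "cis (- \<Phi> k) = cis (- \<Phi> i)" using i(3) by (metis cis_cnj)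
    then have "vertex j * cis (- \<Phi> k) = cis (mid_angle j - \<Phi> i) / of_real (cos ?h)"
      by (simp add: vertex_eq_cis cis_mult)
    then show ?thesis by (simp add: cos_diff mult.commute)
  qed
  ultimately show ?thesis using cos_half_gap_pos[of j] by (simp add: divide_le_eq)
qed

text \<open>There are finitely many vertices, so their hull is compact and could otherwise be
  strictly separated from 0. But the directions of the vertices also have gaps below \<pi>, being
  averages of two consecutive gaps, so some vertex lies on the negative side of any
  direction.\<close>

lemma zero_in_polygon: "0 \<in> convex hull (range vertex)"
proof (rule ccontr)
  interpret mid: cyclic_angles mid_angle m by (rule cyclic_mid_angles)
  assume no: "0 \<notin> convex hull (range vertex)"
  have "range vertex = vertex ` {..<m}"
  proof (intro antisym subsetI)
    fix z assume "z \<in> range vertex"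
    then obtain k where "z = vertex k" by auto
    moreover have "vertex k = vertex (k mod m)"
    proof (induction k rule: less_induct)
      case (less k)
      show ?case
      proof (cases "k < m")
        case False
        then have "vertex (k - m) = vertex ((k - m) mod m)" using m2 by (intro less) auto
        then show ?thesis using False vertex_period[of "k - m"] by (simp add: le_mod_geq)
      qed auto
    qed
    ultimately show "z \<in> vertex ` {..<m}" using m2 by auto
  qed auto
  then have "compact (convex hull (range vertex))" by (simp add: finite_imp_compact_convex_hull)
  then obtain d b where d: "b > 0" "\<And>z. z \<in> convex hull (range vertex) \<Longrightarrow> d \<bullet> z > b"
    using separating_hyperplane_closed_0[of "convex hull (range vertex)"] no
    by (metis compact_imp_closed convex_convex_hull)
  have dpos: "d \<bullet> vertex k > 0" for k using d by (meson hull_inc less_trans rangeI)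
  define \<delta> where "\<delta> = Arg d"
  have d': "d = of_real (cmod d) * cis \<delta>" by (metis \<delta>_def rcis_cmod_Arg rcis_def)
  have gaps: "mid_angle (Suc k) - mid_angle k < pi" for k
    using gap_less_pi[of k] gap_less_pi[of "Suc k"] by (simp add: mid_angle_def field_simps)
  obtain k where k: "cos (mid_angle k - \<delta>) < 0" using mid.no_closed_semicircle[of \<delta>] gaps by blast
  have "d \<bullet> vertex k = cmod d * cos (mid_angle k - \<delta>) / cos ((\<Phi> (Suc k) - \<Phi> k) / 2)"
    by (subst d', simp add: vertex_eq_cis inner_complex_def cos_diff) (simp add: algebra_simps
        add_divide_distrib)
  also have "\<dots> \<le> 0" using k cos_half_gap_pos[of k]
      by (intro divide_nonpos_pos mult_nonneg_nonpos) auto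
  finally show False using dpos[of k] by simp
qed

text \<open>The direction of a point of the polygon selects a triangle, and the tangent half-plane
  of that triangle's side bounds its distance from the centre. Conversely the polygon contains 0 and
  all vertices, hence each triangle.\<close>

lemma polygon_eq_sectors: "convex hull (range vertex) = \<Union> (sector ` {..<m})"
proof (intro antisym subsetI)
  interpret mid: cyclic_angles mid_angle m by (rule cyclic_mid_angles)
  fix z assume z: "z \<in> convex hull (range vertex)"
  have H: "Re (z * cis (- \<Phi> k)) \<le> 1" for k
  proof -
    have "convex {w. Re (w * cis (- \<Phi> k)) \<le> 1}"
    proof -
      have "{w. Re (w * cis (- \<Phi> k)) \<le> 1} = {w. cis (\<Phi> k) \<bullet> w \<le> 1}"
        by (auto simp: inner_complex_def mult.commute)
      then show ?thesis by (simp add: convex_halfspace_le)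
    qed
    then have "convex hull (range vertex) \<subseteq> {w. Re (w * cis (- \<Phi> k)) \<le> 1}"
      using tangent_halfplane_vertex by (intro hull_minimal) auto
    then show ?thesis using z by auto
  qed
  define r where "r = cmod z"
  obtain k \<alpha> where k: "k < m" "cis \<alpha> = cis (Arg z)" "mid_angle k \<le> \<alpha>" "\<alpha> < mid_angle (Suc k)"
    using mid.covering_arc by blast
  have zr: "z = of_real r * cis \<alpha>" unfolding k(2) r_def by (metis rcis_cmod_Arg rcis_def)
  define \<beta> where "\<beta> = \<alpha> - \<Phi> (Suc k)"
  have b: "- ((\<Phi> (Suc k) - \<Phi> k) / 2) \<le> \<beta>" "\<beta> \<le> (\<Phi> (Suc (Suc k)) - \<Phi> (Suc k)) / 2"
    using k by (auto simp: \<beta>_def mid_angle_def field_simps)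
  have b2: "- (pi / 2) < \<beta>" "\<beta> < pi / 2" using b half_gap[of k] half_gap[of "Suc k"] by linarith+
  have cb: "cos \<beta> > 0" using b2 by (intro cos_gt_zero_pi) auto
  have zb: "z = cis (\<Phi> (Suc k)) * Complex (r * cos \<beta>) (r * sin \<beta>)"
  proof -
    have "Complex (r * cos \<beta>) (r * sin \<beta>) = of_real r * cis \<beta>" by (simp add: complex_eq_iff)
    moreover have "cis \<alpha> = cis (\<Phi> (Suc k)) * cis \<beta>" by (simp add: cis_mult \<beta>_def)
    ultimately show ?thesis by (simp add: zr mult.left_commute)
  qed
  have "z * cis (- \<Phi> (Suc k)) = of_real r * cis \<beta>" unfolding zr
      by (simp add: cis_mult \<beta>_def mult.assoc)
  then have "Re (of_real r * cis \<beta>) \<le> 1" using H[of "Suc k"] by metis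
  then have x1: "r * cos \<beta> \<le> 1" by simp
  have x0: "r * cos \<beta> \<ge> 0" using cb by (simp add: r_def)
  have tb: "r * sin \<beta> = tan \<beta> * (r * cos \<beta>)" using cb by (simp add: tan_def)
  have "tan (- ((\<Phi> (Suc k) - \<Phi> k) / 2)) \<le> tan \<beta>"
    using b b2 half_gap[of k] by (intro tan_mono_le) auto
  moreover have "tan \<beta> \<le> tan ((\<Phi> (Suc (Suc k)) - \<Phi> (Suc k)) / 2)"
    using b b2 half_gap[of "Suc k"] by (intro tan_mono_le) auto
  ultimately have "- half_tan k * (r * cos \<beta>) \<le> r * sin \<beta>" "r * sin \<beta>
      \<le> half_tan (Suc k) * (r * cos \<beta>)"
    unfolding tb half_tan_def by (intro mult_right_mono x0; simp)+
  then have "z \<in> sector k" using zb x0 x1 mem_sector_iff by blast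
  then show "z \<in> \<Union> (sector ` {..<m})" using k by auto
next
  fix z assume "z \<in> \<Union> (sector ` {..<m})"
  then obtain k where "z \<in> sector k" by auto
  moreover have "sector k \<subseteq> convex hull (range vertex)" unfolding sector_def
    using zero_in_polygon by (intro hull_minimal) (auto intro: hull_inc)
  ultimately show "z \<in> convex hull (range vertex)" by auto
qed

text \<open>Each \<open>half_tan k\<close> appears, halved, in two neighbouring triangles;
  periodicity closes the sum.\<close>

lemma area_circumscribed_polygon:
  "measure lebesgue (circumscribed_polygon (range (\<lambda>k. cis (\<Phi> k)))) = (\<Sum>k<m. half_tan k)"
proof -
  have "measure lebesgue (\<Union> (sector ` {..<m})) = (\<Sum>k<m. measure lebesgue (sector k))"
  proof (rule measure_negligible_finite_Union_image)
    show "sector k \<in> lmeasurable" for k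
      unfolding sector_def by (intro lmeasurable_compact finite_imp_compact_convex_hull) auto
    have "negligible (sector j \<inter> sector k)" if "j < k" "k < m" for j k
      using sector_inter[OF that] negligible_ray_line by (meson negligible_Un negligible_subset)
    then show "pairwise (\<lambda>j k. negligible (sector j \<inter> sector k)) {..<m}"
      unfolding pairwise_def by (metis Int_commute lessThan_iff linorder_neqE_nat)
  qed simp
  also have "\<dots> = ((\<Sum>k<m. half_tan k) + (\<Sum>k<m. half_tan (Suc k))) / 2"
    by (simp add: measure_sector sum.distrib sum_divide_distrib[symmetric])
  also have "(\<Sum>k<m. half_tan (Suc k)) = (\<Sum>k<m. half_tan k)"
    using sum.lessThan_Suc_shift[of half_tan m] half_tan_period[of 0] by simp
  finally show ?thesis unfolding circumscribed_polygon_def polygon_vertices_eq polygon_eq_sectors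
      by simp
qed

end

section \<open>Polygons in terms of angles\<close>

definition cyclic_gap :: "nat \<Rightarrow> (nat \<Rightarrow> real) \<Rightarrow> nat \<Rightarrow> real" where
  "cyclic_gap m \<phi> k = (if Suc k = m then \<phi> 0 + 2 * pi else \<phi> (Suc k)) - \<phi> k"

text \<open>Positivity of all gaps, including the closing one, says that the angles increase and
  stay within one turn.\<close>

definition tight_angles :: "nat \<Rightarrow> real \<Rightarrow> (nat \<Rightarrow> real) \<Rightarrow> bool" where
  "tight_angles m c \<phi> \<longleftrightarrow> (\<forall>k<m. 0 < cyclic_gap m \<phi> k \<and> cyclic_gap m \<phi> k < pi)
     \<and> (\<Sum>k<m. tan (cyclic_gap m \<phi> k / 2)) \<le> c"

text \<open>Random points come without an order, so some enumeration in increasing order is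
  required. A finite union over enumerations keeps the event measurable.\<close>

definition tight_set :: "real \<Rightarrow> ('i \<Rightarrow> real) \<Rightarrow> 'i set \<Rightarrow> bool" where
  "tight_set c \<theta> I \<longleftrightarrow> (\<exists>xs\<in>permutations_of_set I. tight_angles (card I) c (\<lambda>k. \<theta> (xs ! k)))"

text \<open>Continues \<open>m\<close> angles to the lifted periodic sequence that
  \<open>cyclic_angles\<close> describes, one further turn for every \<open>m\<close>
  indices.\<close>

definition winding_extension :: "nat \<Rightarrow> (nat \<Rightarrow> real) \<Rightarrow> nat \<Rightarrow> real" where
  "winding_extension m \<phi> k = \<phi> (k mod m) + 2 * pi * real (k div m)"

lemma cyclic_gap_cong: "(\<And>k. k < m \<Longrightarrow> \<phi> k = \<psi> k) \<Longrightarrow> k < m \<Longrightarrow> cyclic_gap m \<phi> k = cyclic_gap m \<psi> k"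
  by (auto simp: cyclic_gap_def)

lemma tight_cong: "(\<And>k. k < m \<Longrightarrow> \<phi> k = \<psi> k) \<Longrightarrow> tight_angles m c \<phi> \<longleftrightarrow> tight_angles m c \<psi>"
  unfolding tight_angles_def using cyclic_gap_cong[of m \<phi> \<psi>] by simp

lemma tight_set_cong: "(\<And>i. i \<in> I \<Longrightarrow> \<theta> i = \<theta>' i) \<Longrightarrow> tight_set c \<theta> I \<longleftrightarrow> tight_set c \<theta>' I"
  unfolding tight_set_def
proof (intro bex_cong refl tight_cong)
  fix xs k assume "\<And>i. i \<in> I \<Longrightarrow> \<theta> i = \<theta>' i" "xs \<in> permutations_of_set I" "k < card I"
  then show "\<theta> (xs ! k) = \<theta>' (xs ! k)"
    by (metis distinct_card nth_mem permutations_of_setD)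
qed

lemma sum_cyclic_gap: "m > 0 \<Longrightarrow> (\<Sum>k<m. cyclic_gap m \<phi> k) = 2 * pi"
proof -
  assume "m > 0"
  then obtain d where m: "m = Suc d" by (cases m) auto
  have "(\<Sum>k<m. cyclic_gap m \<phi> k) = (\<Sum>k<d. \<phi> (Suc k) - \<phi> k) + (\<phi> 0 + 2 * pi - \<phi> d)"
    unfolding m sum.lessThan_Suc by (simp add: cyclic_gap_def)
  then show ?thesis by (simp add: sum_lessThan_telescope)
qed

lemma winding_extension_gap:
  assumes "m > 0"
  shows "winding_extension m \<phi> (Suc k) - winding_extension m \<phi> k = cyclic_gap m \<phi> (k mod m)"
proof (cases "Suc (k mod m) = m")
  case True
  then show ?thesis using assms
    by (simp add: winding_extension_def cyclic_gap_def mod_Suc div_Suc algebra_simps)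
next
  case False
  then show ?thesis using assms
    by (simp add: winding_extension_def cyclic_gap_def mod_Suc div_Suc)
qed

lemma cyclic_angles_winding_extension:
  assumes "m \<ge> 2" "\<And>k. k < m \<Longrightarrow> 0 < cyclic_gap m \<phi> k"
  shows "cyclic_angles (winding_extension m \<phi>) m"
proof
  fix k
  show "winding_extension m \<phi> k < winding_extension m \<phi> (Suc k)"
    using winding_extension_gap[of m \<phi> k] assms(2)[of "k mod m"] assms(1) by simp
  show "winding_extension m \<phi> (k + m) = winding_extension m \<phi> k + 2 * pi"
    using assms(1) by (simp add: winding_extension_def algebra_simps)
qed fact

lemma range_cis_winding_extension:
  assumes "m > 0"
  shows "range (\<lambda>k. cis (winding_extension m \<phi> k)) = (\<lambda>k. cis (\<phi> k)) ` {..<m}"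
proof -
  have c: "cis (winding_extension m \<phi> k) = cis (\<phi> (k mod m))" for k
  proof -
    have "cis (2 * pi * real (k div m)) = 1"
      using cos_2npi[of "k div m"] sin_2npi[of "k div m"] by (simp add: complex_eq_iff mult_ac)
    then show ?thesis unfolding winding_extension_def by (simp add: cis_mult[symmetric])
  qed
  have "(\<lambda>k. k mod m) ` UNIV = {..<m}"
    using assms by (auto simp: image_iff) (metis mod_less)
  then have "(\<lambda>k. cis (\<phi> k)) ` {..<m} = range (\<lambda>k. cis (\<phi> (k mod m)))" by (metis image_image)
  then show ?thesis unfolding c by simp
qed

lemma tight_iff_polygon:
  assumes m: "m \<ge> 2" and gap: "\<And>k. k < m \<Longrightarrow> 0 < cyclic_gap m \<phi> k"
  defines "A \<equiv> (\<lambda>k. cis (\<phi> k)) ` {..<m}"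
  shows "tight_angles m c \<phi> \<longleftrightarrow> determines_polygon A \<and> measure lebesgue (circumscribed_polygon A) \<le> c"
proof -
  let ?\<Phi> = "winding_extension m \<phi>"
  interpret cyclic_angles ?\<Phi> m by (rule cyclic_angles_winding_extension[OF m gap])
  have A: "A = range (\<lambda>k. cis (?\<Phi> k))" using m unfolding A_def
      by (simp add: range_cis_winding_extension)
  have gaps: "(\<forall>k. ?\<Phi> (Suc k) - ?\<Phi> k < pi) \<longleftrightarrow> (\<forall>k<m. cyclic_gap m \<phi> k < pi)"
    using m winding_extension_gap[of m \<phi>] by (metis mod_less mod_less_divisor less_le_trans pos2)
  show ?thesis
  proof (cases "\<forall>k<m. cyclic_gap m \<phi> k < pi")
    case True
    interpret polygon_angles ?\<Phi> m
      using True gaps by unfold_locales auto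
    have "measure lebesgue (circumscribed_polygon A) = (\<Sum>k<m. tan (cyclic_gap m \<phi> k / 2))"
      unfolding A area_circumscribed_polygon half_tan_def using m
          by (intro sum.cong) (auto simp: winding_extension_gap)
    moreover have "determines_polygon A" unfolding A determines_polygon_iff using True gaps by blast
    ultimately show ?thesis using True gap unfolding tight_angles_def by auto
  next
    case False
    then have "\<not> determines_polygon A" unfolding A determines_polygon_iff gaps .
    then show ?thesis using False unfolding tight_angles_def by auto
  qed
qed

lemma inj_on_cis_of_gaps:
  assumes m: "m \<ge> 2" and gap: "\<And>k. k < m \<Longrightarrow> 0 < cyclic_gap m \<phi> k"
  shows "inj_on (\<lambda>k. cis (\<phi> k)) {..<m}"
proof (rule inj_onI)
  let ?\<Phi> = "winding_extension m \<phi>"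
  interpret cyclic_angles ?\<Phi> m by (rule cyclic_angles_winding_extension[OF m gap])
  fix j k assume jk: "j \<in> {..<m}" "k \<in> {..<m}" "cis (\<phi> j) = cis (\<phi> k)"
  have "?\<Phi> i = \<phi> i" if "i < m" for i using that by (simp add: winding_extension_def)
  then have "cis (?\<Phi> j) = cis (?\<Phi> k)" using jk by simp
  then show "j = k"
  proof (cases "j \<le> k")
    case True
    have "k < j + m" using jk by simp
    from points_eq_iff[OF True this] show ?thesis using \<open>cis (?\<Phi> j) = cis (?\<Phi> k)\<close> by simp
  next
    case False
    then have "k \<le> j" "j < k + m" using jk by simp_all
    from points_eq_iff[OF this] show ?thesis using \<open>cis (?\<Phi> j) = cis (?\<Phi> k)\<close> by simp
  qed
qed

lemma sorted_gaps_pos: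
  assumes "\<And>k. Suc k < m \<Longrightarrow> \<phi> k < \<phi> (Suc k)" "\<And>k. k < m \<Longrightarrow> 0 \<le> \<phi> k \<and> \<phi> k < 2 * pi" "k < m"
  shows "0 < cyclic_gap m \<phi> k"
proof (cases "Suc k = m")
  case True
  then show ?thesis using assms(2)[of k] assms(2)[of 0] assms(3) by (auto simp: cyclic_gap_def)
qed (use assms in \<open>auto simp: cyclic_gap_def\<close>)

text \<open>Bridge between geometry and angles. For the converse direction \<open>I\<close> is
  sorted by angle: distinct points have distinct angles in the half-open turn, which makes all gaps
  positive.\<close>

lemma tight_set_iff_polygon:
  fixes I :: "'i set"
  assumes I: "finite I" "card I \<ge> 2" and range: "\<And>i. i \<in> I \<Longrightarrow> 0 \<le> \<theta> i \<and> \<theta> i < 2 * pi"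
  defines "A \<equiv> (\<lambda>i. cis (\<theta> i)) ` I"
  shows "tight_set c \<theta> I \<longleftrightarrow> inj_on (\<lambda>i. cis (\<theta> i)) I \<and> determines_polygon A
    \<and> measure lebesgue (circumscribed_polygon A) \<le> c"
proof
  assume "tight_set c \<theta> I"
  then obtain xs where xs: "set xs = I" "distinct xs"
      and t: "tight_angles (card I) c (\<lambda>k. \<theta> (xs ! k))"
    unfolding tight_set_def permutations_of_set_def by auto
  have len: "length xs = card I" using xs distinct_card by metis
  have gap: "0 < cyclic_gap (card I) (\<lambda>k. \<theta> (xs ! k)) k" if "k < card I" for k
    using t that unfolding tight_angles_def by auto
  have I_nth: "I = (!) xs ` {..<card I}"
    using xs(1) len set_conv_nth[of xs] by auto
  have A': "A = (\<lambda>k. cis (\<theta> (xs ! k))) ` {..<card I}"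
    unfolding A_def by (subst (1) I_nth) (simp add: image_image)
  have "inj_on (\<lambda>i. cis (\<theta> i)) I"
  proof -
    have "inj_on ((\<lambda>i. cis (\<theta> i)) \<circ> (!) xs) {..<card I}"
      using inj_on_cis_of_gaps[OF I(2) gap] by (simp add: comp_def)
    then show ?thesis using inj_on_imageI[of "\<lambda>i. cis (\<theta> i)" "(!) xs" "{..<card I}"] I_nth by simp
  qed
  then show "inj_on (\<lambda>i. cis (\<theta> i)) I \<and> determines_polygon A
      \<and> measure lebesgue (circumscribed_polygon A) \<le> c"
    using tight_iff_polygon[OF I(2) gap, of c] t unfolding A' by auto
next
  assume asm: "inj_on (\<lambda>i. cis (\<theta> i)) I \<and> determines_polygon A
      \<and> measure lebesgue (circumscribed_polygon A) \<le> c"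
  have inj: "inj_on \<theta> I" using asm by (auto simp: inj_on_def)
  obtain ys where ys: "set ys = I" "distinct ys" using finite_distinct_list[OF I(1)] by blast
  define xs where "xs = sort_key \<theta> ys"
  have xs: "set xs = I" "distinct xs" "sorted (map \<theta> xs)" using ys by (auto simp: xs_def)
  have len: "length xs = card I" using xs distinct_card by metis
  have mem: "xs ! k \<in> I" if "k < card I" for k using that xs len by (metis nth_mem)
  have gap: "0 < cyclic_gap (card I) (\<lambda>k. \<theta> (xs ! k)) k" if "k < card I" for k
  proof (rule sorted_gaps_pos[OF _ _ that])
    fix j assume j: "Suc j < card I"
    have "\<theta> (xs ! j) \<le> \<theta> (xs ! Suc j)"
      using sorted_nth_mono[OF xs(3), of j "Suc j"] j len by simp
    moreover have "xs ! j \<noteq> xs ! Suc j" using xs(2) j len by (simp add: nth_eq_iff_index_eq)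
    then have "\<theta> (xs ! j) \<noteq> \<theta> (xs ! Suc j)" using inj mem j by (meson Suc_lessD inj_onD)
    ultimately show "\<theta> (xs ! j) < \<theta> (xs ! Suc j)" by simp
  qed (use range mem in auto)
  have I_nth: "I = (!) xs ` {..<card I}"
    using xs(1) len set_conv_nth[of xs] by auto
  have A': "A = (\<lambda>k. cis (\<theta> (xs ! k))) ` {..<card I}"
    unfolding A_def by (subst (1) I_nth) (simp add: image_image)
  have "tight_angles (card I) c (\<lambda>k. \<theta> (xs ! k))"
    using tight_iff_polygon[OF I(2) gap, of c] asm unfolding A' by auto
  then show "tight_set c \<theta> I" unfolding tight_set_def permutations_of_set_def using xs by auto
qed

lemma tight_strict_mono:
  assumes "tight_angles m c \<phi>" "j < k" "k < m"
  shows "\<phi> j < \<phi> k"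
  using assms(2,3)
proof (induction k)
  case (Suc k)
  have "0 < cyclic_gap m \<phi> k" using assms(1) Suc.prems unfolding tight_angles_def by auto
  then have "\<phi> k < \<phi> (Suc k)" using Suc.prems by (simp add: cyclic_gap_def)
  then show ?case using Suc by (cases "j = k") auto
qed simp

text \<open>Positive gaps force strictly increasing angles, so only the sorted enumeration
  qualifies. This makes the union over enumerations disjoint.\<close>

lemma tight_set_unique_order:
  assumes "xs \<in> permutations_of_set I" "ys \<in> permutations_of_set I"
    and "tight_angles (card I) c (\<lambda>k. \<theta> (xs ! k))" "tight_angles (card I) c (\<lambda>k. \<theta> (ys ! k))"
  shows "xs = ys"
proof -
  have s: "sorted_wrt (<) (map \<theta> zs)" if "zs \<in> permutations_of_set I" "tight_angles (card I) c (\<lambda>k.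
      \<theta> (zs ! k))" for zs
  proof -
    have "length zs = card I" using that(1) distinct_card[of zs] permutations_of_setD[of zs I]
        by simp
    then show ?thesis using tight_strict_mono[OF that(2)] by (auto simp: sorted_wrt_iff_nth_less)
  qed
  have xs: "set xs = I" "distinct xs" and ys: "set ys = I"
    using assms(1,2) by (auto simp: permutations_of_set_def)
  have e: "map \<theta> xs = map \<theta> ys"
    using s[OF assms(1,3)] s[OF assms(2,4)] xs ys by (intro strict_sorted_equal) auto
  have "distinct (map \<theta> xs)"
    using s[OF assms(1,3)] by (simp only: strict_sorted_iff)
  then have "inj_on \<theta> I" using xs(1) unfolding distinct_map by simp
  then show ?thesis using e xs ys by (intro map_inj_on[of \<theta>]) auto
qed

lemma measurable_tight_set:
  assumes I: "finite I" and f: "\<And>i. i \<in> I \<Longrightarrow> (\<lambda>\<omega>. f \<omega> i) \<in> borel_measurable M"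
  shows "{\<omega> \<in> space M. tight_set c (f \<omega>) I} \<in> sets M"
proof -
  have "{\<omega> \<in> space M. tight_angles (card I) c (\<lambda>k. f \<omega> (xs ! k))} \<in> sets M" if "xs
      \<in> permutations_of_set I" for xs
  proof -
    have "xs ! k \<in> I" if "k < card I" for k
      using that \<open>xs \<in> permutations_of_set I\<close> by (metis distinct_card nth_mem permutations_of_setD)
    then have [measurable]: "(\<lambda>\<omega>. f \<omega> (xs ! k)) \<in> borel_measurable M" if "k < card I" for k
      using f that by auto
    have [measurable]: "(\<lambda>\<omega>. cyclic_gap (card I) (\<lambda>k. f \<omega> (xs ! k)) k)
        \<in> borel_measurable M" if "k < card I" for k
      using that unfolding cyclic_gap_def by (cases "Suc k = card I") auto
    have [measurable]: "(tan :: real \<Rightarrow> real) \<in> borel_measurable borel" unfolding tan_def[abs_def]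
        by measurable
    have s: "(\<lambda>\<omega>. \<Sum>k<card I. tan (cyclic_gap (card I) (\<lambda>k. f \<omega> (xs ! k)) k / 2))
        \<in> borel_measurable M"
      by measurable
    have "{\<omega> \<in> space M. tight_angles (card I) c (\<lambda>k. f \<omega> (xs ! k))} =
      {\<omega> \<in> space M. \<forall>k\<in>{..<card I}. 0 < cyclic_gap (card I) (\<lambda>k. f \<omega> (xs ! k)) k
          \<and> cyclic_gap (card I) (\<lambda>k. f \<omega> (xs ! k)) k < pi}
      \<inter> {\<omega> \<in> space M. (\<Sum>k<card I. tan (cyclic_gap (card I) (\<lambda>k. f \<omega> (xs ! k)) k / 2)) \<le> c}"
      by (auto simp: tight_angles_def)
    also have "\<dots> \<in> sets M"
      using s by (intro sets.Int sets.sets_Collect_finite_All) (auto, measurable)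
    finally show ?thesis .
  qed
  then have "(\<Union>xs\<in>permutations_of_set I. {\<omega> \<in> space M. tight_angles (card I) c (\<lambda>k. f \<omega> (xs ! k))})
      \<in> sets M"
    by (intro sets.finite_UN) auto
  moreover have "{\<omega> \<in> space M. tight_set c (f \<omega>) I}
      = (\<Union>xs\<in>permutations_of_set I. {\<omega> \<in> space M. tight_angles (card I) c (\<lambda>k. f \<omega> (xs ! k))})"
    unfolding tight_set_def by auto
  ultimately show ?thesis by simp
qed

section \<open>Uniform angles\<close>

definition uniform_angle :: "real measure" where
  "uniform_angle = uniform_measure lborel {0..<2 * pi}"

lemma sets_uniform_angle [simp, measurable_cong]: "sets uniform_angle = sets borel"
  by (simp add: uniform_angle_def)

lemma space_uniform_angle [simp]: "space uniform_angle = UNIV"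
  by (simp add: uniform_angle_def)

lemma prob_space_uniform_angle: "prob_space uniform_angle"
  unfolding uniform_angle_def by (intro prob_space_uniform_measure) auto

lemma emeasure_uniform_angle:
  "A \<in> sets borel \<Longrightarrow> emeasure uniform_angle A = emeasure lborel ({0..<2 * pi} \<inter> A) / ennreal (2
      * pi)"
  unfolding uniform_angle_def by (subst emeasure_uniform_measure) auto

text \<open>Reduces probabilities of angle events to Lebesgue volumes inside a cube.\<close>

lemma PiM_uniform_angle:
  fixes I :: "'i set"
  assumes I: "finite I"
  shows "Pi\<^sub>M I (\<lambda>_. uniform_angle) = uniform_measure (Pi\<^sub>M I (\<lambda>_. lborel)) (Pi\<^sub>E I (\<lambda>_. {0..<2
      * pi}))"
proof -
  interpret L: product_sigma_finite "\<lambda>_ :: 'i. lborel :: real measure" by standard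
  interpret P: prob_space uniform_angle by (rule prob_space_uniform_angle)
  interpret U: product_sigma_finite "\<lambda>_ :: 'i. uniform_angle" by standard
  have box: "Pi\<^sub>E I (\<lambda>_. {0..<2 * pi}) \<in> sets (Pi\<^sub>M I (\<lambda>_. lborel))"
    using I by (intro sets_PiM_I_finite) auto
  have "uniform_measure (Pi\<^sub>M I (\<lambda>_. lborel)) (Pi\<^sub>E I (\<lambda>_. {0..<2 * pi}))
      = Pi\<^sub>M I (\<lambda>_. uniform_angle)"
  proof (rule U.PiM_eqI[OF I])
    show "sets (uniform_measure (Pi\<^sub>M I (\<lambda>_. lborel)) (Pi\<^sub>E I (\<lambda>_. {0..<2 * pi})))
        = sets (Pi\<^sub>M I (\<lambda>_. uniform_angle))"
      unfolding sets_uniform_measure by (intro sets_PiM_cong) auto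
    fix A :: "'i \<Rightarrow> real set" assume A: "\<And>i. i \<in> I \<Longrightarrow> A i \<in> sets uniform_angle"
    have "emeasure (uniform_measure (Pi\<^sub>M I (\<lambda>_. lborel)) (Pi\<^sub>E I (\<lambda>_. {0..<2 * pi}))) (Pi\<^sub>E I A)
      = emeasure (Pi\<^sub>M I (\<lambda>_. lborel)) (Pi\<^sub>E I (\<lambda>i. {0..<2
          * pi} \<inter> A i)) / emeasure (Pi\<^sub>M I (\<lambda>_. lborel)) (Pi\<^sub>E I (\<lambda>_. {0..<2 * pi} :: real set))"
      using box A I by (subst emeasure_uniform_measure) (auto simp: PiE_Int intro!:
          sets_PiM_I_finite)
    also have "\<dots> = (\<Prod>i\<in>I. emeasure lborel ({0..<2 * pi} \<inter> A i)) / (\<Prod>i\<in>I. ennreal (2 * pi))"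
      using A I by (subst (1 2) L.emeasure_PiM) auto
    also have "\<dots> = (\<Prod>i\<in>I. emeasure lborel ({0..<2 * pi} \<inter> A i) / ennreal (2 * pi))"
      unfolding divide_ennreal_def prod.distrib by (simp add: ennreal_inverse_power)
    also have "\<dots> = (\<Prod>i\<in>I. emeasure uniform_angle (A i))"
      using A by (intro prod.cong) (auto simp: emeasure_uniform_angle)
    finally show "emeasure (uniform_measure (Pi\<^sub>M I (\<lambda>_. lborel)) (Pi\<^sub>E I (\<lambda>_. {0..<2
        * pi}))) (Pi\<^sub>E I A) = (\<Prod>i\<in>I. emeasure uniform_angle (A i))" .
  qed
  then show ?thesis by simp
qed

lemma emeasure_PiM_uniform_angle:
  assumes I: "finite I" and A: "A \<in> sets (Pi\<^sub>M I (\<lambda>_. lborel))"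
  shows "emeasure (Pi\<^sub>M I (\<lambda>_. uniform_angle)) A
    = emeasure (Pi\<^sub>M I (\<lambda>_. lborel)) (Pi\<^sub>E I (\<lambda>_. {0..<2 * pi}) \<inter> A) / ennreal ((2 * pi) ^ card I)"
proof -
  interpret L: product_sigma_finite "\<lambda>_ . lborel :: real measure" by standard
  have box: "Pi\<^sub>E I (\<lambda>_. {0..<2 * pi}) \<in> sets (Pi\<^sub>M I (\<lambda>_. lborel))"
    using I by (intro sets_PiM_I_finite) auto
  have "emeasure (Pi\<^sub>M I (\<lambda>_. lborel)) (Pi\<^sub>E I (\<lambda>_. {0..<2 * pi} :: real set))
      = ennreal ((2 * pi) ^ card I)"
    using I by (subst L.emeasure_PiM) (auto simp: ennreal_power)
  then show ?thesis
    unfolding PiM_uniform_angle[OF I] using box A by (subst emeasure_uniform_measure) auto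
qed

lemma sets_PiM_uniform_angle: "sets (Pi\<^sub>M I (\<lambda>_. uniform_angle)) = sets (Pi\<^sub>M I (\<lambda>_. lborel))"
  by (intro sets_PiM_cong) auto

lemma measurable_tight_PiM:
  "{\<phi> \<in> space (Pi\<^sub>M {..<m} (\<lambda>_. uniform_angle)). tight_angles m c \<phi>}
      \<in> sets (Pi\<^sub>M {..<m} (\<lambda>_. uniform_angle))"
proof -
  let ?M = "Pi\<^sub>M {..<m} (\<lambda>_. uniform_angle)"
  have [measurable]: "(\<lambda>\<phi>. \<phi> k) \<in> borel_measurable ?M" if "k < m" for k
    using that measurable_component_singleton[of k "{..<m}" "\<lambda>_. uniform_angle"]
        by (auto cong: measurable_cong_sets)
  have [measurable]: "(\<lambda>\<phi>. cyclic_gap m \<phi> k) \<in> borel_measurable ?M" if "k < m" for k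
    using that unfolding cyclic_gap_def by (cases "Suc k = m") auto
  have [measurable]: "(tan :: real \<Rightarrow> real) \<in> borel_measurable borel" unfolding tan_def[abs_def]
      by measurable
  have s: "(\<lambda>\<phi>. \<Sum>k<m. tan (cyclic_gap m \<phi> k / 2)) \<in> borel_measurable ?M"
    by measurable
  have "{\<phi> \<in> space ?M. tight_angles m c \<phi>} =
      {\<phi> \<in> space ?M. \<forall>k\<in>{..<m}. 0 < cyclic_gap m \<phi> k \<and> cyclic_gap m \<phi> k < pi}
      \<inter> {\<phi> \<in> space ?M. (\<Sum>k<m. tan (cyclic_gap m \<phi> k / 2)) \<le> c}"
    by (auto simp: tight_angles_def)
  also have "\<dots> \<in> sets ?M"
    using s by (intro sets.Int sets.sets_Collect_finite_All) (auto, measurable)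
  finally show ?thesis .
qed

text \<open>The enumerations give disjoint events, which are equally likely because relabelling the
  coordinates preserves the product measure.\<close>

lemma measure_tight_set:
  assumes I: "finite I"
  shows "measure (Pi\<^sub>M I (\<lambda>_. uniform_angle)) {\<theta>
      \<in> space (Pi\<^sub>M I (\<lambda>_. uniform_angle)). tight_set c \<theta> I}
    = fact (card I) * measure (Pi\<^sub>M {..<card I} (\<lambda>_. uniform_angle))
        {\<phi> \<in> space (Pi\<^sub>M {..<card I} (\<lambda>_. uniform_angle)). tight_angles (card I) c \<phi>}"
proof -
  let ?m = "card I" let ?M = "Pi\<^sub>M I (\<lambda>_. uniform_angle)" and ?N
      = "Pi\<^sub>M {..<card I} (\<lambda>_. uniform_angle)"
  interpret PM: prob_space ?M by (intro prob_space_PiM prob_space_uniform_angle)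
  define T where "T = {\<phi> \<in> space ?N. tight_angles ?m c \<phi>}"
  have T: "T \<in> sets ?N" unfolding T_def by (rule measurable_tight_PiM)
  define E where "E xs = (\<lambda>\<theta>. \<lambda>k\<in>{..<?m}. \<theta> (xs ! k)) -` T \<inter> space ?M" for xs
  have E_eq: "E xs = {\<theta> \<in> space ?M. tight_angles ?m c (\<lambda>k. \<theta> (xs ! k))}" for xs
  proof -
    have "tight_angles ?m c (\<lambda>k\<in>{..<?m}. \<theta> (xs ! k))
        \<longleftrightarrow> tight_angles ?m c (\<lambda>k. \<theta> (xs ! k))" for \<theta> :: "'a \<Rightarrow> real"
      by (rule tight_cong) auto
    then show ?thesis unfolding E_def T_def by (auto simp: space_PiM)
  qed
  have reindex: "distr ?M ?N (\<lambda>\<theta>. \<lambda>k\<in>{..<?m}. \<theta> (xs ! k)) = ?N"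
    and meas: "(\<lambda>\<theta>. \<lambda>k\<in>{..<?m}. \<theta> (xs ! k)) \<in> measurable ?M ?N" if xs: "xs
        \<in> permutations_of_set I" for xs
  proof -
    have "set xs = I" "distinct xs" "length xs = ?m"
      using xs distinct_card[of xs] permutations_of_setD[of xs I] by auto
    then have inj: "inj_on ((!) xs) {..<?m}" "(!) xs \<in> {..<?m} \<rightarrow> I"
      by (auto simp: inj_on_def nth_eq_iff_index_eq)
    show "distr ?M ?N (\<lambda>\<theta>. \<lambda>k\<in>{..<?m}. \<theta> (xs ! k)) = ?N"
      using distr_PiM_reindex[of I "\<lambda>_. uniform_angle" "(!) xs" "{..<?m}", OF
          prob_space_uniform_angle inj] .
    show "(\<lambda>\<theta>. \<lambda>k\<in>{..<?m}. \<theta> (xs ! k)) \<in> measurable ?M ?N"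
      using inj by (intro measurable_restrict measurable_component_singleton) auto
  qed
  have E_meas: "E xs \<in> sets ?M" if "xs \<in> permutations_of_set I" for xs
    unfolding E_def using meas[OF that] T by (rule measurable_sets)
  have E_prob: "measure ?M (E xs) = measure ?N T" if "xs \<in> permutations_of_set I" for xs
    unfolding E_def using measure_distr[OF meas[OF that] T] reindex[OF that] by simp
  have "{\<theta> \<in> space ?M. tight_set c \<theta> I} = (\<Union>xs\<in>permutations_of_set I. E xs)"
    unfolding tight_set_def E_eq by auto
  also have "measure ?M \<dots> = (\<Sum>xs\<in>permutations_of_set I. measure ?M (E xs))"
  proof (rule PM.finite_measure_finite_Union)
    show "disjoint_family_on E (permutations_of_set I)"
      unfolding disjoint_family_on_def E_eq using tight_set_unique_order by blast
  qed (use E_meas in auto)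
  also have "\<dots> = fact ?m * measure ?N T"
    using I by (simp add: E_prob)
  finally show ?thesis unfolding T_def .
qed

text \<open>Once the first angle is fixed at \<open>s\<close>, the gaps are the steps of a chain
  from \<open>s\<close> to \<open>s + 2 * pi\<close> with \<open>d\<close> free points. The ideal
  step \<open>2 * pi / m\<close> fits exactly, so the least energy is 0 and the volume is the same
  for every \<open>s\<close>.\<close>

lemma emeasure_cyclic_gaps_near:
  fixes d :: nat
  defines "m \<equiv> Suc d"
  assumes S: "S \<in> sets borel" and R: "R \<ge> 0"
  shows "emeasure (Pi\<^sub>M {..<m} (\<lambda>_. lborel)) {\<theta> \<in> space (Pi\<^sub>M {..<m} (\<lambda>_. lborel)). \<theta> 0 \<in> S \<and>
       (\<Sum>k<m. (cyclic_gap m \<theta> k - 2 * pi / real m)\<^sup>2) \<le> R}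
    = emeasure lborel S * ennreal (unit_ball_vol (real d) / sqrt (real m) * sqrt R ^ d)"
    and "{\<theta> \<in> space (Pi\<^sub>M {..<m} (\<lambda>_. lborel)). \<theta> 0 \<in> S \<and>
       (\<Sum>k<m. (cyclic_gap m \<theta> k - 2 * pi / real m)\<^sup>2) \<le> R} \<in> sets (Pi\<^sub>M {..<m} (\<lambda>_. lborel))"
proof -
  interpret L: product_sigma_finite "\<lambda>_ . lborel :: real measure" by standard
  let ?M = "Pi\<^sub>M {..<m} (\<lambda>_. lborel :: real measure)" and ?N
      = "Pi\<^sub>M {1..d} (\<lambda>_. lborel :: real measure)"
  define b where "b = 2 * pi / real m"
  define A where "A = {\<theta> \<in> space ?M. \<theta> 0 \<in> S \<and> (\<Sum>k<m. (cyclic_gap m \<theta> k - b)\<^sup>2) \<le> R}"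
  have [measurable]: "(\<lambda>\<phi>. cyclic_gap m \<phi> k) \<in> borel_measurable ?M" if "k < m" for k
    using that unfolding cyclic_gap_def by (cases "Suc k = m") auto
  have [measurable]: "(\<lambda>\<phi>. \<phi> 0) \<in> measurable ?M borel" by (simp add: m_def)
  note S[measurable]
  have Am: "A \<in> sets ?M" unfolding A_def by measurable
  then show "{\<theta> \<in> space ?M. \<theta> 0 \<in> S \<and> (\<Sum>k<m. (cyclic_gap m \<theta> k - 2 * pi / real m)\<^sup>2) \<le> R} \<in> sets ?M"
    unfolding A_def b_def .
  have ins: "{..<m} = insert 0 {1..d}" unfolding m_def by auto
  have energy: "(\<Sum>k<m. (cyclic_gap m (y(0 := s)) k - b)\<^sup>2)
      = chain_energy d b s (s + 2 * pi) y" for y s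
    unfolding m_def sum.lessThan_Suc chain_energy_def
    by (intro arg_cong2[of _ _ _ _ "(+)"] sum.cong) (auto simp: cyclic_gap_def)
  have "emeasure ?M A = (\<integral>\<^sup>+y. indicator A y \<partial>Pi\<^sub>M (insert 0 {1..d}) (\<lambda>_. lborel))"
    using Am unfolding ins by simp
  also have "\<dots> = (\<integral>\<^sup>+s. \<integral>\<^sup>+y. indicator A (y(0 := s)) \<partial>?N \<partial>lborel)"
    using Am unfolding ins by (subst L.product_nn_integral_insert_rev) auto
  also have "\<dots> = (\<integral>\<^sup>+s. ennreal (unit_ball_vol (real d) / sqrt (real m) * sqrt R ^ d)
      * indicator S s \<partial>lborel)"
  proof (intro nn_integral_cong)
    fix s :: real
    let ?B = "{y \<in> space ?N. chain_energy d b s (s + 2 * pi) y \<le> R}"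
    have B: "?B \<in> sets ?N" by measurable
    have "(\<integral>\<^sup>+y. indicator A (y(0 := s)) \<partial>?N) = (\<integral>\<^sup>+y. indicator S s * indicator ?B y \<partial>?N)"
    proof (intro nn_integral_cong)
      fix y assume y: "y \<in> space ?N"
      have "y(0 := s) \<in> space ?M" using y unfolding ins
          by (auto simp: space_PiM PiE_def extensional_def)
      then show "indicator A (y(0 := s)) = indicator S s * (indicator ?B y :: ennreal)"
        using y energy[of y s] by (auto simp: A_def indicator_def)
    qed
    also have "\<dots> = indicator S s * emeasure ?N ?B"
      by (rule nn_integral_cmult_indicator[OF B])
    also have "emeasure ?N ?B = ennreal (unit_ball_vol (real d) / sqrt (real m) * sqrt R ^ d)"
      using R unfolding emeasure_chain_energy_le by (simp add: b_def m_def)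
    finally show "(\<integral>\<^sup>+y. indicator A (y(0 := s)) \<partial>?N)
        = ennreal (unit_ball_vol (real d) / sqrt (real m) * sqrt R ^ d) * indicator S s"
      by (simp only: mult.commute)
  qed
  also have "\<dots> = emeasure lborel S * ennreal (unit_ball_vol (real d) / sqrt (real m) * sqrt R ^ d)"
    using S by (subst nn_integral_cmult_indicator) (auto simp: mult.commute)
  finally show "emeasure ?M {\<theta> \<in> space ?M. \<theta> 0 \<in> S \<and> (\<Sum>k<m. (cyclic_gap m \<theta> k - 2 * pi / real m)\<^sup>2)
      \<le> R}
    = emeasure lborel S * ennreal (unit_ball_vol (real d) / sqrt (real m) * sqrt R ^ d)"
    unfolding A_def b_def .
qed

lemma cyclic_gap_dev_le:
  assumes "k < m"
  shows "\<bar>cyclic_gap m \<phi> k - b\<bar> \<le> sqrt (\<Sum>k<m. (cyclic_gap m \<phi> k - b)\<^sup>2)"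
proof -
  have "(cyclic_gap m \<phi> k - b)\<^sup>2 \<le> (\<Sum>k<m. (cyclic_gap m \<phi> k - b)\<^sup>2)"
    using assms by (intro member_le_sum) auto
  then have "sqrt ((cyclic_gap m \<phi> k - b)\<^sup>2) \<le> sqrt (\<Sum>k<m. (cyclic_gap m \<phi> k - b)\<^sup>2)"
    by (rule real_sqrt_le_mono)
  then show ?thesis by simp
qed

section \<open>Probability that \<open>m\<close> uniform angles in a given order are almost equally
  spaced\<close>

context
  fixes m :: nat and T \<kappa> b :: real
  assumes m: "m \<ge> 3"
  defines "T \<equiv> tan (pi / real m)"
  defines "\<kappa> \<equiv> T * (1 + T\<^sup>2) / 4"
  defines "b \<equiv> 2 * pi / real m"
begin

lemma tan_pi_div_pos: "T > 0"
  unfolding T_def using m by (intro tan_gt_zero) (auto simp: field_simps)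

lemma curvature_pos: "\<kappa> > 0"
  unfolding \<kappa>_def using tan_pi_div_pos by (simp add: add_pos_nonneg)

text \<open>One fixed enumeration only; the factor \<open>fact m\<close> enters in
  \<open>prob_tight_event\<close>.\<close>

definition tight_prob :: "real \<Rightarrow> real" where
  "tight_prob e = measure (Pi\<^sub>M {..<m} (\<lambda>_. uniform_angle))
     {\<phi> \<in> space (Pi\<^sub>M {..<m} (\<lambda>_. uniform_angle)). tight_angles m (real m * T + e) \<phi>}"

text \<open>Coefficient of \<open>sqrt R ^ (m - 1)\<close> in the volume of the gap ellipsoid over a
  fixed first angle.\<close>

definition ball_const :: real where
  "ball_const = unit_ball_vol (real (m - 1)) / sqrt (real m)"

lemma ball_const_pos: "ball_const > 0"
  unfolding ball_const_def using m by simp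

text \<open>The last gap is \<open>\<phi> 0 + 2 * pi - \<phi> (m - 1)\<close> and deviates from
  \<open>b\<close> by at most \<open>sqrt R\<close>. Angles in the half-open turn therefore need a
  first angle of at most \<open>b + sqrt R\<close>, while a nonnegative first angle below
  \<open>b - sqrt R\<close> suffices. Together with the two ellipsoids of
  \<open>tan_sum_excess\<close> this encloses the event between two sets of known volume.\<close>

lemma tight_prob_bounds:
  obtains C e0 where "C > 0" "e0 > 0"
    "\<And>e. 0 < e \<Longrightarrow> e \<le> e0 \<Longrightarrow> tight_prob e
       \<le> (b + sqrt (e * (1 + C * sqrt e) / \<kappa>)) * (ball_const * sqrt (e * (1 + C
           * sqrt e) / \<kappa>) ^ (m - 1)) / (2 * pi) ^ m"
    "\<And>e. 0 < e \<Longrightarrow> e \<le> e0 \<Longrightarrow> tight_prob e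
       \<ge> (b - sqrt (e * (1 - C * sqrt e) / \<kappa>)) * (ball_const * sqrt (e * (1 - C
           * sqrt e) / \<kappa>) ^ (m - 1)) / (2 * pi) ^ m"
proof -
  let ?L = "Pi\<^sub>M {..<m} (\<lambda>_. lborel :: real measure)" and ?M = "Pi\<^sub>M {..<m} (\<lambda>_. uniform_angle)"
  interpret PM: prob_space ?M by (intro prob_space_PiM prob_space_uniform_angle)
  obtain C e1 where C: "C > 0" and e1: "e1 > 0" and Ce1: "C * sqrt e1 < 1"
    and up: "\<And>g e. 0 < e \<Longrightarrow> e \<le> e1 \<Longrightarrow> (\<And>k. k < m \<Longrightarrow> 0 < g k \<and> g k < pi) \<Longrightarrow> (\<Sum>k<m. g k) = 2 * pi \<Longrightarrow>
      (\<Sum>k<m. tan (g k / 2)) \<le> real m * T + e \<Longrightarrow>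
      \<kappa> * (\<Sum>k<m. (g k - b)\<^sup>2) \<le> e * (1 + C * sqrt e)"
    and low: "\<And>g e. 0 < e \<Longrightarrow> e \<le> e1 \<Longrightarrow> (\<Sum>k<m. g k) = 2 * pi \<Longrightarrow>
      \<kappa> * (\<Sum>k<m. (g k - b)\<^sup>2) \<le> e * (1 - C * sqrt e) \<Longrightarrow>
      (\<forall>k<m. 0 < g k \<and> g k < pi) \<and> (\<Sum>k<m. tan (g k / 2)) \<le> real m * T + e"
    using tan_sum_excess[OF m] unfolding T_def \<kappa>_def b_def by blast
  have b: "b > 0" using m by (simp add: b_def)
  \<comment> \<open>The second bound keeps the inner \<open>sqrt R\<close> below \<open>b\<close>,
    so that the range left for the first angle has positive length.\<close>
  define e0 where "e0 = min e1 (\<kappa> * b\<^sup>2 / 2)"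
  have e0: "e0 > 0" "e0 \<le> e1" using e1 curvature_pos b by (auto simp: e0_def)
  have m1: "Suc (m - 1) = m" using m by simp
  let ?Q = "\<lambda>\<phi>. \<Sum>k<m. (cyclic_gap m \<phi> k - b)\<^sup>2"
  have vol: "emeasure ?L {\<theta> \<in> space ?L. \<theta> 0 \<in> S \<and> ?Q \<theta> \<le> R}
      = emeasure lborel S * ennreal (ball_const * sqrt R ^ (m - 1))"
      "{\<theta> \<in> space ?L. \<theta> 0 \<in> S \<and> ?Q \<theta> \<le> R} \<in> sets ?L"
    if "S \<in> sets borel" "R \<ge> 0" for S R
    using emeasure_cyclic_gaps_near[of S R "m - 1"] that unfolding m1 b_def ball_const_def by auto
  have Tm: "{\<phi> \<in> space ?M. tight_angles m c \<phi>} \<in> sets ?L" for c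
    using measurable_tight_PiM[of m c] unfolding sets_PiM_uniform_angle .
  have box: "Pi\<^sub>E {..<m} (\<lambda>_. {0..<2 * pi}) \<in> sets ?L" by (intro sets_PiM_I_finite) auto
  have prob_eq: "ennreal (tight_prob e) = emeasure ?L (Pi\<^sub>E {..<m} (\<lambda>_. {0..<2 * pi}) \<inter> {\<phi>
      \<in> space ?M. tight_angles m (real m * T + e) \<phi>}) / ennreal ((2 * pi) ^ m)" for e
    using emeasure_PiM_uniform_angle[OF finite_lessThan Tm, of "real m * T + e"]
    unfolding tight_prob_def PM.emeasure_eq_measure by simp
  have gapsum: "(\<Sum>k<m. cyclic_gap m \<phi> k) = 2 * pi" for \<phi> using m by (intro sum_cyclic_gap) simp
  have lastgap: "cyclic_gap m \<phi> (m - 1) = \<phi> 0 + 2 * pi - \<phi> (m - 1)" for \<phi> using m1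
      by (simp add: cyclic_gap_def)
  show ?thesis
  proof (rule that[OF C e0(1)])
    fix e assume e: "0 < e" "e \<le> e0"
    define R where "R = e * (1 + C * sqrt e) / \<kappa>"
    have R: "R \<ge> 0" unfolding R_def using e C curvature_pos
        by (intro divide_nonneg_pos mult_nonneg_nonneg) auto
    have sub: "Pi\<^sub>E {..<m} (\<lambda>_. {0..<2 * pi}) \<inter> {\<phi> \<in> space ?M. tight_angles m (real m * T + e) \<phi>}
        \<subseteq> {\<theta> \<in> space ?L. \<theta> 0 \<in> {0..b + sqrt R} \<and> ?Q \<theta> \<le> R}"
    proof
      fix \<phi> assume p: "\<phi> \<in> Pi\<^sub>E {..<m} (\<lambda>_. {0..<2 * pi}) \<inter> {\<phi> \<in> space ?M. tight_angles m (real m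
          * T + e) \<phi>}"
      then have t: "tight_angles m (real m * T + e) \<phi>" and sp: "\<phi> \<in> space ?L"
          by (auto simp: space_PiM)
      have "\<kappa> * ?Q \<phi> \<le> e * (1 + C * sqrt e)"
        using t e e0 gapsum unfolding tight_angles_def by (intro up) auto
      then have Q: "?Q \<phi> \<le> R" unfolding R_def using curvature_pos by (simp add: field_simps)
      have "0 \<le> \<phi> 0" "\<phi> (m - 1) < 2 * pi" using p m by (auto simp: PiE_iff)
      moreover have "\<bar>cyclic_gap m \<phi> (m - 1) - b\<bar> \<le> sqrt R"
        using cyclic_gap_dev_le[of "m - 1" m \<phi> b] m Q
            by (meson diff_less less_le_trans order_trans real_sqrt_le_mono zero_less_numeral
            zero_less_one)
      ultimately have "\<phi> 0 \<in> {0..b + sqrt R}" unfolding lastgap by auto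
      then show "\<phi> \<in> {\<theta> \<in> space ?L. \<theta> 0 \<in> {0..b + sqrt R} \<and> ?Q \<theta> \<le> R}" using sp Q by simp
    qed
    have "ennreal (tight_prob e) \<le> emeasure ?L {\<theta> \<in> space ?L. \<theta> 0 \<in> {0..b + sqrt R} \<and> ?Q \<theta>
        \<le> R} / ennreal ((2 * pi) ^ m)"
      unfolding prob_eq using sub vol(2)[of "{0..b + sqrt R}" R] R
          by (intro divide_right_mono_ennreal emeasure_mono) auto
    also have "\<dots> = ennreal ((b + sqrt R) * (ball_const * sqrt R ^ (m - 1)) / (2 * pi) ^ m)"
      using R b ball_const_pos by (subst vol(1)) (auto simp: ennreal_mult'[symmetric] divide_ennreal
          simp del: ennreal_plus)
    finally show "tight_prob e \<le> (b + sqrt (e * (1 + C * sqrt e) / \<kappa>)) * (ball_const * sqrt (e * (1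
        + C * sqrt e) / \<kappa>) ^ (m - 1)) / (2 * pi) ^ m"
      using R b ball_const_pos unfolding R_def[symmetric] by (subst (asm) ennreal_le_iff) auto
  next
    fix e assume e: "0 < e" "e \<le> e0"
    define R where "R = e * (1 - C * sqrt e) / \<kappa>"
    have "C * sqrt e \<le> C * sqrt e1" using e e0 C by (intro mult_left_mono) auto
    then have Ce: "C * sqrt e < 1" using Ce1 by simp
    then have R: "R \<ge> 0" unfolding R_def using e C curvature_pos
        by (intro divide_nonneg_pos mult_nonneg_nonneg) auto
    have "e * (1 - C * sqrt e) \<le> e * 1" using e C by (intro mult_left_mono) auto
    also have "\<dots> < \<kappa> * b\<^sup>2" using e e0_def curvature_pos b by (simp add: min_def split: if_splits)
    finally have "R < b\<^sup>2" unfolding R_def using curvature_pos by (simp add: field_simps)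
    then have Rb: "sqrt R < b" using b by (intro real_less_lsqrt) auto
    have sub: "{\<theta> \<in> space ?L. \<theta> 0 \<in> {0..<b - sqrt R} \<and> ?Q \<theta> \<le> R}
        \<subseteq> Pi\<^sub>E {..<m} (\<lambda>_. {0..<2 * pi}) \<inter> {\<phi> \<in> space ?M. tight_angles m (real m * T + e) \<phi>}"
    proof
      fix \<phi> assume p: "\<phi> \<in> {\<theta> \<in> space ?L. \<theta> 0 \<in> {0..<b - sqrt R} \<and> ?Q \<theta> \<le> R}"
      then have "\<kappa> * ?Q \<phi> \<le> e * (1 - C * sqrt e)" using curvature_pos unfolding R_def
          by (simp add: field_simps)
      then have t: "tight_angles m (real m * T + e) \<phi>" unfolding tight_angles_def using e e0 gapsum
          by (intro low) auto
      have inc: "\<phi> j \<le> \<phi> k" if "j \<le> k" "k < m" for j k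
        using tight_strict_mono[OF t, of j k] that by (cases "j = k") auto
      have "\<bar>cyclic_gap m \<phi> (m - 1) - b\<bar> \<le> sqrt (?Q \<phi>)" using m by (intro cyclic_gap_dev_le) simp
      also have "\<dots> \<le> sqrt R" using p by simp
      finally have "\<phi> (m - 1) < 2 * pi" using p unfolding lastgap by auto
      moreover have "0 \<le> \<phi> 0" using p by simp
      ultimately have "\<phi> k \<in> {0..<2 * pi}" if "k < m" for k
        using inc[of 0 k] inc[of k "m - 1"] that by force
      then show "\<phi> \<in> Pi\<^sub>E {..<m} (\<lambda>_. {0..<2 * pi}) \<inter> {\<phi> \<in> space ?M. tight_angles m (real m * T
          + e) \<phi>}"
        using t p by (auto simp: space_PiM PiE_iff)
    qed
    have "ennreal ((b - sqrt R) * (ball_const * sqrt R ^ (m - 1)) / (2 * pi) ^ m)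
       = emeasure ?L {\<theta> \<in> space ?L. \<theta> 0 \<in> {0..<b - sqrt R} \<and> ?Q \<theta> \<le> R} / ennreal ((2 * pi) ^ m)"
      using R Rb ball_const_pos by (subst vol(1)) (auto simp: ennreal_mult'[symmetric]
          divide_ennreal)
    also have "\<dots> \<le> ennreal (tight_prob e)"
      unfolding prob_eq using sub box Tm by (intro divide_right_mono_ennreal emeasure_mono) auto
    finally show "(b - sqrt (e * (1 - C * sqrt e) / \<kappa>)) * (ball_const * sqrt (e * (1 - C
        * sqrt e) / \<kappa>) ^ (m - 1)) / (2 * pi) ^ m \<le> tight_prob e"
      unfolding R_def[symmetric] by (subst (asm) ennreal_le_iff) (auto simp: tight_prob_def)
  qed
qed

lemma DERIV_imp_local_Lipschitz:
  fixes f :: "real \<Rightarrow> real"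
  assumes "(f has_real_derivative D) (at 0)"
  shows "\<exists>r K. r > 0 \<and> K \<ge> 0 \<and> (\<forall>s. \<bar>s\<bar> \<le> r \<longrightarrow> \<bar>f s - f 0\<bar> \<le> K * \<bar>s\<bar>)"
proof -
  have "((\<lambda>h. (f h - f 0) / h) \<longlongrightarrow> D) (at 0)"
    using assms by (simp add: DERIV_def)
  then have "\<forall>\<^sub>F h in at 0. dist ((f h - f 0) / h) D < 1" by (rule tendstoD) simp
  then obtain r where r: "r > 0" "\<And>h. h \<noteq> 0 \<Longrightarrow> dist h 0 < r \<Longrightarrow> dist ((f h - f 0) / h) D < 1"
    unfolding eventually_at by blast
  have "\<bar>f s - f 0\<bar> \<le> (\<bar>D\<bar> + 1) * \<bar>s\<bar>" if "\<bar>s\<bar> \<le> r / 2" for s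
  proof (cases "s = 0")
    case False
    have "dist s 0 < r" using that r(1) by simp
    then have "\<bar>(f s - f 0) / s\<bar> \<le> \<bar>D\<bar> + 1" using r(2)[OF False] by (simp add: dist_real_def)
    then show ?thesis using False by (simp add: abs_divide field_simps)
  qed simp
  then show ?thesis using r(1) by (intro exI[of _ "r / 2"] exI[of _ "\<bar>D\<bar> + 1"]) auto
qed

text \<open>Leading coefficient of \<open>tight_prob e\<close> in powers of \<open>sqrt e\<close>;
  after the \<open>m!\<close> orders cancel against the count of \<open>m\<close>-sets it is also
  the limiting intensity for \<open>t = 1\<close>.\<close>

definition tight_rate :: real where
  "tight_rate = b * ball_const / sqrt \<kappa> ^ (m - 1) / (2 * pi) ^ m"

text \<open>With \<open>s = sqrt e\<close> both bounds of \<open>tight_prob_bounds\<close> are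
  \<open>s ^ (m - 1)\<close> times a function of \<open>s\<close> that is differentiable at 0 with
  value \<open>tight_rate\<close> there; a local Lipschitz bound gives the error.\<close>

lemma tight_prob_asymp:
  obtains C e0 where "C \<ge> 0" "e0 > 0"
    "\<And>e. 0 < e \<Longrightarrow> e \<le> e0 \<Longrightarrow> \<bar>tight_prob e - tight_rate * sqrt e ^ (m - 1)\<bar> \<le> C * sqrt e ^ m"
proof -
  obtain C e1 where C: "C > 0" and e1: "e1 > 0" and
    up: "\<And>e. 0 < e \<Longrightarrow> e \<le> e1 \<Longrightarrow> tight_prob e
       \<le> (b + sqrt (e * (1 + C * sqrt e) / \<kappa>)) * (ball_const * sqrt (e * (1 + C
           * sqrt e) / \<kappa>) ^ (m - 1)) / (2 * pi) ^ m"
    and low: "\<And>e. 0 < e \<Longrightarrow> e \<le> e1 \<Longrightarrow> tight_prob e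
       \<ge> (b - sqrt (e * (1 - C * sqrt e) / \<kappa>)) * (ball_const * sqrt (e * (1 - C
           * sqrt e) / \<kappa>) ^ (m - 1)) / (2 * pi) ^ m"
    using tight_prob_bounds by blast
  \<comment> \<open>The sign \<open>c\<close>, which is 1 or -1, treats the upper and the lower
    bound at once.\<close>
  define f where "f c s = (b + c * (s * sqrt ((1 + c * C * s) / \<kappa>))) * (ball_const * sqrt ((1 + c
      * C * s) / \<kappa>) ^ (m - 1)) / (2 * pi) ^ m"
    for c s :: real
  have "\<exists>D. (f c has_real_derivative D) (at 0)" for c
    unfolding f_def[abs_def] using curvature_pos
    by (intro exI) (rule derivative_eq_intros refl | simp)+
  then obtain D where D: "\<And>c. (f c has_real_derivative D c) (at 0)" by metis
  obtain r1 K1 where 1: "r1 > 0" "K1 \<ge> 0" "\<And>s. \<bar>s\<bar> \<le> r1 \<Longrightarrow> \<bar>f 1 s - f 1 0\<bar> \<le> K1 * \<bar>s\<bar>"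
    using DERIV_imp_local_Lipschitz[OF D[of 1]] by metis
  obtain r2 K2 where 2: "r2 > 0" "K2 \<ge> 0" "\<And>s. \<bar>s\<bar> \<le> r2 \<Longrightarrow> \<bar>f (- 1) s - f (- 1) 0\<bar> \<le> K2 * \<bar>s\<bar>"
    using DERIV_imp_local_Lipschitz[OF D[of "- 1"]] by metis
  have f0: "f c 0 = tight_rate" for c
    unfolding f_def tight_rate_def by (simp add: real_sqrt_divide power_divide)
  define e0 where "e0 = min e1 (min (r1\<^sup>2) (r2\<^sup>2))"
  have e0: "e0 > 0" using e1 1 2 by (simp add: e0_def)
  have "\<bar>tight_prob e - tight_rate * sqrt e ^ (m - 1)\<bar> \<le> (K1 + K2) * sqrt e ^ m" if e: "0 < e" "e
      \<le> e0" for e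
  proof -
    define s where "s = sqrt e"
    have s: "s > 0" "e = s\<^sup>2" using e by (auto simp: s_def)
    have sr: "\<bar>s\<bar> \<le> r1" "\<bar>s\<bar> \<le> r2"
      using e 1(1) 2(1) s unfolding e0_def by (auto intro: power2_le_imp_le)
    have sq: "sqrt (e * x / \<kappa>) = s * sqrt (x / \<kappa>)" for x
      using s by (simp add: real_sqrt_mult real_sqrt_divide)
    have g: "(b + c * sqrt (e * (1 + c * C * s) / \<kappa>)) * (ball_const * sqrt (e * (1 + c * C
        * s) / \<kappa>) ^ (m - 1)) / (2 * pi) ^ m
       = s ^ (m - 1) * f c s" for c
      unfolding sq f_def by (simp add: power_mult_distrib)
    have u: "tight_prob e \<le> s ^ (m - 1) * f 1 s"
      using up[of e] e g[of 1] unfolding s_def[symmetric] e0_def by simp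
    have l: "s ^ (m - 1) * f (- 1) s \<le> tight_prob e"
      using low[of e] e g[of "- 1"] unfolding s_def[symmetric] e0_def by simp
    have "f 1 s \<le> tight_rate + K1 * s" "f (- 1) s \<ge> tight_rate - K2 * s"
      using 1(3)[OF sr(1)] 2(3)[OF sr(2)] s unfolding f0 by auto
    then have "s ^ (m - 1) * f 1 s \<le> s ^ (m - 1) * (tight_rate + K1 * s)"
      "s ^ (m - 1) * f (- 1) s \<ge> s ^ (m - 1) * (tight_rate - K2 * s)"
      using s by (auto intro!: mult_left_mono)
    moreover have "s ^ (m - 1) * s = s ^ m" using m by (simp add: power_eq_if)
    then have "s ^ (m - 1) * (tight_rate + K1 * s) = tight_rate * s ^ (m - 1) + K1 * s ^ m"
      "s ^ (m - 1) * (tight_rate - K2 * s) = tight_rate * s ^ (m - 1) - K2 * s ^ m"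
          by (auto simp: algebra_simps)
    moreover have "0 \<le> K1 * s ^ m" "0 \<le> K2 * s ^ m" using s 1 2 by auto
    ultimately show ?thesis using u l unfolding s_def[symmetric] distrib_right by linarith
  qed
  then show ?thesis using 1 2 e0 by (intro that[of "K1 + K2" e0]) auto
qed

text \<open>Angles that are \<open>n\<close> positions apart differ by \<open>n\<close> gaps, each
  within \<open>sqrt Q\<close> of \<open>b\<close>, where \<open>Q\<close> is the sum of squared
  deviations; the multiple \<open>k\<close> is negative when the order is reversed.\<close>

lemma tight_lattice:
  obtains D e0 where "D > 0" "e0 > 0"
    "\<And>e \<phi> i j. 0 < e \<Longrightarrow> e \<le> e0 \<Longrightarrow> tight_angles m (real m * T + e) \<phi> \<Longrightarrow> i < m \<Longrightarrow> j < m \<Longrightarrow>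
      \<exists>k\<in>{- int m..int m}. \<bar>\<phi> j - \<phi> i - of_int k * b\<bar> \<le> D * sqrt e"
proof -
  obtain C e1 where C: "C > 0" and e1: "e1 > 0" and Ce1: "C * sqrt e1 < 1"
    and up: "\<And>g e. 0 < e \<Longrightarrow> e \<le> e1 \<Longrightarrow> (\<And>k. k < m \<Longrightarrow> 0 < g k \<and> g k < pi) \<Longrightarrow> (\<Sum>k<m. g k) = 2 * pi \<Longrightarrow>
      (\<Sum>k<m. tan (g k / 2)) \<le> real m * T + e \<Longrightarrow>
      \<kappa> * (\<Sum>k<m. (g k - b)\<^sup>2) \<le> e * (1 + C * sqrt e)"
    using tan_sum_excess[OF m] unfolding T_def \<kappa>_def b_def by metis
  \<comment> \<open>\<open>m\<close> bounds the number of gaps between two angles; the 2 under the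
    root comes from \<open>1 + C * sqrt e \<le> 2\<close>.\<close>
  define D where "D = real m * sqrt (2 / \<kappa>)"
  have "D > 0" using m curvature_pos by (simp add: D_def)
  moreover have "\<exists>k\<in>{- int m..int m}. \<bar>\<phi> j - \<phi> i - of_int k * b\<bar> \<le> D * sqrt e"
    if e: "0 < e" "e \<le> e1" and t: "tight_angles m (real m * T + e) \<phi>"
        and ij: "i < m" "j < m" for e \<phi> i j
  proof -
    let ?Q = "\<Sum>k<m. (cyclic_gap m \<phi> k - b)\<^sup>2"
    have "C * sqrt e \<le> C * sqrt e1" using e C by (intro mult_left_mono) auto
    then have "e * (1 + C * sqrt e) \<le> e * 2" using Ce1 e by (intro mult_left_mono) auto
    moreover have "\<kappa> * ?Q \<le> e * (1 + C * sqrt e)"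
      using t e m unfolding tight_angles_def by (intro up sum_cyclic_gap) auto
    ultimately have "?Q \<le> 2 / \<kappa> * e" using curvature_pos by (simp add: field_simps)
    then have "sqrt ?Q \<le> sqrt (2 / \<kappa> * e)" by (rule real_sqrt_le_mono)
    then have Q: "sqrt ?Q \<le> sqrt (2 / \<kappa>) * sqrt e" by (simp only: real_sqrt_mult)
    have step: "\<bar>\<phi> (p + n) - \<phi> p - real n * b\<bar> \<le> real n * sqrt ?Q" if "p + n < m" for p n
      using that
    proof (induction n)
      case (Suc n)
      have "cyclic_gap m \<phi> (p + n) = \<phi> (p + Suc n) - \<phi> (p + n)" using Suc.prems
          by (simp add: cyclic_gap_def)
      then have "\<bar>\<phi> (p + Suc n) - \<phi> (p + n) - b\<bar> \<le> sqrt ?Q"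
        using cyclic_gap_dev_le[of "p + n" m \<phi> b] Suc.prems by simp
      moreover have "\<bar>\<phi> (p + n) - \<phi> p - real n * b\<bar> \<le> real n * sqrt ?Q" using Suc by simp
      ultimately show ?case by (simp add: algebra_simps abs_le_iff)
    qed simp
    have le: "real n * sqrt ?Q \<le> D * sqrt e" if "n < m" for n
    proof -
      have "real n * sqrt ?Q \<le> real m * (sqrt (2 / \<kappa>) * sqrt e)"
        using that Q by (intro mult_mono) (auto intro!: sum_nonneg)
      then show ?thesis by (simp add: D_def)
    qed
    show ?thesis
    proof (cases "i \<le> j")
      case True
      have "j - i < m" using ij by simp
      then have "\<bar>\<phi> j - \<phi> i - of_int (int (j - i)) * b\<bar> \<le> D * sqrt e"
        using order_trans[OF step[of i "j - i"] le[of "j - i"]] ij True by simp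
      moreover have "int (j - i) \<in> {- int m..int m}" using ij by simp
      ultimately show ?thesis by blast
    next
      case False
      then have "i - j < m" using ij by simp
      then have "\<bar>\<phi> i - \<phi> j - real (i - j) * b\<bar> \<le> D * sqrt e"
        using order_trans[OF step[of j "i - j"] le[of "i - j"]] ij False by simp
      then have "\<bar>\<phi> j - \<phi> i - of_int (- int (i - j)) * b\<bar> \<le> D * sqrt e" by (simp add: abs_le_iff)
      moreover have "- int (i - j) \<in> {- int m..int m}" using ij by simp
      ultimately show ?thesis by blast
    qed
  qed
  ultimately show ?thesis using e1 by (intro that[of D e1]) auto
qed

lemma tight_set_lattice:
  obtains D e0 where "D > 0" "e0 > 0"
    "\<And>e (\<theta> :: 'i \<Rightarrow> real) I i j. 0 < e \<Longrightarrow> e \<le> e0 \<Longrightarrow> finite I \<Longrightarrow> card I = m \<Longrightarrow>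
        tight_set (real m * T + e) \<theta> I \<Longrightarrow> i \<in> I \<Longrightarrow> j \<in> I \<Longrightarrow>
      \<exists>k\<in>{- int m..int m}. \<bar>\<theta> j - \<theta> i - of_int k * b\<bar> \<le> D * sqrt e"
proof -
  obtain D e0 where D: "D > 0" "e0 > 0"
    and *: "\<And>e \<phi> i j. 0 < e \<Longrightarrow> e \<le> e0 \<Longrightarrow> tight_angles m (real m * T + e) \<phi> \<Longrightarrow> i < m \<Longrightarrow> j < m \<Longrightarrow>
      \<exists>k\<in>{- int m..int m}. \<bar>\<phi> j - \<phi> i - of_int k * b\<bar> \<le> D * sqrt e"
    using tight_lattice by blast
  show ?thesis
  proof (rule that[OF D])
    fix e and \<theta> :: "'i \<Rightarrow> real" and I i j
    assume e: "0 < e" "e \<le> e0" and I: "finite I" "card I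
        = m" and t: "tight_set (real m * T + e) \<theta> I"
      and ij: "i \<in> I" "j \<in> I"
    obtain xs where xs: "set xs = I" "distinct xs" "tight_angles m (real m * T
        + e) (\<lambda>k. \<theta> (xs ! k))"
      using t I unfolding tight_set_def permutations_of_set_def by auto
    have "length xs = m" using xs I distinct_card by metis
    then obtain p q where "p < m" "i = xs ! p" "q < m" "j = xs ! q"
      using ij xs(1) by (metis in_set_conv_nth)
    then show "\<exists>k\<in>{- int m..int m}. \<bar>\<theta> j - \<theta> i - of_int k * b\<bar> \<le> D * sqrt e"
      using *[OF e xs(3), of p q] by simp
  qed
qed

text \<open>Given the angle of \<open>i0\<close>, every other angle independently has to fall into
  \<open>2 * m + 1\<close> intervals of length \<open>2 * \<delta>\<close>, out of a circle of
  length \<open>2 * pi\<close>. The angle of \<open>i0\<close> itself is free, hence the exponent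
  \<open>card K\<close>.\<close>

lemma measure_lattice_le:
  fixes K :: "'i set"
  assumes K: "finite K" "i0 \<notin> K" and d: "\<delta> \<ge> 0"
    and A: "A \<in> sets (Pi\<^sub>M (insert i0 K) (\<lambda>_. uniform_angle))"
    and sub: "\<And>\<theta> j. \<theta> \<in> A \<Longrightarrow> j \<in> K \<Longrightarrow> \<exists>k\<in>{- int m..int m}. \<bar>\<theta> j - \<theta> i0 - of_int k * b\<bar> \<le> \<delta>"
  shows "measure (Pi\<^sub>M (insert i0 K) (\<lambda>_. uniform_angle)) A \<le> (real (2 * m + 1) * \<delta> / pi) ^ card K"
proof -
  interpret P: prob_space uniform_angle by (rule prob_space_uniform_angle)
  interpret U: product_sigma_finite "\<lambda>_ :: 'i. uniform_angle" by standard
  let ?M = "Pi\<^sub>M (insert i0 K) (\<lambda>_. uniform_angle)" and ?N = "Pi\<^sub>M K (\<lambda>_. uniform_angle)"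
  interpret PM: prob_space ?M by (intro prob_space_PiM prob_space_uniform_angle)
  define S where "S s = (\<Union>k\<in>{- int m..int m}. {s + of_int k * b - \<delta>..s + of_int k * b + \<delta>})" for s
  have S: "S s \<in> sets borel" for s unfolding S_def by auto
  have muS: "emeasure uniform_angle (S s) \<le> ennreal (real (2 * m + 1) * \<delta> / pi)" for s
  proof -
    have "emeasure uniform_angle (S s) \<le> emeasure lborel (S s) / ennreal (2 * pi)"
      unfolding emeasure_uniform_angle[OF S] using S
          by (intro divide_right_mono_ennreal emeasure_mono) auto
    also have "emeasure lborel (S s) \<le> (\<Sum>k\<in>{- int m..int m}. emeasure lborel {s + of_int k
        * b - \<delta>..s + of_int k * b + \<delta>})"
      unfolding S_def by (intro emeasure_subadditive_finite) auto
    also have "\<dots> = ennreal (real (2 * m + 1) * (2 * \<delta>))"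
      using d by (simp add: ennreal_mult'[symmetric] ennreal_of_nat_eq_real_of_nat nat_add_distrib
          algebra_simps)
    finally have "emeasure uniform_angle (S s)
        \<le> ennreal (real (2 * m + 1) * (2 * \<delta>)) / ennreal (2 * pi)"
      by (simp add: divide_right_mono_ennreal)
    also have "\<dots> = ennreal (real (2 * m + 1) * \<delta> / pi)"
      using d by (subst divide_ennreal) auto
    finally show ?thesis .
  qed
  have "emeasure ?M A = (\<integral>\<^sup>+y. indicator A y \<partial>?M)" using A by simp
  also have "\<dots> = (\<integral>\<^sup>+s. \<integral>\<^sup>+y. indicator A (y(i0 := s)) \<partial>?N \<partial>uniform_angle)"
    using A K by (subst U.product_nn_integral_insert_rev) auto
  also have "\<dots> \<le> (\<integral>\<^sup>+s. ennreal ((real (2 * m + 1) * \<delta> / pi) ^ card K) \<partial>uniform_angle)"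
  proof (rule nn_integral_mono)
    fix s :: real
    have "(\<integral>\<^sup>+y. indicator A (y(i0 := s)) \<partial>?N) \<le> (\<integral>\<^sup>+y. indicator (Pi\<^sub>E K (\<lambda>_. S s)) y \<partial>?N)"
    proof (rule nn_integral_mono)
      fix y assume y: "y \<in> space ?N"
      have "y \<in> Pi\<^sub>E K (\<lambda>_. S s)" if a: "y(i0 := s) \<in> A"
      proof -
        have "y j \<in> S s" if "j \<in> K" for j
        proof -
          have "j \<noteq> i0" using that K by auto
          then have "\<exists>k\<in>{- int m..int m}. \<bar>y j - s - of_int k * b\<bar> \<le> \<delta>" using sub[OF a that] by simp
          then obtain k where "k \<in> {- int m..int m}" "\<bar>y j - s - of_int k * b\<bar> \<le> \<delta>" by blast
          then show ?thesis unfolding S_def by (intro UN_I[of k]) (auto simp: abs_le_iff)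
        qed
        then show ?thesis using y by (auto simp: space_PiM PiE_iff)
      qed
      then show "indicator A (y(i0 := s)) \<le> (indicator (Pi\<^sub>E K (\<lambda>_. S s)) y :: ennreal)"
          by (auto simp: indicator_def)
    qed
    also have "\<dots> = emeasure ?N (Pi\<^sub>E K (\<lambda>_. S s))"
      using S K by (intro nn_integral_indicator sets_PiM_I_finite) auto
    also have "\<dots> = (\<Prod>i\<in>K. emeasure uniform_angle (S s))" using S K by (subst U.emeasure_PiM) auto
    also have "\<dots> \<le> (\<Prod>i\<in>K. ennreal (real (2 * m + 1) * \<delta> / pi))" by (intro prod_mono_ennreal muS)
    also have "\<dots> = ennreal ((real (2 * m + 1) * \<delta> / pi) ^ card K)" using d
        by (simp add: ennreal_power)
    finally show "(\<integral>\<^sup>+y. indicator A (y(i0 := s)) \<partial>?N)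
        \<le> ennreal ((real (2 * m + 1) * \<delta> / pi) ^ card K)" .
  qed
  also have "\<dots> = ennreal ((real (2 * m + 1) * \<delta> / pi) ^ card K)" using P.emeasure_space_1 by simp
  finally show ?thesis using d unfolding PM.emeasure_eq_measure by (subst (asm) ennreal_le_iff) auto
qed

end

section \<open>Counting almost regular polygons\<close>

text \<open>There are at most \<open>n ^ u\<close> possible unions of size \<open>u\<close>, and
  each contains at most \<open>4 ^ u\<close> pairs of subsets.\<close>

lemma sum_pairs_card_Un_le:
  fixes f :: "nat \<Rightarrow> real"
  assumes P: "P \<subseteq> Pow {1..n} \<times> Pow {1..n}" and U: "finite U" "\<And>I J. (I, J) \<in> P \<Longrightarrow> card (I \<union> J) \<in> U"
    and f: "\<And>u. u \<in> U \<Longrightarrow> f u \<ge> 0"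
  shows "(\<Sum>(I, J)\<in>P. f (card (I \<union> J))) \<le> (\<Sum>u\<in>U. real n ^ u * 4 ^ u * f u)"
proof -
  have finP: "finite P" using P by (rule finite_subset) auto
  have "(\<Sum>(I, J)\<in>P. f (card (I \<union> J))) = (\<Sum>u\<in>U. \<Sum>p\<in>{p \<in> P. card (fst p \<union> snd p)
      = u}. f (card (fst p \<union> snd p)))"
    using finP U by (subst sum.group) (auto simp: case_prod_unfold)
  also have "\<dots> \<le> (\<Sum>u\<in>U. real n ^ u * 4 ^ u * f u)"
  proof (rule sum_mono)
    fix u assume u: "u \<in> U"
    let ?Q = "{p \<in> P. card (fst p \<union> snd p) = u}" and ?K = "{K. K \<subseteq> {1..n} \<and> card K = u}"
    have finK: "finite ?K" by (rule finite_subset[of _ "Pow {1..n}"]) auto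
    have "?Q \<subseteq> (\<Union>K\<in>?K. Pow K \<times> Pow K)"
    proof
      fix p assume "p \<in> ?Q"
      then have "p \<in> Pow {1..n} \<times> Pow {1..n}" "card (fst p \<union> snd p) = u" using P by auto
      then have "fst p \<union> snd p \<in> ?K" "p \<in> Pow (fst p \<union> snd p) \<times> Pow (fst p \<union> snd p)"
        unfolding mem_Times_iff by auto
      then show "p \<in> (\<Union>K\<in>?K. Pow K \<times> Pow K)" by blast
    qed
    moreover have "finite (\<Union>K\<in>?K. Pow K \<times> Pow K)"
      using finK finite_subset[OF _ finite_atLeastAtMost[of 1 n]] by auto
    ultimately have "card ?Q \<le> card (\<Union>K\<in>?K. Pow K \<times> Pow K)" by (intro card_mono)
    also have "\<dots> \<le> (\<Sum>K\<in>?K. card (Pow K \<times> Pow K))" by (rule card_UN_le[OF finK])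
    also have "\<dots> = (\<Sum>K\<in>?K. 4 ^ u)"
    proof (rule sum.cong)
      fix K assume "K \<in> ?K"
      then have "finite K" "card K = u" using finite_subset[of K "{1..n}"] by auto
      then show "card (Pow K \<times> Pow K) = 4 ^ u"
        by (simp add: card_cartesian_product card_Pow power_mult_distrib[symmetric])
    qed simp
    also have "\<dots> = (n choose u) * 4 ^ u" by (simp add: n_subsets)
    also have "\<dots> \<le> n ^ u * 4 ^ u"
      by (intro mult_right_mono) (cases "u \<le> n"; simp add: binomial_le_pow binomial_eq_0)+
    finally have "real (card ?Q) \<le> real (n ^ u * 4 ^ u)" by (rule of_nat_mono)
    then have c: "real (card ?Q) \<le> real n ^ u * 4 ^ u" by simp
    have "(\<Sum>p\<in>?Q. f (card (fst p \<union> snd p))) = (\<Sum>p\<in>?Q. f u)" by (intro sum.cong) auto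
    also have "\<dots> = real (card ?Q) * f u" by simp
    also have "\<dots> \<le> real n ^ u * 4 ^ u * f u" using c f[OF u] by (rule mult_right_mono)
    finally show "(\<Sum>p\<in>?Q. f (card (fst p \<union> snd p))) \<le> real n ^ u * 4 ^ u * f u" .
  qed
  finally show ?thesis .
qed

text \<open>The lower bound replaces every factor \<open>n - i\<close> by \<open>n - m\<close> and
  uses Bernoulli's inequality; for \<open>n < m\<close> its left side is not positive.\<close>

lemma falling_factorial_bounds:
  assumes "n \<ge> 1"
  shows "real ((n choose m) * fact m) \<le> real n ^ m"
    and "real n ^ m * (1 - real m ^ 2 / real n) \<le> real ((n choose m) * fact m)"
proof -
  have e: "real ((n choose m) * fact m) = (\<Prod>i<m. real n - real i)"
    using gbinomial_prod_rev[of "real n" m] unfolding binomial_gbinomial[symmetric]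
    by (simp add: atLeast0LessThan)
  have le: "real ((n choose m) * fact m) \<le> real n ^ m"
  proof (cases "m \<le> n")
    case True
    then show ?thesis unfolding e using prod_mono[of "{..<m}" "\<lambda>i. real n - real i" "\<lambda>_. real n"]
        by auto
  qed (simp add: binomial_eq_0)
  then show "real ((n choose m) * fact m) \<le> real n ^ m" .
  show "real n ^ m * (1 - real m ^ 2 / real n) \<le> real ((n choose m) * fact m)"
  proof (cases "m \<le> n")
    case True
    have n: "real n > 0" using assms by simp
    have "1 - real m ^ 2 / real n \<le> (1 - real m / real n) ^ m"
      using Bernoulli_inequality[of "- (real m / real n)" m] True n
      by (simp add: power2_eq_square)
    then have "real n ^ m * (1 - real m ^ 2 / real n) \<le> real n ^ m * (1 - real m / real n) ^ m"
      by (intro mult_left_mono) auto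
    also have "\<dots> = (\<Prod>i<m. real n - real m)" using n
        by (simp add: power_mult_distrib[symmetric] algebra_simps)
    also have "\<dots> \<le> (\<Prod>i<m. real n - real i)" using True by (intro prod_mono) auto
    finally show ?thesis unfolding e .
  next
    case False
    have n: "real n > 0" using assms by simp
    have "real n \<le> real m" "1 \<le> real m" using False assms by auto
    then have "real n * 1 \<le> real m * real m" by (intro mult_mono) auto
    then have "1 - real m ^ 2 / real n \<le> 0" using n by (simp add: power2_eq_square)
    then have "real n ^ m * (1 - real m ^ 2 / real n) \<le> 0" using n by (simp add: mult_nonneg_nonpos)
    then show ?thesis by (meson of_nat_0_le_iff order_trans)
  qed
qed

text \<open>From \<open>m * (u - 1) = (m - 1) * u + (u - m)\<close>. As \<open>sqrt e\<close> is
  proportional to \<open>r ^ m\<close>, this is the order of the expected number of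
  \<open>u\<close>-point configurations.\<close>

lemma power_scaling_identity:
  fixes r :: real
  assumes r: "0 < r" and nr: "real n * r ^ (m - 1) = 1" and m: "m \<ge> 1" and u: "u \<ge> m"
  shows "real n ^ u * (r ^ m) ^ (u - 1) = r ^ (u - m)"
proof -
  have "m * (u - 1) = (m - 1) * u + (u - m)"
    using m u by (cases m; cases u) (auto simp: algebra_simps)
  then have "real n ^ u * (r ^ m) ^ (u - 1) = (real n * r ^ (m - 1)) ^ u * r ^ (u - m)"
    by (simp add: power_mult[symmetric] power_add power_mult_distrib mult.assoc)
  then show ?thesis unfolding nr by simp
qed

section \<open>Independent uniform angles and the dependence between the events of two sets\<close>

locale uniform_angles = prob_space +
  fixes \<theta> :: "nat \<Rightarrow> 'a \<Rightarrow> real"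
  assumes indep_angles: "indep_vars (\<lambda>_. borel) \<theta> {1..}"
    and distr_angle: "\<And>i. i \<ge> 1 \<Longrightarrow> distr M borel (\<theta> i) = uniform_angle"
begin

lemma measurable_angle: "i \<ge> 1 \<Longrightarrow> \<theta> i \<in> borel_measurable M"
  using indep_angles unfolding indep_vars_def by auto

lemma distr_angles:
  assumes "K \<subseteq> {1..}" "K \<noteq> {}"
  shows "distr M (Pi\<^sub>M K (\<lambda>_. borel)) (\<lambda>\<omega>. \<lambda>i\<in>K. \<theta> i \<omega>) = Pi\<^sub>M K (\<lambda>_. uniform_angle)"
proof -
  have "indep_vars (\<lambda>_. borel) \<theta> K" using indep_angles assms(1) by (rule indep_vars_subset)
  then have "distr M (Pi\<^sub>M K (\<lambda>_. borel)) (\<lambda>\<omega>. \<lambda>i\<in>K. \<theta> i \<omega>) = Pi\<^sub>M K (\<lambda>i. distr M borel (\<theta> i))"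
    using assms measurable_angle by (subst (asm) indep_vars_iff_distr_eq_PiM') auto
  also have "\<dots> = Pi\<^sub>M K (\<lambda>_. uniform_angle)" using assms distr_angle by (intro PiM_cong) auto
  finally show ?thesis .
qed

lemma prob_angles:
  assumes K: "K \<subseteq> {1..}" "K \<noteq> {}" and A: "A \<in> sets (Pi\<^sub>M K (\<lambda>_. uniform_angle))"
  shows "prob {\<omega> \<in> space M. (\<lambda>i\<in>K. \<theta> i \<omega>) \<in> A} = measure (Pi\<^sub>M K (\<lambda>_. uniform_angle)) A"
proof -
  have "A \<in> sets (Pi\<^sub>M K (\<lambda>_. borel))" using A sets_PiM_cong[of K K "\<lambda>_. uniform_angle" "\<lambda>_. borel"]
      by simp
  moreover have "(\<lambda>\<omega>. \<lambda>i\<in>K. \<theta> i \<omega>) \<in> measurable M (Pi\<^sub>M K (\<lambda>_. borel))"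
    using K measurable_angle by (intro measurable_restrict) auto
  ultimately have "measure (distr M (Pi\<^sub>M K (\<lambda>_. borel)) (\<lambda>\<omega>. \<lambda>i\<in>K. \<theta> i \<omega>)) A
      = prob ((\<lambda>\<omega>. \<lambda>i\<in>K. \<theta> i \<omega>) -` A \<inter> space M)"
    by (intro measure_distr)
  then show ?thesis unfolding distr_angles[OF K] by (simp add: vimage_def Int_def conj_commute)
qed

definition tight_event :: "real \<Rightarrow> nat set \<Rightarrow> 'a set" where
  "tight_event c I = {\<omega> \<in> space M. tight_set c (\<lambda>i. \<theta> i \<omega>) I}"

lemma sets_tight_event: "finite I \<Longrightarrow> I \<subseteq> {1..} \<Longrightarrow> tight_event c I \<in> events"
  unfolding tight_event_def using measurable_angle by (intro measurable_tight_set) auto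

lemma tight_set_restrict: "I \<subseteq> K \<Longrightarrow> tight_set c (\<lambda>i\<in>K. f i) I \<longleftrightarrow> tight_set c f I"
  by (rule tight_set_cong) auto

lemma sets_tight_PiM:
  "finite K \<Longrightarrow> I \<subseteq> K \<Longrightarrow> {y \<in> space (Pi\<^sub>M K (\<lambda>_. uniform_angle)). tight_set c y I}
      \<in> sets (Pi\<^sub>M K (\<lambda>_. uniform_angle))"
  using measurable_component_singleton[of _ K "\<lambda>_. uniform_angle"]
  by (intro measurable_tight_set) (auto intro: finite_subset simp: measurable_cong_sets[OF refl
      sets_uniform_angle])

lemma prob_tight_event:
  assumes I: "finite I" "I \<subseteq> {1..}" "card I = m" and m: "m \<ge> 3"
  shows "prob (tight_event (real m * tan (pi / real m) + e) I) = fact m * tight_prob m e"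
proof -
  let ?c = "real m * tan (pi / real m) + e"
  have ne: "I \<noteq> {}" using I m by auto
  let ?A = "{y \<in> space (Pi\<^sub>M I (\<lambda>_. uniform_angle)). tight_set ?c y I}"
  have "tight_event ?c I = {\<omega> \<in> space M. (\<lambda>i\<in>I. \<theta> i \<omega>) \<in> ?A}"
    unfolding tight_event_def by (auto simp: space_PiM tight_set_restrict)
  then have "prob (tight_event ?c I) = measure (Pi\<^sub>M I (\<lambda>_. uniform_angle)) ?A"
    using prob_angles[OF I(2) ne sets_tight_PiM[OF I(1) order_refl]] by simp
  then show ?thesis unfolding measure_tight_set[OF I(1)] I(3) tight_prob_def[OF m] .
qed

text \<open>A common point \<open>i0\<close> anchors both sets to the same lattice, so all other
  angles of the union are confined relative to it. The case \<open>I = J\<close> bounds the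
  probability of a single event.\<close>

lemma tight_event_pair_bound:
  assumes m: "m \<ge> 3"
  obtains B e0 where "B > 0" "e0 > 0"
    "\<And>e I J. 0 < e \<Longrightarrow> e \<le> e0 \<Longrightarrow> finite I \<Longrightarrow> finite J \<Longrightarrow> I \<subseteq> {1..} \<Longrightarrow> J \<subseteq> {1..} \<Longrightarrow> card I = m \<Longrightarrow>
        card J = m \<Longrightarrow> I \<inter> J \<noteq> {} \<Longrightarrow>
      prob (tight_event (real m * tan (pi / real m) + e) I \<inter> tight_event (real m * tan (pi / real m)
          + e) J)
        \<le> (B * sqrt e) ^ (card (I \<union> J) - 1)"
proof -
  obtain D e0 where D: "D > 0" "e0 > 0"
    and lat: "\<And>e (\<theta> :: nat \<Rightarrow> real) I i j. 0 < e \<Longrightarrow> e \<le> e0 \<Longrightarrow> finite I \<Longrightarrow> card I = m \<Longrightarrow>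
        tight_set (real m * tan (pi / real m) + e) \<theta> I \<Longrightarrow> i \<in> I \<Longrightarrow> j \<in> I \<Longrightarrow>
      \<exists>k\<in>{- int m..int m}. \<bar>\<theta> j - \<theta> i - of_int k * (2 * pi / real m)\<bar> \<le> D * sqrt e"
    using tight_set_lattice[OF m, where 'i = nat] by metis
  define B where "B = real (2 * m + 1) * D / pi"
  have B: "B > 0" unfolding B_def using D by (intro divide_pos_pos mult_pos_pos) auto
  show ?thesis
  proof (rule that[OF B D(2)])
    fix e :: real and I J :: "nat set" assume e: "0 < e" "e
        \<le> e0" and I: "finite I" "finite J" "I \<subseteq> {1..}" "J \<subseteq> {1..}"
      and c: "card I = m" "card J = m" "I \<inter> J \<noteq> {}"
    let ?c = "real m * tan (pi / real m) + e"
    obtain i0 where i0: "i0 \<in> I" "i0 \<in> J" using c by auto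
    define K where "K = I \<union> J - {i0}"
    have K: "insert i0 K = I \<union> J" "i0 \<notin> K" "finite K" using i0 I by (auto simp: K_def)
    let ?N = "Pi\<^sub>M (insert i0 K) (\<lambda>_. uniform_angle)"
    define A where "A = {y \<in> space ?N. tight_set ?c y I} \<inter> {y \<in> space ?N. tight_set ?c y J}"
    have A: "A \<in> sets ?N" unfolding A_def using I K by (intro sets.Int sets_tight_PiM) auto
    have "tight_event ?c I \<inter> tight_event ?c J = {\<omega> \<in> space M. (\<lambda>i\<in>insert i0 K. \<theta> i \<omega>) \<in> A}"
      unfolding tight_event_def A_def K(1) by (auto simp: space_PiM tight_set_restrict)
    then have "prob (tight_event ?c I \<inter> tight_event ?c J) = measure ?N A"
      using prob_angles[of "insert i0 K" A] A I(3,4) i0(1) unfolding K(1) by auto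
    also have "\<dots> \<le> (real (2 * m + 1) * (D * sqrt e) / pi) ^ card K"
    proof (rule measure_lattice_le[OF m K(3,2) _ A])
      show "0 \<le> D * sqrt e" using D e by simp
      fix y j assume y: "y \<in> A" and j: "j \<in> K"
      then consider "j \<in> I" "tight_set ?c y I" | "j \<in> J" "tight_set ?c y J"
        unfolding A_def K_def by auto
      then show "\<exists>k\<in>{- int m..int m}. \<bar>y j - y i0 - of_int k * (2 * pi / real m)\<bar> \<le> D * sqrt e"
      proof cases
        case 1
        then show ?thesis using lat[OF e I(1) c(1)] i0 by blast
      next
        case 2
        then show ?thesis using lat[OF e I(2) c(2)] i0 by blast
      qed
    qed
    also have "card K = card (I \<union> J) - 1" using card_insert_disjoint[OF K(3,2)] K(1) by simp
    also have "real (2 * m + 1) * (D * sqrt e) / pi = B * sqrt e" by (simp add: B_def)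
    finally show "prob (tight_event ?c I \<inter> tight_event ?c J) \<le> (B * sqrt e) ^ (card (I \<union> J) - 1)" .
  qed
qed

text \<open>The event of \<open>I\<close> depends only on the coordinates in \<open>I\<close>, and
  the count only on those in the union of \<open>F\<close>, which is disjoint from \<open>I\<close>;
  families of independent variables over disjoint index sets are independent.\<close>

lemma tight_events_indep:
  fixes g :: "nat \<Rightarrow> real"
  assumes I: "finite I" "I \<subseteq> {1..}" and F: "finite F" "\<And>J. J \<in> F \<Longrightarrow>
      finite J \<and> J \<subseteq> {1..} \<and> J \<inter> I = {}"
    and g: "\<And>k. \<bar>g k\<bar> \<le> 1"
  shows "expectation (\<lambda>\<omega>. indicator (tight_event c I) \<omega> * g (card {J \<in> F. \<omega> \<in> tight_event c J}))
    = prob (tight_event c I) * expectation (\<lambda>\<omega>. g (card {J \<in> F. \<omega> \<in> tight_event c J}))"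
proof -
  define K where "K = \<Union>F"
  have K: "K \<inter> I = {}" "K \<subseteq> {1..}" "finite K" using F by (auto simp: K_def)
  let ?PI = "Pi\<^sub>M I (\<lambda>_. borel :: real measure)" and ?PK = "Pi\<^sub>M K (\<lambda>_. borel :: real measure)"
  define X where "X y = (indicator {y \<in> space ?PI. tight_set c y I} y :: real)" for y
  define E where "E J = {y \<in> space ?PK. tight_set c y J}" for J
  define Y where "Y y = g (card {J \<in> F. y \<in> E J})" for y
  have E_eq: "E J = {y \<in> space (Pi\<^sub>M K (\<lambda>_. uniform_angle)). tight_set c y J}" for J
    unfolding E_def by (simp add: space_PiM)
  have sPK: "sets (Pi\<^sub>M K (\<lambda>_. uniform_angle))
      = sets ?PK" and sPI: "sets (Pi\<^sub>M I (\<lambda>_. uniform_angle)) = sets ?PI"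
    by (intro sets_PiM_cong; simp)+
  have "{y \<in> space ?PI. tight_set c y I} \<in> sets ?PI"
    using sets_tight_PiM[OF I(1) order_refl, of c] unfolding sPI by (simp add: space_PiM)
  then have X: "X \<in> borel_measurable ?PI" unfolding X_def[abs_def] by measurable
  have E: "E J \<in> sets ?PK" if "J \<in> F" for J
    unfolding E_eq sPK[symmetric] using that K(3) by (intro sets_tight_PiM) (auto simp: K_def)
  have Y: "Y \<in> borel_measurable ?PK"
  proof -
    interpret PK: prob_space "Pi\<^sub>M K (\<lambda>_. uniform_angle)"
        by (intro prob_space_PiM prob_space_uniform_angle)
    have "(\<lambda>y. card {J \<in> F. y \<in> E J}) \<in> measurable (Pi\<^sub>M K (\<lambda>_. uniform_angle)) (count_space UNIV)"
      using F(1) E unfolding sPK[symmetric] by (rule PK.measurable_count_events)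
    then have "(\<lambda>y. card {J \<in> F. y \<in> E J}) \<in> measurable ?PK (count_space UNIV)"
      using measurable_cong_sets[OF sPK refl] by blast
    then show ?thesis unfolding Y_def[abs_def] by measurable
  qed
  have "indep_var ?PI (\<lambda>\<omega>. restrict (\<lambda>i. \<theta> i \<omega>) I) ?PK (\<lambda>\<omega>. restrict (\<lambda>i. \<theta> i \<omega>) K)"
    using K I by (intro indep_var_restrict[OF indep_angles]) auto
  from indep_var_compose[OF this X Y]
  have ind: "indep_var borel (\<lambda>\<omega>. X (\<lambda>i\<in>I. \<theta> i \<omega>)) borel (\<lambda>\<omega>. Y (\<lambda>i\<in>K. \<theta> i \<omega>))"
    by (simp add: comp_def)
  have rv: "(\<lambda>\<omega>. X (\<lambda>i\<in>I. \<theta> i \<omega>)) \<in> borel_measurable M" "(\<lambda>\<omega>. Y (\<lambda>i\<in>K. \<theta> i \<omega>)) \<in> borel_measurable M"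
    using indep_var_rv1[OF ind] indep_var_rv2[OF ind] .
  have "expectation (\<lambda>\<omega>. X (\<lambda>i\<in>I. \<theta> i \<omega>) * Y (\<lambda>i\<in>K. \<theta> i \<omega>))
     = expectation (\<lambda>\<omega>. X (\<lambda>i\<in>I. \<theta> i \<omega>)) * expectation (\<lambda>\<omega>. Y (\<lambda>i\<in>K. \<theta> i \<omega>))"
    using rv g by (intro indep_var_lebesgue_integral[OF ind] integrable_const_bound[of _ 1])
      (auto simp: X_def Y_def indicator_def)
  moreover have "X (\<lambda>i\<in>I. \<theta> i \<omega>) = indicator (tight_event c I) \<omega>" if "\<omega> \<in> space M" for \<omega>
    using that unfolding X_def tight_event_def
        by (auto simp: indicator_def space_PiM tight_set_restrict)
  moreover have "Y (\<lambda>i\<in>K. \<theta> i \<omega>) = g (card {J \<in> F. \<omega> \<in> tight_event c J})" if "\<omega> \<in> space M" for \<omega>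
  proof -
    have "(\<lambda>i\<in>K. \<theta> i \<omega>) \<in> E J \<longleftrightarrow> \<omega> \<in> tight_event c J" if "J \<in> F" for J
    proof -
      have "J \<subseteq> K" using that by (auto simp: K_def)
      then show ?thesis using \<open>\<omega> \<in> space M\<close> unfolding E_def tight_event_def
          by (auto simp: space_PiM tight_set_restrict)
    qed
    then show ?thesis unfolding Y_def by (metis (mono_tags, lifting) Collect_cong)
  qed
  ultimately have "expectation (\<lambda>\<omega>. indicator (tight_event c I) \<omega> * g (card {J \<in> F. \<omega>
      \<in> tight_event c J}))
     = expectation (indicator (tight_event c I)) * expectation (\<lambda>\<omega>. g (card {J \<in> F. \<omega>
         \<in> tight_event c J}))"
    by (simp cong: Bochner_Integration.integral_cong)
  then show ?thesis using sets_tight_event[OF I, of c] by simp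
qed

end

context uniform_angles
begin

definition no_tight_event :: "nat \<Rightarrow> nat \<Rightarrow> real \<Rightarrow> 'a set" where
  "no_tight_event m n c = {\<omega> \<in> space M. \<forall>I\<in>{I. I \<subseteq> {1..n} \<and> card I = m}. \<omega> \<notin> tight_event c I}"

text \<open>Parametrised by \<open>r\<close> instead of \<open>n\<close> so that only natural powers
  occur. Of the Chen--Stein terms, the discrepancy of the mean and the products of probabilities are
  covered by powers of \<open>r\<close> with exponent at least \<open>m - 1\<close>; the pair
  intersections give the first power.\<close>

lemma no_tight_event_rate:
  fixes t :: real
  assumes m: "m \<ge> 3" and t: "t > 0"
  defines "l \<equiv> tight_rate m * sqrt t ^ (m - 1)"
  obtains C r0 where "r0 > 0" "\<And>n r. n \<ge> 1 \<Longrightarrow> 0 < r \<Longrightarrow> r \<le> r0 \<Longrightarrow> real n * r ^ (m - 1) = 1 \<Longrightarrow>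
    \<bar>prob (no_tight_event m n (real m * tan (pi / real m) + t * (r ^ m)\<^sup>2)) - exp (- l)\<bar> \<le> C * r"
proof -
  let ?a = "real m * tan (pi / real m)"
  have lpos: "l > 0"
    unfolding l_def tight_rate_def[OF m] using ball_const_pos[OF m] curvature_pos[OF m] m t by simp
  obtain C1 e1 where C1: "C1 \<ge> 0" "e1 > 0"
    and asymp: "\<And>e. 0 < e \<Longrightarrow> e \<le> e1 \<Longrightarrow> \<bar>tight_prob m e - tight_rate m * sqrt e ^ (m - 1)\<bar>
        \<le> C1 * sqrt e ^ m"
    using tight_prob_asymp[OF m] by blast
  obtain B e2 where B: "B > 0" "e2 > 0"
    and pair: "\<And>e I J. 0 < e \<Longrightarrow> e \<le> e2 \<Longrightarrow> finite I \<Longrightarrow> finite J \<Longrightarrow> I \<subseteq> {1..} \<Longrightarrow> J \<subseteq> {1..} \<Longrightarrow> card I = m \<Longrightarrow>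
        card J = m \<Longrightarrow> I \<inter> J \<noteq> {} \<Longrightarrow>
      prob (tight_event (?a + e) I \<inter> tight_event (?a + e) J) \<le> (B * sqrt e) ^ (card (I \<union> J) - 1)"
    using tight_event_pair_bound[OF m] by blast
  define b where "b = B * sqrt t"
  have b: "b > 0" using B t by (simp add: b_def)
  \<comment> \<open>For \<open>r \<le> 1\<close> the excess is at most \<open>t * r\<close>, so
    these bounds keep it below \<open>e1\<close> and \<open>e2\<close>.\<close>
  define r0 where "r0 = min 1 (min (e1 / t) (e2 / t))"
  have r0: "r0 > 0" "r0 \<le> 1" using C1 B t by (auto simp: r0_def)
  \<comment> \<open>Possible sizes of the union of two \<open>m\<close>-sets with a common
    point.\<close>
  define U where "U = {m..2 * m - 1}"
  \<comment> \<open>The first summand pays for replacing the falling factorial by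
    \<open>n ^ m\<close>, the second for the error in \<open>tight_prob_asymp\<close>.\<close>
  define C2 where "C2 = l * (real m)\<^sup>2 + C1 * sqrt t ^ m"
  define C3 where "C3 = (\<Sum>u\<in>U. 4 ^ u * b ^ (2 * m - 2))"
  define C4 where "C4 = (\<Sum>u\<in>U - {m}. 4 ^ u * b ^ (u - 1))"
  show ?thesis
  proof (rule that[OF r0(1)])
    fix n :: nat and r :: real
    assume n: "n \<ge> 1" and r: "0 < r" "r \<le> r0" and nr: "real n * r ^ (m - 1) = 1"
    have r1: "r \<le> 1" using r r0 by simp
    define e where "e = t * (r ^ m)\<^sup>2"
    have se: "sqrt e = sqrt t * r ^ m" unfolding e_def using r by (simp add: real_sqrt_mult)
    have e0: "0 < e" unfolding e_def using t r by simp
    have "(r ^ m)\<^sup>2 \<le> r"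
    proof -
      have "(r ^ m)\<^sup>2 = r ^ (m * 2)" by (simp add: power_mult)
      also have "\<dots> \<le> r ^ 1" using r r1 m by (intro power_decreasing) auto
      finally show ?thesis by simp
    qed
    then have "e \<le> t * r0" unfolding e_def using r t by simp
    also have "t * r0 \<le> t * (e1 / t)" "t * r0 \<le> t * (e2 / t)"
      unfolding r0_def using t by (intro mult_left_mono; simp)+
    ultimately have e12: "e \<le> e1" "e \<le> e2" using t by auto
    have inv_n: "1 / real n = r ^ (m - 1)" using nr n by (simp add: field_simps)
    have rm1: "r ^ (m - 1) \<le> r" using power_decreasing[of 1 "m - 1" r] r r1 m by simp
    have rm: "r ^ m \<le> r" using power_decreasing[of 1 m r] r r1 m by simp
    define c where "c = ?a + e"
    define F where "F = {I. I \<subseteq> {1..n} \<and> card I = m}"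
    have finF: "finite F" unfolding F_def by (rule finite_subset[of _ "Pow {1..n}"]) auto
    have F: "finite I" "I \<subseteq> {1..}" "card I = m" if "I \<in> F" for I
      using that finite_subset[of I "{1..n}"] by (auto simp: F_def)
    define N where "N I = {J \<in> F. I \<inter> J \<noteq> {}}" for I
    define p where "p = prob (tight_event c {1..m})"
    have p: "prob (tight_event c I) = p" if "I \<in> F" for I
      unfolding p_def c_def using prob_tight_event[OF F[OF that] m, of e] prob_tight_event[of
          "{1..m}", OF _ _ _ m, of e] by auto
    have p_eq: "p = fact m * tight_prob m e"
      unfolding p_def c_def using prob_tight_event[of "{1..m}", OF _ _ _ m, of e] by auto
    have p0: "p \<ge> 0" by (simp add: p_def)
    have x: "B * sqrt e = b * r ^ m" unfolding se b_def by simp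
    \<comment> \<open>The pair bound with both sets equal to \<open>{1..m}\<close>.\<close>
    have p_le: "p \<le> (b * r ^ m) ^ (m - 1)"
      using pair[OF e0 e12(2), of "{1..m}" "{1..m}"] m unfolding p_def c_def x by auto
    have stein: "\<bar>prob (no_tight_event m n c) - exp (- l)\<bar> \<le> \<bar>l - (\<Sum>I\<in>F. prob (tight_event c I))\<bar>
        + (\<Sum>I\<in>F. \<Sum>J\<in>N I. prob (tight_event c I) * prob (tight_event c J))
        + (\<Sum>I\<in>F. \<Sum>J\<in>N I - {I}. prob (tight_event c I \<inter> tight_event c J))"
      unfolding no_tight_event_def F_def[symmetric]
    proof (rule poisson_approximation_none[OF finF _ _ _ _ lpos])
      fix I assume I: "I \<in> F"
      show "tight_event c I \<in> events" using F[OF I] by (intro sets_tight_event)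
      show "I \<in> N I" using I F[OF I] m by (auto simp: N_def)
      show "N I \<subseteq> F" by (auto simp: N_def)
      fix g :: "nat \<Rightarrow> real" assume g: "\<And>k. \<bar>g k\<bar> \<le> 1"
      show "expectation (\<lambda>\<omega>. indicator (tight_event c I) \<omega> * g (card {J \<in> F - N I. \<omega>
          \<in> tight_event c J}))
        = prob (tight_event c I) * expectation (\<lambda>\<omega>. g (card {J \<in> F - N I. \<omega> \<in> tight_event c J}))"
        using F[OF I] finF F g by (intro tight_events_indep) (auto simp: N_def)
    qed
    have T1: "\<bar>l - (\<Sum>I\<in>F. prob (tight_event c I))\<bar> \<le> C2 * r"
    proof -
      let ?f = "real ((n choose m) * fact m)"
      have total: "(\<Sum>I\<in>F. prob (tight_event c I)) = ?f * tight_prob m e"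
        using p by (simp add: F_def n_subsets p_eq)
      have f: "?f \<le> real n ^ m" "real n ^ m * (1 - (real m)\<^sup>2 / real n) \<le> ?f"
        using falling_factorial_bounds[OF n] by auto
      have "real n ^ m * sqrt e ^ (m - 1) = sqrt t ^ (m - 1) * (real n ^ m * (r ^ m) ^ (m - 1))"
        unfolding se by (simp add: power_mult_distrib)
      also have "\<dots> = sqrt t ^ (m - 1)" using power_scaling_identity[OF r(1) nr, of m] m by simp
      finally have nl: "real n ^ m * (tight_rate m * sqrt e ^ (m - 1)) = l" unfolding l_def
          by (simp add: mult_ac)
      have main: "\<bar>l - ?f * (tight_rate m * sqrt e ^ (m - 1))\<bar> \<le> l * (real m)\<^sup>2 * r"
      proof -
        define q where "q = tight_rate m * sqrt e ^ (m - 1)"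
        have nq: "real n ^ m * q = l" using nl unfolding q_def .
        have q0: "q > 0" using lpos nq n by (metis less_eq_real_def mult_nonneg_nonpos not_le
            of_nat_0_le_iff zero_le_power)
        have "?f * q \<le> l" using mult_right_mono[OF f(1), of q] q0 nq by simp
        moreover have "real n ^ m * (1 - (real m)\<^sup>2 / real n) * q \<le> ?f * q"
          using f(2) q0 by (intro mult_right_mono) auto
        then have "l * (1 - (real m)\<^sup>2 / real n) \<le> ?f * q"
          by (simp only: nq[symmetric] mult_ac)
        moreover have "l * ((real m)\<^sup>2 / real n) \<le> l * ((real m)\<^sup>2 * r)"
        proof (rule mult_left_mono)
          have "(real m)\<^sup>2 / real n = (real m)\<^sup>2 * (1 / real n)" by simp
          then have "(real m)\<^sup>2 / real n = (real m)\<^sup>2 * r ^ (m - 1)" unfolding inv_n .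
          then show "(real m)\<^sup>2 / real n \<le> (real m)\<^sup>2 * r" using rm1 by (simp add: mult_left_mono)
        qed (use lpos in simp)
        ultimately show ?thesis unfolding q_def[symmetric] by (simp add: abs_le_iff algebra_simps)
      qed
      have "\<bar>?f * (tight_rate m * sqrt e ^ (m - 1)) - ?f * tight_prob m e\<bar>
          = ?f * \<bar>tight_prob m e - tight_rate m * sqrt e ^ (m - 1)\<bar>"
        unfolding right_diff_distrib[symmetric] abs_mult by (simp add: abs_minus_commute)
      also have "\<dots> \<le> real n ^ m * (C1 * sqrt e ^ m)"
        using asymp[OF e0 e12(1)] f(1) by (intro mult_mono) auto
      also have "\<dots> = C1 * sqrt t ^ m * (real n ^ m * (r ^ m) ^ (m - 1)) * r ^ m"
        unfolding se using m by (simp add: power_mult_distrib power_eq_if[of "r ^ m" m] mult_ac)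
      also have "\<dots> = C1 * sqrt t ^ m * r ^ m" using power_scaling_identity[OF r(1) nr, of m] m
          by simp
      also have "\<dots> \<le> C1 * sqrt t ^ m * r" using rm C1 t by (intro mult_left_mono) auto
      finally have "\<bar>?f * (tight_rate m * sqrt e ^ (m - 1)) - ?f * tight_prob m e\<bar>
          \<le> C1 * sqrt t ^ m * r" .
      then show ?thesis using main total
        unfolding C2_def distrib_right by linarith
    qed
    have cards: "card (I \<union> J) \<in> U" "J \<noteq> I \<Longrightarrow> card (I \<union> J) \<noteq> m" if "I \<in> F" "J \<in> N I" for I J
    proof -
      have IJ: "finite I" "finite J" "card I = m" "card J = m" "I \<inter> J \<noteq> {}"
        using F that by (auto simp: N_def)
      have "card (I \<inter> J) > 0" using IJ by (simp add: card_gt_0_iff)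
      then show "card (I \<union> J) \<in> U"
        using card_Un_Int[OF IJ(1,2)] card_mono[of "I \<union> J" I] IJ by (auto simp: U_def)
      assume "J \<noteq> I"
      show "card (I \<union> J) \<noteq> m"
      proof
        assume "card (I \<union> J) = m"
        then have "I = I \<union> J" "J = I \<union> J" using IJ by (intro card_subset_eq; simp)+
        then show False using \<open>J \<noteq> I\<close> by simp
      qed
    qed
    have NF: "(SIGMA I:F. N I) \<subseteq> Pow {1..n} \<times> Pow {1..n}" "(SIGMA I:F. N I - {I}) \<subseteq> Pow {1..n} \<times> Pow
        {1..n}"
      by (auto simp: F_def N_def)
    have finN: "finite (N I)" for I using finF by (simp add: N_def)
    have T2: "(\<Sum>I\<in>F. \<Sum>J\<in>N I. prob (tight_event c I) * prob (tight_event c J)) \<le> C3 * r"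
    proof -
      have "(\<Sum>I\<in>F. \<Sum>J\<in>N I. prob (tight_event c I) * prob (tight_event c J))
          \<le> (\<Sum>I\<in>F. \<Sum>J\<in>N I. (b * r ^ m) ^ (2 * m - 2))"
      proof (intro sum_mono)
        fix I J assume "I \<in> F" "J \<in> N I"
        then have "prob (tight_event c I) * prob (tight_event c J) = p * p" using p
            by (auto simp: N_def)
        also have "\<dots> \<le> (b * r ^ m) ^ (m - 1) * (b * r ^ m) ^ (m - 1)" using p_le p0 b r
            by (intro mult_mono) auto
        also have "\<dots> = (b * r ^ m) ^ (2 * m - 2)" using m
            by (simp add: power_add[symmetric] mult_2[symmetric] right_diff_distrib')
        finally show "prob (tight_event c I) * prob (tight_event c J) \<le> (b * r ^ m) ^ (2 * m - 2)" .
      qed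
      also have "\<dots> = (\<Sum>(I, J)\<in>(SIGMA I:F. N I). (\<lambda>u. (b * r ^ m) ^ (2 * m - 2)) (card (I \<union> J)))"
        by (subst sum.Sigma) (use finF finN in auto)
      also have "\<dots> \<le> (\<Sum>u\<in>U. real n ^ u * 4 ^ u * (b * r ^ m) ^ (2 * m - 2))"
        using b r cards by (intro sum_pairs_card_Un_le NF) (auto simp: U_def)
      also have "\<dots> \<le> (\<Sum>u\<in>U. 4 ^ u * b ^ (2 * m - 2) * r)"
      proof (rule sum_mono)
        fix u assume u: "u \<in> U"
        \<comment> \<open>The largest union, \<open>u = 2 * m - 1\<close>, is the worst case, since
          the product of probabilities does not depend on \<open>u\<close>; it leaves
          \<open>r ^ (m - 1)\<close>.\<close>
        have "real n ^ u \<le> real n ^ (2 * m - 1)" using u n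
            by (intro power_increasing) (auto simp: U_def)
        then have "real n ^ u * (r ^ m) ^ (2 * m - 2)
            \<le> real n ^ (2 * m - 1) * (r ^ m) ^ (2 * m - 2)"
          using r by (intro mult_right_mono) auto
        also have "\<dots> = r ^ (m - 1)" using power_scaling_identity[OF r(1) nr, of "2 * m - 1"] m
            by (simp add: numeral_2_eq_2)
        also have "\<dots> \<le> r" by (rule rm1)
        finally have "4 ^ u * b ^ (2 * m - 2) * (real n ^ u * (r ^ m) ^ (2 * m - 2))
            \<le> 4 ^ u * b ^ (2 * m - 2) * r"
          using b by (intro mult_left_mono) auto
        then show "real n ^ u * 4 ^ u * (b * r ^ m) ^ (2 * m - 2) \<le> 4 ^ u * b ^ (2 * m - 2) * r"
          by (simp only: power_mult_distrib mult_ac)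
      qed
      also have "\<dots> = C3 * r" by (simp add: C3_def sum_distrib_right)
      finally show ?thesis .
    qed
    have T3: "(\<Sum>I\<in>F. \<Sum>J\<in>N I - {I}. prob (tight_event c I \<inter> tight_event c J)) \<le> C4 * r"
    proof -
      have "(\<Sum>I\<in>F. \<Sum>J\<in>N I - {I}. prob (tight_event c I \<inter> tight_event c J))
          \<le> (\<Sum>I\<in>F. \<Sum>J\<in>N I - {I}. (b * r ^ m) ^ (card (I \<union> J) - 1))"
        using F pair[OF e0 e12(2)] unfolding c_def x by (intro sum_mono) (auto simp: N_def)
      also have "\<dots> = (\<Sum>(I, J)\<in>(SIGMA I:F. N I - {I}). (\<lambda>u. (b * r ^ m) ^ (u - 1)) (card (I \<union> J)))"
        using finF finN by (simp add: sum.Sigma)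
      also have "\<dots> \<le> (\<Sum>u\<in>U - {m}. real n ^ u * 4 ^ u * (b * r ^ m) ^ (u - 1))"
        using b r cards by (intro sum_pairs_card_Un_le NF) (auto simp: U_def)
      also have "\<dots> \<le> (\<Sum>u\<in>U - {m}. 4 ^ u * b ^ (u - 1) * r)"
      proof (rule sum_mono)
        fix u assume u: "u \<in> U - {m}"
        \<comment> \<open>A second, different set contributes at least one new point to the union,
          and this yields the factor \<open>r\<close>.\<close>
        then have um: "u \<ge> m" "u - m \<ge> 1" by (auto simp: U_def)
        have "real n ^ u * (r ^ m) ^ (u - 1) = r ^ (u - m)"
            using power_scaling_identity[OF r(1) nr _ um(1)] m by simp
        also have "\<dots> \<le> r" using power_decreasing[OF um(2), of r] r r1 by simp
        finally have "4 ^ u * b ^ (u - 1) * (real n ^ u * (r ^ m) ^ (u - 1))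
            \<le> 4 ^ u * b ^ (u - 1) * r"
          using b by (intro mult_left_mono) auto
        then show "real n ^ u * 4 ^ u * (b * r ^ m) ^ (u - 1) \<le> 4 ^ u * b ^ (u - 1) * r"
          by (simp only: power_mult_distrib mult_ac)
      qed
      also have "\<dots> = C4 * r" by (simp add: C4_def sum_distrib_right)
      finally show ?thesis .
    qed
    show "\<bar>prob (no_tight_event m n (?a + t * (r ^ m)\<^sup>2)) - exp (- l)\<bar> \<le> (C2 + C3 + C4) * r"
      using stein T1 T2 T3 unfolding c_def e_def distrib_right by linarith
  qed
qed

end

text \<open>Origin of the factors of \<open>K4\<close>: \<open>m\<close> from the range
  \<open>2 * pi / m\<close> of the first angle and \<open>sqrt m\<close> from the determinant of the
  ellipsoid, \<open>Gamma\<close> and half of the powers of \<pi> from the ball volume. The powers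
  of 2 from the 4 in \<open>\<kappa>\<close> cancel against those in
  \<open>(2 * pi) ^ m\<close>.\<close>

lemma tight_rate_eq_K4:
  assumes m: "m \<ge> 3" and t: "t > 0"
  shows "tight_rate m * sqrt t ^ (m - 1) = t powr ((real m - 1) / 2) / K4 m"
proof -
  define T where "T = tan (pi / real m)"
  define h where "h = (real m - 1) / 2"
  have T: "T > 0" using tan_pi_div_pos[OF m] by (simp add: T_def)
  define w where "w = T * (1 + T\<^sup>2)"
  have w: "w > 0" using T by (simp add: w_def add_pos_nonneg)
  have pw: "sqrt x ^ (m - 1) = x powr h" if "x > 0" for x
  proof -
    have "sqrt x ^ (m - 1) = sqrt x powr real (m - 1)" using that by (simp add: powr_realpow)
    also have "\<dots> = x powr h" using that m
      by (simp add: powr_half_sqrt[symmetric] powr_powr h_def of_nat_diff)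
    finally show ?thesis .
  qed
  have "unit_ball_vol (real (m - 1)) = pi powr h / Gamma ((real m + 1) / 2)"
  proof -
    have "real (m - 1) / 2 + 1 = (real m + 1) / 2" "real (m - 1) / 2 = h" using m
        by (auto simp: h_def of_nat_diff field_simps)
    then show ?thesis unfolding unit_ball_vol_def by (simp only:)
  qed
  moreover have "sqrt (w / 4) ^ (m - 1) = w powr h / 2 ^ (m - 1)"
    using pw[OF w] by (simp add: real_sqrt_divide power_divide)
  moreover have "(2 * pi) ^ m = 2 * pi * 2 ^ (m - 1) * (pi powr h * pi powr h)"
  proof -
    have "(2 * pi) ^ m = 2 * pi * (2 * pi) ^ (m - 1)" using m by (simp add: power_eq_if)
    moreover have "pi ^ (m - 1) = pi powr h * pi powr h"
      using pw[of pi] by (metis pi_gt_zero power_mult_distrib real_sqrt_mult_self abs_of_pos)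
    ultimately show ?thesis by (simp add: power_mult_distrib)
  qed
  moreover have "real m powr (3 / 2) = real m * sqrt (real m)"
  proof -
    have "real m powr (3 / 2) = real m powr (1 + 1 / 2)" by simp
    also have "\<dots> = real m * sqrt (real m)" using m unfolding powr_add by (simp add: powr_half_sqrt)
    finally show ?thesis .
  qed
  moreover have "(pi * (1 + T\<^sup>2) * T) powr h = pi powr h * w powr h"
    using w T by (simp add: w_def powr_mult[symmetric] mult_ac)
  moreover have "Gamma ((real m + 1) / 2) > 0" by (intro Gamma_real_pos) simp
  moreover have "pi powr h > 0" "w powr h > 0" using w by auto
  ultimately show ?thesis
    unfolding tight_rate_def[OF m] ball_const_def[OF m] K4_def T_def[symmetric] w_def[symmetric]
        h_def[symmetric] pw[OF t]
    using m by (simp add: field_simps)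
qed

section \<open>The limit theorem\<close>

text \<open>\<open>Arg2pi\<close> is continuous off the nonnegative reals and 0 on them, so cutting
  it off by the indicator of the complement changes nothing.\<close>

lemma Arg2pi_borel_measurable: "Arg2pi \<in> borel_measurable borel"
proof -
  have "- \<real>\<^sub>\<ge>\<^sub>0 \<in> sets (borel :: complex measure)"
    using closed_nonneg_Reals_complex by auto
  moreover have "continuous_on (- \<real>\<^sub>\<ge>\<^sub>0) Arg2pi"
    by (intro continuous_at_imp_continuous_on ballI continuous_at_Arg2pi) auto
  ultimately have "(\<lambda>z. indicator (- \<real>\<^sub>\<ge>\<^sub>0) z *\<^sub>R Arg2pi z) \<in> borel_measurable borel"
    by (rule borel_measurable_continuous_on_indicator)
  moreover have "(\<lambda>z. indicator (- \<real>\<^sub>\<ge>\<^sub>0) z *\<^sub>R Arg2pi z) = Arg2pi"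
  proof
    show "indicator (- \<real>\<^sub>\<ge>\<^sub>0) z *\<^sub>R Arg2pi z = Arg2pi z" for z
      using Arg2pi_eq_0[of z] by (auto simp: indicator_def complex_nonneg_Reals_iff
          complex_is_Real_iff)
  qed
  ultimately show ?thesis by (simp only:)
qed

lemma Arg2pi_cis: "0 \<le> x \<Longrightarrow> x < 2 * pi \<Longrightarrow> Arg2pi (cis x) = x"
  by (rule Arg2pi_unique[where r = 1]) (auto simp: cis_conv_exp)

lemma cis_Arg2pi: "norm z = 1 \<Longrightarrow> cis (Arg2pi z) = z"
  using complex_norm_eq_1_exp[of z] by (simp add: cis_conv_exp)

lemma cis_borel_measurable: "cis \<in> borel_measurable borel"
  by (intro borel_measurable_continuous_onI continuous_intros)

lemma distr_uniform_circle_Arg2pi: "distr uniform_circle borel Arg2pi = uniform_angle"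
proof -
  have "distr uniform_circle borel Arg2pi = distr uniform_angle borel (Arg2pi \<circ> cis)"
    unfolding uniform_circle_def uniform_angle_def
    using Arg2pi_borel_measurable cis_borel_measurable by (subst distr_distr) auto
  also have "\<dots> = distr uniform_angle borel (\<lambda>x. x)"
  proof (rule distr_cong_AE)
    show "AE x in uniform_angle. (Arg2pi \<circ> cis) x = x"
      unfolding uniform_angle_def by (rule AE_uniform_measureI) (auto simp: Arg2pi_cis)
    show "Arg2pi \<circ> cis \<in> borel_measurable uniform_angle"
      using measurable_comp[OF cis_borel_measurable Arg2pi_borel_measurable]
      by (simp add: measurable_cong_sets[OF sets_uniform_angle refl])
  qed auto
  also have "\<dots> = uniform_angle" by (rule distr_id2) simp
  finally show ?thesis .
qed

lemma emeasure_uniform_circle_sphere: "emeasure uniform_circle (sphere 0 1) = 1"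
proof -
  interpret prob_space uniform_angle by (rule prob_space_uniform_angle)
  have "emeasure uniform_circle (sphere 0 1) = emeasure uniform_angle (cis -` sphere 0 1 \<inter> space
      uniform_angle)"
    unfolding uniform_circle_def uniform_angle_def using cis_borel_measurable
    by (subst emeasure_distr) auto
  also have "cis -` sphere 0 1 \<inter> space uniform_angle = space uniform_angle" by auto
  finally show ?thesis by (simp only: emeasure_space_1)
qed

text \<open>Includes \<open>x = \<infinity>\<close>, the value of an empty minimum, where both sides
  fail.\<close>

lemma ereal_scaled_excess_le_iff:
  assumes "a > 0"
  shows "ereal a * (x - ereal y) \<le> ereal t \<longleftrightarrow> x \<le> ereal (y + t / a)"
proof (cases x)
  case (real r)
  have "a * (r - y) \<le> t \<longleftrightarrow> r \<le> y + t / a" using assms by (simp add: field_simps)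
  then show ?thesis using real by simp
qed (use assms in auto)

text \<open>The family of subsets is finite, so the infimum is attained unless the family is
  empty.\<close>

lemma min_area_le_iff:
  "min_area m n u \<le> ereal c \<longleftrightarrow> (\<exists>I. I \<subseteq> {1..n} \<and> card I = m \<and> inj_on u I \<and> determines_polygon (u ` I)
     \<and> measure lebesgue (circumscribed_polygon (u ` I)) \<le> c)"
proof -
  let ?S = "{I. I \<subseteq> {1..n} \<and> card I = m \<and> inj_on u I \<and> determines_polygon (u ` I)}"
  let ?f = "\<lambda>I. ereal (measure lebesgue (circumscribed_polygon (u ` I)))"
  have fin: "finite ?S" by (rule finite_subset[of _ "Pow {1..n}"]) auto
  show ?thesis
  proof (cases "?S = {}")
    case True
    then have "min_area m n u = \<infinity>" unfolding min_area_def
        by (simp only: image_empty) (simp add: top_ereal_def)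
    then show ?thesis using True by auto
  next
    case False
    then have "min_area m n u = Min (?f ` ?S)" unfolding min_area_def using fin
        by (subst Min_Inf) auto
    then have "min_area m n u \<le> ereal c \<longleftrightarrow> (\<exists>I\<in>?S. ?f I \<le> ereal c)"
      using False fin by (subst \<open>min_area m n u = _\<close>, subst Min_le_iff) auto
    then show ?thesis by auto
  qed
qed

lemma polygon_iff_tight_set:
  assumes "finite I" "card I \<ge> 2" and u: "\<And>i. i \<in> I \<Longrightarrow> u i \<in> sphere 0 1"
  shows "inj_on u I \<and> determines_polygon (u ` I) \<and> measure lebesgue (circumscribed_polygon (u ` I))
      \<le> c
    \<longleftrightarrow> tight_set c (\<lambda>i. Arg2pi (u i)) I"
proof -
  have c: "cis (Arg2pi (u i)) = u i" if "i \<in> I" for i using u[OF that] by (simp add: cis_Arg2pi)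
  then have "(\<lambda>i. cis (Arg2pi (u i))) ` I = u ` I" "inj_on (\<lambda>i. cis (Arg2pi (u i))) I \<longleftrightarrow> inj_on u I"
    by (auto intro!: image_cong inj_on_cong)
  then show ?thesis
    using tight_set_iff_polygon[OF assms(1,2), of "\<lambda>i. Arg2pi (u i)" c]
        by (simp add: Arg2pi_ge_0 Arg2pi_lt_2pi)
qed

theorem theorem4:
  fixes M :: "'a measure" and U :: "nat \<Rightarrow> 'a \<Rightarrow> complex" and m :: nat and t :: real
  defines "p \<equiv> \<lambda>n::nat. measure M {\<omega> \<in> space M.
      ereal (real n powr (2 * real m / (real m - 1)))
        * (min_area m n (\<lambda>i. U i \<omega>) - ereal (real m * tan (pi / real m))) \<le> ereal t}"
    and "L \<equiv> 1 - exp (- (t powr ((real m - 1) / 2) / K4 m))"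
  assumes "prob_space M"
    and "m \<ge> 3"
    and "prob_space.indep_vars M (\<lambda>_. borel) U {1..}"
    and "\<And>i. i \<ge> 1 \<Longrightarrow> distr M borel (U i) = uniform_circle"
    and "t > 0"
  shows "p \<longlonglongrightarrow> L \<and> (\<lambda>n. \<bar>p n - L\<bar>) \<in> O(\<lambda>n. real n powr (- 1 / (real m - 1)))"
proof -
  note m = \<open>m \<ge> 3\<close>
  interpret prob_space M by fact
  define \<theta> where "\<theta> i \<omega> = Arg2pi (U i \<omega>)" for i \<omega>
  have U: "U i \<in> borel_measurable M" if "i \<ge> 1" for i
    using assms(5) that unfolding indep_vars_def by auto
  interpret uniform_angles M \<theta>
  proof
    show "indep_vars (\<lambda>_. borel) \<theta> {1..}"
      unfolding \<theta>_def[abs_def] by (rule indep_vars_compose2[OF assms(5)]) (rule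
          Arg2pi_borel_measurable)
    show "distr M borel (\<theta> i) = uniform_angle" if "i \<ge> 1" for i
    proof -
      have "distr M borel (\<theta> i) = distr (distr M borel (U i)) borel Arg2pi"
        using U[OF that] Arg2pi_borel_measurable
            by (subst distr_distr) (auto simp: comp_def \<theta>_def[abs_def])
      then show ?thesis using assms(6)[OF that] distr_uniform_circle_Arg2pi by simp
    qed
  qed
  define r where "r n = real n powr (- 1 / (real m - 1))" for n
  obtain C r0 where r0: "r0 > 0" and rate: "\<And>n r. n \<ge> 1 \<Longrightarrow> 0 < r \<Longrightarrow> r \<le> r0 \<Longrightarrow>
      real n * r ^ (m - 1) = 1 \<Longrightarrow>
    \<bar>prob (no_tight_event m n (real m * tan (pi / real m) + t * (r ^ m)\<^sup>2)) - exp (- (tight_rate m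
        * sqrt t ^ (m - 1)))\<bar> \<le> C * r"
    using no_tight_event_rate[OF m \<open>t > 0\<close>] by metis
  have p_eq: "p n = 1 - prob (no_tight_event m n (real m * tan (pi / real m) + t * (r n ^ m)\<^sup>2))"
    if n: "n \<ge> 1" for n
  proof -
    define c where "c = real m * tan (pi / real m) + t * (r n ^ m)\<^sup>2"
    define F where "F = {I. I \<subseteq> {1..n} \<and> card I = m}"
    have finF: "finite F" unfolding F_def by (rule finite_subset[of _ "Pow {1..n}"]) auto
    have F: "finite I" "I \<subseteq> {1..}" "card I = m" if "I \<in> F" for I
      using that finite_subset[of I "{1..n}"] by (auto simp: F_def)
    define a where "a = real n powr (2 * real m / (real m - 1))"
    have a: "a > 0" using n by (simp add: a_def)
    have ta: "t / a = t * (r n ^ m)\<^sup>2"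
    \<comment> \<open>The powers of \<open>n\<close> match because \<open>r n ^ (2 * m)\<close> is
      \<open>n\<close> to the power \<open>- 2 * m / (m - 1)\<close>.\<close>
    proof -
      have "(r n ^ m)\<^sup>2 = r n ^ (2 * m)" by (simp add: power_mult[symmetric] mult.commute)
      also have "\<dots> = r n powr real (2 * m)" using n by (subst powr_realpow) (auto simp: r_def)
      also have "\<dots> = r n powr (2 * real m)" by simp
      also have "\<dots> = real n powr (- (2 * real m / (real m - 1)))"
        by (simp add: r_def powr_powr)
      finally show ?thesis by (simp add: a_def powr_minus divide_inverse)
    qed
    \<comment> \<open>The \<open>U i\<close> lie on the circle only almost surely. Off it no polygon
      is determined although \<open>Arg2pi\<close> still returns an angle, so an exact, and visibly
      measurable, description of the event needs \<open>S I\<close>; an almost sure argument then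
      removes it.\<close>
    define S where "S I = {\<omega> \<in> space M. \<forall>i\<in>I. U i \<omega> \<in> sphere 0 1}" for I
    have S: "S I \<in> events" if "finite I" "I \<subseteq> {1..}" for I
      unfolding S_def using that U by (intro sets.sets_Collect_finite_All) (auto intro!:
          measurable_sets_borel)
    have "{\<omega> \<in> space M. ereal a * (min_area m n (\<lambda>i. U i \<omega>) - ereal (real m * tan (pi / real m)))
        \<le> ereal t}
       = (\<Union>I\<in>F. S I \<inter> tight_event c I)" (is "?A = _")
    proof (intro antisym subsetI)
      fix \<omega> assume "\<omega> \<in> ?A"
      then have w: "\<omega> \<in> space M" "min_area m n (\<lambda>i. U i \<omega>) \<le> ereal c"
        using ereal_scaled_excess_le_iff[OF a] unfolding c_def ta[symmetric] by auto
      then obtain I where I: "I \<in> F" and P: "inj_on (\<lambda>i. U i \<omega>) I" "determines_polygon ((\<lambda>i. U i \<omega>)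
          ` I)"
        "measure lebesgue (circumscribed_polygon ((\<lambda>i. U i \<omega>) ` I)) \<le> c"
        unfolding min_area_le_iff F_def by blast
      have sph: "U i \<omega> \<in> sphere 0 1" if "i \<in> I" for i using P(2) that
          unfolding determines_polygon_def by blast
      then have "tight_set c (\<lambda>i. \<theta> i \<omega>) I"
        using polygon_iff_tight_set[of I "\<lambda>i. U i \<omega>" c] P F[OF I] m unfolding \<theta>_def by auto
      then show "\<omega> \<in> (\<Union>I\<in>F. S I \<inter> tight_event c I)" using I w sph unfolding S_def tight_event_def
          by blast
    next
      fix \<omega> assume "\<omega> \<in> (\<Union>I\<in>F. S I \<inter> tight_event c I)"
      then obtain I where I: "I \<in> F" and w: "\<omega> \<in> space M" "\<And>i. i \<in> I \<Longrightarrow> U i \<omega> \<in> sphere 0 1"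
        "tight_set c (\<lambda>i. \<theta> i \<omega>) I" unfolding S_def tight_event_def by blast
      have "min_area m n (\<lambda>i. U i \<omega>) \<le> ereal c"
        using polygon_iff_tight_set[of I "\<lambda>i. U i \<omega>" c] w F[OF I] I m
            unfolding min_area_le_iff \<theta>_def F_def by auto
      then show "\<omega> \<in> ?A" using w ereal_scaled_excess_le_iff[OF a] unfolding c_def ta[symmetric]
          by auto
    qed
    then have "p n = prob (\<Union>I\<in>F. S I \<inter> tight_event c I)" unfolding p_def a_def by simp
    also have "\<dots> = prob (\<Union>I\<in>F. tight_event c I)"
    proof (rule measure_eq_AE)
      have "AE \<omega> in M. U i \<omega> \<in> sphere 0 1" if "i \<ge> 1" for i
      proof -
        have "U i -` sphere 0 1 \<inter> space M \<in> events" using U[OF that] by (intro measurable_sets) auto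
        moreover have "emeasure M (U i -` sphere 0 1 \<inter> space M) = 1"
          using emeasure_uniform_circle_sphere U[OF that]
              by (simp add: assms(6)[OF that, symmetric] emeasure_distr)
        then have "prob (U i -` sphere 0 1 \<inter> space M) = 1" by (simp add: measure_def)
        ultimately have "AE \<omega> in M. \<omega> \<in> U i -` sphere 0 1 \<inter> space M" by (simp only: prob_eq_1)
        then show ?thesis by eventually_elim simp
      qed
      then have "AE \<omega> in M. \<forall>i\<in>{1..n}. U i \<omega> \<in> sphere 0 1" by (intro AE_finite_allI) auto
      then show "AE \<omega> in M. \<omega> \<in> (\<Union>I\<in>F. S I \<inter> tight_event c I) \<longleftrightarrow> \<omega> \<in> (\<Union>I\<in>F. tight_event c I)"
      proof eventually_elim
        case (elim \<omega>)
        then have "\<omega> \<in> S I" if "I \<in> F" "\<omega> \<in> tight_event c I" for I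
          using that unfolding S_def tight_event_def F_def by blast
        then show ?case by blast
      qed
    qed (use finF F S sets_tight_event in \<open>auto intro!: sets.finite_UN\<close>)
    also have "\<dots> = 1 - prob (space M - (\<Union>I\<in>F. tight_event c I))"
      using finF F sets_tight_event by (subst prob_compl) (auto intro!: sets.finite_UN)
    also have "space M - (\<Union>I\<in>F. tight_event c I) = no_tight_event m n c"
      unfolding no_tight_event_def F_def by auto
    finally show ?thesis unfolding c_def .
  qed
  have L: "L = 1 - exp (- (tight_rate m * sqrt t ^ (m - 1)))"
    unfolding L_def tight_rate_eq_K4[OF m \<open>t > 0\<close>] ..
  have m1: "real m - 1 > 0" using m by simp
  have rlim: "r \<longlonglongrightarrow> 0"
    unfolding r_def using m1
    by (intro tendsto_neg_powr[OF _ filterlim_real_sequentially]) simp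
  have "\<forall>\<^sub>F n in sequentially. r n < r0" using order_tendstoD(2)[OF rlim r0] .
  then have bound: "\<forall>\<^sub>F n in sequentially. \<bar>p n - L\<bar> \<le> C * r n"
    using eventually_ge_at_top[of 1]
  proof eventually_elim
    case (elim n)
    have r: "r n > 0" using elim by (simp add: r_def)
    have "r n ^ (m - 1) = r n powr (real m - 1)" using r m
        by (simp add: powr_realpow[symmetric] of_nat_diff)
    also have "\<dots> = real n powr (- 1)" using m1 by (simp add: r_def powr_powr)
    finally have "real n * r n ^ (m - 1) = 1" using elim by (simp add: powr_minus)
    then have "\<bar>prob (no_tight_event m n (real m * tan (pi / real m) + t
        * (r n ^ m)\<^sup>2)) - exp (- (tight_rate m * sqrt t ^ (m - 1)))\<bar> \<le> C * r n"
      using elim r by (intro rate) auto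
    then show ?case using p_eq[OF elim(2)] unfolding L by (simp add: abs_le_iff)
  qed
  have O: "(\<lambda>n. \<bar>p n - L\<bar>) \<in> O(\<lambda>n. r n)"
  proof (rule bigoI)
    show "\<forall>\<^sub>F n in sequentially. norm \<bar>p n - L\<bar> \<le> C * norm (r n)"
      using bound by eventually_elim (simp add: r_def)
  qed
  have "(\<lambda>n. p n - L) \<longlonglongrightarrow> 0"
  proof (rule Lim_null_comparison)
    show "\<forall>\<^sub>F n in sequentially. norm (p n - L) \<le> C * r n" using bound by simp
    show "(\<lambda>n. C * r n) \<longlonglongrightarrow> 0" using tendsto_mult_right_zero[OF rlim] .
  qed
  then have "p \<longlonglongrightarrow> L" by (simp add: LIM_zero_iff)
  then show ?thesis using O unfolding r_def by simp
qed

end
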